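(* Let $(\mathcal C,i,\boxtimes,\beta)$ be a braided monoidal category. The symmetric center $\Sigma(\mathcal C)$ classifies braided actions on $\mathcal C$: $\Sigma(\mathcal C)$ acts braidedly on $\mathcal C$ via $\boxtimes:\Sigma(\mathcal C)\times\mathcal C\to\mathcal C$, and for every symmetric monoidal category $\mathcal M$ and every braided action $\bullet:\mathcal M\times\mathcal C\to\mathcal C$, there is a unique $F_\bullet:\mathcal M\to\Sigma(\mathcal C)$ through which $\bullet$ factors as $$\mathcal M\times\mathcal C\xrightarrow{\;F_\bullet\times\mathcal C\;}\Sigma(\mathcal C)\times\mathcal C\xrightarrow{\;\boxtimes\;}\mathcal C .$$ In other words, $(\Sigma(\mathcal C),\boxtimes)$ is terminal in the 2-category $\mathrm{Act}^{\mathrm{cart}}_{\mathbf{BrMonCat}}(\mathcal C)$ of braided actions on $\mathcal C$.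
   Context: Actegories. For a monoidal category $(\mathcal M,j,\otimes,\lambda,\rho,\alpha)$ a left $\mathcal M$-actegory (left $\mathcal M$-action) is a category $\mathcal C$ with a functor $\bullet:\mathcal M\times\mathcal C\to\mathcal C$ and natural isomorphisms $\eta_c:c\to j\bullet c$, $\mu_{m,n,c}:m\bullet(n\bullet c)\to(m\otimes n)\bullet c$ such that $(\alpha_{m,n,p}\bullet c)\circ\mu_{m\otimes n,p,c}\circ\mu_{m,n,p\bullet c}=\mu_{m,n\otimes p,c}\circ(m\bullet\mu_{n,p,c})$, $\mu_{j,m,c}\circ\eta_{m\bullet c}=\lambda_m^{-1}\bullet c$, $\mu_{m,j,c}\circ(m\bullet\eta_c)=\rho_m^{-1}\bullet c$. Braided actions. Let $(\mathcal M,j,\otimes,\sigma)$ be symmetric monoidal and $(\mathcal C,i,\boxtimes,\beta)$ braided monoidal. A braided (monoidal) action of $\mathcal M$ on $\mathcal C$ is a left $\mathcal M$-action $(\bullet,\eta,\mu)$ in which $\bullet:\mathcal M\times\mathcal C\to\mathcal C$ is a strong braided monoidal functor, with natural isomorphisms $\iota_{m,n,c,d}:(m\otimes n)\bullet(c\boxtimes d)\to(m\bullet c)\boxtimes(n\bullet d)$ satisfying in particular $\beta_{m\bullet c,n\bullet d}\circ\iota_{m,n,c,d}=\iota_{n,m,d,c}\circ(\sigma_{m,n}\bullet\beta_{c,d})$, and $\eta,\mu$ are monoidal natural transformations; here $\otimes:\mathcal M\times\mathcal M\to\mathcal M$ is strong monoidal via $m\otimes\sigma_{n,m'}\otimes n':(m\otimes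 n)\otimes(m'\otimes n')\to(m\otimes m')\otimes(n\otimes n')$ (up to associators). Symmetric center. $\Sigma(\mathcal C)$ is the full subcategory of $\mathcal C$ on the objects $c$ such that $\beta_{d,c}\circ\beta_{c,d}=1_{c\boxtimes d}$ for all $d\in\mathcal C$; it is symmetric monoidal with the structure inherited from $\mathcal C$. Its action on $\mathcal C$ is $(s,c)\mapsto s\boxtimes c$, with unitor, multiplicator and interchanger built from the unitor, the associator and the braiding of $\mathcal C$ (the interchanger $s\boxtimes s'\boxtimes c\boxtimes c'\to s\boxtimes c\boxtimes s'\boxtimes c'$ is given by $\beta_{s',c}$). Restriction. For a strong monoidal $R:\mathcal M\to\mathcal N$ with structure $(\epsilon,\varpi)$ and an $\mathcal N$-action $\star$, $R^*\star$ is the $\mathcal M$-action $(m,c)\mapsto R(m)\star c$ with unitor $(\epsilon\star c)\circ\eta_c$ and multiplicator $(\varpi_{m,m'}\star c)\circ\mu_{R(m),R(m'),c}$. The 2-category $\mathrm{Act}^{\mathrm{cart}}_{\mathbf{BrMonCat}}(\mathcal C)$: objects are pairs $(\mathcal M,\bullet)$ with $\mathcal M$ symmetric monoidal and $\bullet$ a braided action on $\mathcal C$; a morphism $(\mathcal M,\bullet)\to(\mathcal N,\star)$ is a strong braided (i.e. symmetric) monoidal functor $R:\mathcal M\to\mathcal N$ together with an identification $R^*\star\cong\bullet$ (a natural isomorphism $R(m)\star c\cong m\bullet c$ compatible with unitors, multiplicators and interchangers); 2-cells are monoidal natural transformations compatible with these identifications. Uniqueness and terminality are understood in the usual 2-categorical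 (pseudo) sense: the hom-category into the terminal object is equivalent to the one-object, one-morphism category. *)

theory Defs
  imports Main "HOL-Library.FuncSet"
begin

text \<open>
  A category is given by carrier sets of objects and arrows; the operations are total functions
  that are meaningful on the carriers only.  \<open>g \<cdot> f\<close> is "first \<open>f\<close>, then \<open>g\<close>".
\<close>

record ('o, 'a) cat =
  Obj :: "'o set"
  Arr :: "'a set"
  Dom :: "'a \<Rightarrow> 'o"
  Cod :: "'a \<Rightarrow> 'o"
  Ide :: "'o \<Rightarrow> 'a"
  Comp :: "'a \<Rightarrow> 'a \<Rightarrow> 'a"  (infixr "\<cdot>\<index>" 60)

definition hom :: "('o, 'a, 'z) cat_scheme \<Rightarrow> 'o \<Rightarrow> 'o \<Rightarrow> 'a set" where
  "hom C a b = {f \<in> Arr C. Dom C f = a \<and> Cod C f = b}"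

definition inverse_arrows :: "('o, 'a, 'z) cat_scheme \<Rightarrow> 'a \<Rightarrow> 'a \<Rightarrow> bool" where
  "inverse_arrows C f g \<longleftrightarrow>
     f \<in> hom C (Dom C f) (Cod C f) \<and> g \<in> hom C (Cod C f) (Dom C f) \<and>
     g \<cdot>\<^bsub>C\<^esub> f = Ide C (Dom C f) \<and> f \<cdot>\<^bsub>C\<^esub> g = Ide C (Cod C f)"

definition iso :: "('o, 'a, 'z) cat_scheme \<Rightarrow> 'a \<Rightarrow> bool" where
  "iso C f \<longleftrightarrow> (\<exists>g. inverse_arrows C f g)"

definition inv_arr :: "('o, 'a, 'z) cat_scheme \<Rightarrow> 'a \<Rightarrow> 'a" where
  "inv_arr C f = (THE g. inverse_arrows C f g)"

locale category =
  fixes C :: "('o, 'a, 'z) cat_scheme" (structure)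
  assumes dom_obj: "f \<in> Arr C \<Longrightarrow> Dom C f \<in> Obj C"
    and cod_obj: "f \<in> Arr C \<Longrightarrow> Cod C f \<in> Obj C"
    and ide_hom: "a \<in> Obj C \<Longrightarrow> Ide C a \<in> hom C a a"
    and comp_hom: "f \<in> hom C a b \<Longrightarrow> g \<in> hom C b c \<Longrightarrow> g \<cdot> f \<in> hom C a c"
    and comp_ide_left: "f \<in> hom C a b \<Longrightarrow> Ide C b \<cdot> f = f"
    and comp_ide_right: "f \<in> hom C a b \<Longrightarrow> f \<cdot> Ide C a = f"
    and comp_assoc:
      "f \<in> hom C a b \<Longrightarrow> g \<in> hom C b c \<Longrightarrow> h \<in> hom C c d \<Longrightarrow> (h \<cdot> g) \<cdot> f = h \<cdot> (g \<cdot> f)"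

record ('o1, 'a1, 'o2, 'a2) func =
  FObj :: "'o1 \<Rightarrow> 'o2"
  FArr :: "'a1 \<Rightarrow> 'a2"

locale cat_functor = C: category C + D: category D
  for C :: "('o1, 'a1, 'z1) cat_scheme" and D :: "('o2, 'a2, 'z2) cat_scheme" +
  fixes F :: "('o1, 'a1, 'o2, 'a2, 'z) func_scheme"
  assumes fobj: "x \<in> Obj C \<Longrightarrow> FObj F x \<in> Obj D"
    and farr: "f \<in> hom C x y \<Longrightarrow> FArr F f \<in> hom D (FObj F x) (FObj F y)"
    and fide: "x \<in> Obj C \<Longrightarrow> FArr F (Ide C x) = Ide D (FObj F x)"
    and fcomp: "f \<in> hom C x y \<Longrightarrow> g \<in> hom C y z \<Longrightarrow>
      FArr F (g \<cdot>\<^bsub>C\<^esub> f) = FArr F g \<cdot>\<^bsub>D\<^esub> FArr F f"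

locale natural_transformation = F: cat_functor C D F + G: cat_functor C D G
  for C :: "('o1, 'a1, 'z1) cat_scheme" and D :: "('o2, 'a2, 'z2) cat_scheme"
    and F :: "('o1, 'a1, 'o2, 'a2, 'y1) func_scheme"
    and G :: "('o1, 'a1, 'o2, 'a2, 'y2) func_scheme" +
  fixes \<tau> :: "'o1 \<Rightarrow> 'a2"
  assumes component: "x \<in> Obj C \<Longrightarrow> \<tau> x \<in> hom D (FObj F x) (FObj G x)"
    and natural: "f \<in> hom C x y \<Longrightarrow> FArr G f \<cdot>\<^bsub>D\<^esub> \<tau> x = \<tau> y \<cdot>\<^bsub>D\<^esub> FArr F f"

locale natural_isomorphism = natural_transformation +
  assumes component_iso: "x \<in> Obj C \<Longrightarrow> iso D (\<tau> x)"

definition id_func :: "('o, 'a, 'o, 'a) func" where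
  "id_func = \<lparr>FObj = (\<lambda>x. x), FArr = (\<lambda>f. f)\<rparr>"

definition comp_func ::
  "('o2, 'a2, 'o3, 'a3, 'y) func_scheme \<Rightarrow> ('o1, 'a1, 'o2, 'a2, 'z) func_scheme
    \<Rightarrow> ('o1, 'a1, 'o3, 'a3) func" where
  "comp_func G F = \<lparr>FObj = FObj G \<circ> FObj F, FArr = FArr G \<circ> FArr F\<rparr>"

definition equivalent_categories ::
  "('o1, 'a1, 'z1) cat_scheme \<Rightarrow> ('o2, 'a2, 'z2) cat_scheme \<Rightarrow> bool" where
  "equivalent_categories C D \<longleftrightarrow>
     (\<exists>(F :: ('o1, 'a1, 'o2, 'a2) func) (G :: ('o2, 'a2, 'o1, 'a1) func) \<tau> \<upsilon>.
        cat_functor C D F \<and> cat_functor D C G \<and>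
        natural_isomorphism C C id_func (comp_func G F) \<tau> \<and>
        natural_isomorphism D D (comp_func F G) id_func \<upsilon>)"

definition one_cat :: "(unit, unit) cat" where
  "one_cat = \<lparr>Obj = {()}, Arr = {()}, Dom = (\<lambda>_. ()), Cod = (\<lambda>_. ()), Ide = (\<lambda>_. ()),
              Comp = (\<lambda>_ _. ())\<rparr>"

definition prod_cat ::
  "('o1, 'a1, 'z1) cat_scheme \<Rightarrow> ('o2, 'a2, 'z2) cat_scheme \<Rightarrow> ('o1 \<times> 'o2, 'a1 \<times> 'a2) cat" where
  "prod_cat C D =
     \<lparr>Obj = Obj C \<times> Obj D, Arr = Arr C \<times> Arr D,
      Dom = map_prod (Dom C) (Dom D), Cod = map_prod (Cod C) (Cod D),
      Ide = map_prod (Ide C) (Ide D),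
      Comp = (\<lambda>(g, g') (f, f'). (g \<cdot>\<^bsub>C\<^esub> f, g' \<cdot>\<^bsub>D\<^esub> f'))\<rparr>"

text \<open>
  \<open>\<otimes>\<close> is the tensor product of objects, \<open>\<odot>\<close> that of arrows.  The structure isomorphisms are
  \<open>Lun a : I \<otimes> a \<rightarrow> a\<close>, \<open>Run a : a \<otimes> I \<rightarrow> a\<close>,
  \<open>Assoc a b c : (a \<otimes> b) \<otimes> c \<rightarrow> a \<otimes> (b \<otimes> c)\<close> and \<open>Braid a b : a \<otimes> b \<rightarrow> b \<otimes> a\<close>.
\<close>

record ('o, 'a) moncat = "('o, 'a) cat" +
  Unit :: 'o
  TObj :: "'o \<Rightarrow> 'o \<Rightarrow> 'o"  (infixr "\<otimes>\<index>" 70)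
  TArr :: "'a \<Rightarrow> 'a \<Rightarrow> 'a"  (infixr "\<odot>\<index>" 70)
  Lun :: "'o \<Rightarrow> 'a"
  Run :: "'o \<Rightarrow> 'a"
  Assoc :: "'o \<Rightarrow> 'o \<Rightarrow> 'o \<Rightarrow> 'a"

record ('o, 'a) brmoncat = "('o, 'a) moncat" +
  Braid :: "'o \<Rightarrow> 'o \<Rightarrow> 'a"

locale monoidal_category = category C
  for C :: "('o, 'a, 'z) moncat_scheme" (structure) +
  assumes unit_obj: "Unit C \<in> Obj C"
    and tensor_obj: "a \<in> Obj C \<Longrightarrow> b \<in> Obj C \<Longrightarrow> a \<otimes> b \<in> Obj C"
    and tensor_hom: "f \<in> hom C a a' \<Longrightarrow> g \<in> hom C b b' \<Longrightarrow> f \<odot> g \<in> hom C (a \<otimes> b) (a' \<otimes> b')"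
    and tensor_ide: "a \<in> Obj C \<Longrightarrow> b \<in> Obj C \<Longrightarrow> Ide C a \<odot> Ide C b = Ide C (a \<otimes> b)"
    and tensor_comp:
      "f \<in> hom C a a' \<Longrightarrow> f' \<in> hom C a' a'' \<Longrightarrow> g \<in> hom C b b' \<Longrightarrow> g' \<in> hom C b' b'' \<Longrightarrow>
       (f' \<cdot> f) \<odot> (g' \<cdot> g) = (f' \<odot> g') \<cdot> (f \<odot> g)"
    and lun_hom: "a \<in> Obj C \<Longrightarrow> Lun C a \<in> hom C (Unit C \<otimes> a) a"
    and lun_iso: "a \<in> Obj C \<Longrightarrow> iso C (Lun C a)"
    and lun_natural: "f \<in> hom C a b \<Longrightarrow> f \<cdot> Lun C a = Lun C b \<cdot> (Ide C (Unit C) \<odot> f)"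
    and run_hom: "a \<in> Obj C \<Longrightarrow> Run C a \<in> hom C (a \<otimes> Unit C) a"
    and run_iso: "a \<in> Obj C \<Longrightarrow> iso C (Run C a)"
    and run_natural: "f \<in> hom C a b \<Longrightarrow> f \<cdot> Run C a = Run C b \<cdot> (f \<odot> Ide C (Unit C))"
    and assoc_hom: "a \<in> Obj C \<Longrightarrow> b \<in> Obj C \<Longrightarrow> c \<in> Obj C \<Longrightarrow>
      Assoc C a b c \<in> hom C ((a \<otimes> b) \<otimes> c) (a \<otimes> (b \<otimes> c))"
    and assoc_iso: "a \<in> Obj C \<Longrightarrow> b \<in> Obj C \<Longrightarrow> c \<in> Obj C \<Longrightarrow> iso C (Assoc C a b c)"
    and assoc_natural:
      "f \<in> hom C a a' \<Longrightarrow> g \<in> hom C b b' \<Longrightarrow> h \<in> hom C c c' \<Longrightarrow>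
       (f \<odot> (g \<odot> h)) \<cdot> Assoc C a b c = Assoc C a' b' c' \<cdot> ((f \<odot> g) \<odot> h)"
    and triangle: "a \<in> Obj C \<Longrightarrow> b \<in> Obj C \<Longrightarrow>
      (Ide C a \<odot> Lun C b) \<cdot> Assoc C a (Unit C) b = Run C a \<odot> Ide C b"
    and pentagon: "a \<in> Obj C \<Longrightarrow> b \<in> Obj C \<Longrightarrow> c \<in> Obj C \<Longrightarrow> d \<in> Obj C \<Longrightarrow>
      (Ide C a \<odot> Assoc C b c d) \<cdot> Assoc C a (b \<otimes> c) d \<cdot> (Assoc C a b c \<odot> Ide C d) =
      Assoc C a b (c \<otimes> d) \<cdot> Assoc C (a \<otimes> b) c d"

locale braided_monoidal_category = monoidal_category C
  for C :: "('o, 'a, 'z) brmoncat_scheme" (structure) +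
  assumes braid_hom: "a \<in> Obj C \<Longrightarrow> b \<in> Obj C \<Longrightarrow> Braid C a b \<in> hom C (a \<otimes> b) (b \<otimes> a)"
    and braid_iso: "a \<in> Obj C \<Longrightarrow> b \<in> Obj C \<Longrightarrow> iso C (Braid C a b)"
    and braid_natural: "f \<in> hom C a a' \<Longrightarrow> g \<in> hom C b b' \<Longrightarrow>
      (g \<odot> f) \<cdot> Braid C a b = Braid C a' b' \<cdot> (f \<odot> g)"
    and hexagon1: "a \<in> Obj C \<Longrightarrow> b \<in> Obj C \<Longrightarrow> c \<in> Obj C \<Longrightarrow>
      Assoc C b c a \<cdot> Braid C a (b \<otimes> c) \<cdot> Assoc C a b c =
      (Ide C b \<odot> Braid C a c) \<cdot> Assoc C b a c \<cdot> (Braid C a b \<odot> Ide C c)"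
    and hexagon2: "a \<in> Obj C \<Longrightarrow> b \<in> Obj C \<Longrightarrow> c \<in> Obj C \<Longrightarrow>
      inv_arr C (Assoc C c a b) \<cdot> Braid C (a \<otimes> b) c \<cdot> inv_arr C (Assoc C a b c) =
      (Braid C a c \<odot> Ide C b) \<cdot> inv_arr C (Assoc C a c b) \<cdot> (Ide C a \<odot> Braid C b c)"

locale symmetric_monoidal_category = braided_monoidal_category C
  for C :: "('o, 'a, 'z) brmoncat_scheme" (structure) +
  assumes symmetry: "a \<in> Obj C \<Longrightarrow> b \<in> Obj C \<Longrightarrow> Braid C b a \<cdot> Braid C a b = Ide C (a \<otimes> b)"

definition prod_brmoncat ::
  "('o1, 'a1) brmoncat \<Rightarrow> ('o2, 'a2) brmoncat \<Rightarrow> ('o1 \<times> 'o2, 'a1 \<times> 'a2) brmoncat" where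
  "prod_brmoncat C D =
     \<lparr>Obj = Obj (prod_cat C D), Arr = Arr (prod_cat C D),
      Dom = Dom (prod_cat C D), Cod = Cod (prod_cat C D),
      Ide = Ide (prod_cat C D), Comp = Comp (prod_cat C D),
      Unit = (Unit C, Unit D),
      TObj = (\<lambda>(a, a') (b, b'). (a \<otimes>\<^bsub>C\<^esub> b, a' \<otimes>\<^bsub>D\<^esub> b')),
      TArr = (\<lambda>(f, f') (g, g'). (f \<odot>\<^bsub>C\<^esub> g, f' \<odot>\<^bsub>D\<^esub> g')),
      Lun = map_prod (Lun C) (Lun D),
      Run = map_prod (Run C) (Run D),
      Assoc = (\<lambda>(a, a') (b, b') (c, c'). (Assoc C a b c, Assoc D a' b' c')),
      Braid = (\<lambda>(a, a') (b, b'). (Braid C a b, Braid D a' b'))\<rparr>"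

text \<open>
  The middle-four interchange \<open>(a \<otimes> b) \<otimes> (c \<otimes> d) \<rightarrow> (a \<otimes> c) \<otimes> (b \<otimes> d)\<close>, i.e.
  \<open>a \<otimes> Braid b c \<otimes> d\<close> with the associators written out.
\<close>

definition interchange :: "('o, 'a, 'z) brmoncat_scheme \<Rightarrow> 'o \<Rightarrow> 'o \<Rightarrow> 'o \<Rightarrow> 'o \<Rightarrow> 'a" where
  "interchange C a b c d =
     inv_arr C (Assoc C a c (b \<otimes>\<^bsub>C\<^esub> d)) \<cdot>\<^bsub>C\<^esub>
     (Ide C a \<odot>\<^bsub>C\<^esub>
        (Assoc C c b d \<cdot>\<^bsub>C\<^esub> (Braid C b c \<odot>\<^bsub>C\<^esub> Ide C d) \<cdot>\<^bsub>C\<^esub> inv_arr C (Assoc C b c d))) \<cdot>\<^bsub>C\<^esub>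
     Assoc C a b (c \<otimes>\<^bsub>C\<^esub> d)"

text \<open>
  \<open>FUnit F : I \<rightarrow> F I\<close> and \<open>FTen F x y : F x \<otimes> F y \<rightarrow> F (x \<otimes> y)\<close>.
\<close>

record ('o1, 'a1, 'o2, 'a2) mfunc = "('o1, 'a1, 'o2, 'a2) func" +
  FUnit :: 'a2
  FTen :: "'o1 \<Rightarrow> 'o1 \<Rightarrow> 'a2"

locale strong_monoidal_functor =
  C: monoidal_category C + D: monoidal_category D + cat_functor C D F
  for C :: "('o1, 'a1, 'z1) moncat_scheme" and D :: "('o2, 'a2, 'z2) moncat_scheme"
    and F :: "('o1, 'a1, 'o2, 'a2, 'z) mfunc_scheme" +
  assumes funit_hom: "FUnit F \<in> hom D (Unit D) (FObj F (Unit C))"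
    and funit_iso: "iso D (FUnit F)"
    and ften_hom: "x \<in> Obj C \<Longrightarrow> y \<in> Obj C \<Longrightarrow>
      FTen F x y \<in> hom D (FObj F x \<otimes>\<^bsub>D\<^esub> FObj F y) (FObj F (x \<otimes>\<^bsub>C\<^esub> y))"
    and ften_iso: "x \<in> Obj C \<Longrightarrow> y \<in> Obj C \<Longrightarrow> iso D (FTen F x y)"
    and ften_natural: "f \<in> hom C x x' \<Longrightarrow> g \<in> hom C y y' \<Longrightarrow>
      FArr F (f \<odot>\<^bsub>C\<^esub> g) \<cdot>\<^bsub>D\<^esub> FTen F x y = FTen F x' y' \<cdot>\<^bsub>D\<^esub> (FArr F f \<odot>\<^bsub>D\<^esub> FArr F g)"
    and ften_assoc: "x \<in> Obj C \<Longrightarrow> y \<in> Obj C \<Longrightarrow> z \<in> Obj C \<Longrightarrow>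
      FArr F (Assoc C x y z) \<cdot>\<^bsub>D\<^esub> FTen F (x \<otimes>\<^bsub>C\<^esub> y) z \<cdot>\<^bsub>D\<^esub> (FTen F x y \<odot>\<^bsub>D\<^esub> Ide D (FObj F z)) =
      FTen F x (y \<otimes>\<^bsub>C\<^esub> z) \<cdot>\<^bsub>D\<^esub> (Ide D (FObj F x) \<odot>\<^bsub>D\<^esub> FTen F y z) \<cdot>\<^bsub>D\<^esub>
        Assoc D (FObj F x) (FObj F y) (FObj F z)"
    and ften_lun: "x \<in> Obj C \<Longrightarrow>
      FArr F (Lun C x) \<cdot>\<^bsub>D\<^esub> FTen F (Unit C) x \<cdot>\<^bsub>D\<^esub> (FUnit F \<odot>\<^bsub>D\<^esub> Ide D (FObj F x)) =
      Lun D (FObj F x)"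
    and ften_run: "x \<in> Obj C \<Longrightarrow>
      FArr F (Run C x) \<cdot>\<^bsub>D\<^esub> FTen F x (Unit C) \<cdot>\<^bsub>D\<^esub> (Ide D (FObj F x) \<odot>\<^bsub>D\<^esub> FUnit F) =
      Run D (FObj F x)"

locale strong_braided_monoidal_functor =
  C: braided_monoidal_category C + D: braided_monoidal_category D + strong_monoidal_functor C D F
  for C :: "('o1, 'a1, 'z1) brmoncat_scheme" and D :: "('o2, 'a2, 'z2) brmoncat_scheme"
    and F :: "('o1, 'a1, 'o2, 'a2, 'z) mfunc_scheme" +
  assumes ften_braid: "x \<in> Obj C \<Longrightarrow> y \<in> Obj C \<Longrightarrow>
      FArr F (Braid C x y) \<cdot>\<^bsub>D\<^esub> FTen F x y = FTen F y x \<cdot>\<^bsub>D\<^esub> Braid D (FObj F x) (FObj F y)"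

locale monoidal_transformation =
  F: strong_monoidal_functor C D F + G: strong_monoidal_functor C D G +
  natural_transformation C D F G \<tau>
  for C :: "('o1, 'a1, 'z1) moncat_scheme" and D :: "('o2, 'a2, 'z2) moncat_scheme"
    and F :: "('o1, 'a1, 'o2, 'a2, 'y1) mfunc_scheme"
    and G :: "('o1, 'a1, 'o2, 'a2, 'y2) mfunc_scheme"
    and \<tau> :: "'o1 \<Rightarrow> 'a2" +
  assumes trans_unit: "\<tau> (Unit C) \<cdot>\<^bsub>D\<^esub> FUnit F = FUnit G"
    and trans_tensor: "x \<in> Obj C \<Longrightarrow> y \<in> Obj C \<Longrightarrow>
      \<tau> (x \<otimes>\<^bsub>C\<^esub> y) \<cdot>\<^bsub>D\<^esub> FTen F x y = FTen G x y \<cdot>\<^bsub>D\<^esub> (\<tau> x \<odot>\<^bsub>D\<^esub> \<tau> y)"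

definition id_mfunc :: "('o, 'a, 'z) moncat_scheme \<Rightarrow> ('o, 'a, 'o, 'a) mfunc" where
  "id_mfunc C =
     \<lparr>FObj = (\<lambda>x. x), FArr = (\<lambda>f. f),
      FUnit = Ide C (Unit C), FTen = (\<lambda>x y. Ide C (x \<otimes>\<^bsub>C\<^esub> y))\<rparr>"

definition comp_mfunc ::
  "('o3, 'a3, 'z) moncat_scheme \<Rightarrow> ('o2, 'a2, 'o3, 'a3) mfunc \<Rightarrow> ('o1, 'a1, 'o2, 'a2) mfunc
    \<Rightarrow> ('o1, 'a1, 'o3, 'a3) mfunc" where
  "comp_mfunc E G F =
     \<lparr>FObj = FObj G \<circ> FObj F, FArr = FArr G \<circ> FArr F,
      FUnit = FArr G (FUnit F) \<cdot>\<^bsub>E\<^esub> FUnit G,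
      FTen = (\<lambda>x y. FArr G (FTen F x y) \<cdot>\<^bsub>E\<^esub> FTen G (FObj F x) (FObj F y))\<rparr>"

definition prod_mfunc ::
  "('o1, 'a1, 'o2, 'a2) mfunc \<Rightarrow> ('p1, 'b1, 'p2, 'b2) mfunc
    \<Rightarrow> ('o1 \<times> 'p1, 'a1 \<times> 'b1, 'o2 \<times> 'p2, 'a2 \<times> 'b2) mfunc" where
  "prod_mfunc F G =
     \<lparr>FObj = map_prod (FObj F) (FObj G), FArr = map_prod (FArr F) (FArr G),
      FUnit = (FUnit F, FUnit G),
      FTen = (\<lambda>(x, x') (y, y'). (FTen F x y, FTen G x' y'))\<rparr>"

definition assoc_mfunc ::
  "('m, 'f) brmoncat \<Rightarrow> ('n, 'g) brmoncat \<Rightarrow> ('o, 'a) brmoncat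
    \<Rightarrow> ('m \<times> 'n \<times> 'o, 'f \<times> 'g \<times> 'a, ('m \<times> 'n) \<times> 'o, ('f \<times> 'g) \<times> 'a) mfunc" where
  "assoc_mfunc M N C =
     (let P = prod_brmoncat (prod_brmoncat M N) C; as = (\<lambda>(m, n, c). ((m, n), c)) in
      \<lparr>FObj = as, FArr = (\<lambda>(f, g, h). ((f, g), h)),
       FUnit = Ide P (Unit P),
       FTen = (\<lambda>x y. Ide P (as x \<otimes>\<^bsub>P\<^esub> as y))\<rparr>)"

definition unit_mfunc ::
  "('m, 'f) brmoncat \<Rightarrow> ('o, 'a) brmoncat \<Rightarrow> ('o, 'a, 'm \<times> 'o, 'f \<times> 'a) mfunc" where
  "unit_mfunc M C =
     \<lparr>FObj = (\<lambda>c. (Unit M, c)), FArr = (\<lambda>f. (Ide M (Unit M), f)),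
      FUnit = (Ide M (Unit M), Ide C (Unit C)),
      FTen = (\<lambda>c d. (Lun M (Unit M), Ide C (c \<otimes>\<^bsub>C\<^esub> d)))\<rparr>"

definition tensor_mfunc :: "('m, 'f) brmoncat \<Rightarrow> ('m \<times> 'm, 'f \<times> 'f, 'm, 'f) mfunc" where
  "tensor_mfunc M =
     \<lparr>FObj = (\<lambda>(m, n). m \<otimes>\<^bsub>M\<^esub> n), FArr = (\<lambda>(f, g). f \<odot>\<^bsub>M\<^esub> g),
      FUnit = inv_arr M (Lun M (Unit M)),
      FTen = (\<lambda>(m, n) (m', n'). interchange M m n m' n')\<rparr>"

text \<open>
  The data of an action of \<open>M\<close> on \<open>C\<close>, with unit objects \<open>j\<close> and \<open>i\<close>:
  the functor \<open>(ActO, ActA)\<close>, the unitor \<open>Eta c : c \<rightarrow> j \<bullet> c\<close>,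
  the multiplicator \<open>Mult m n c : m \<bullet> (n \<bullet> c) \<rightarrow> (m \<otimes> n) \<bullet> c\<close>,
  the interchanger \<open>Iota m n c d : (m \<otimes> n) \<bullet> (c \<otimes> d) \<rightarrow> (m \<bullet> c) \<otimes> (n \<bullet> d)\<close>
  and the unit comparison \<open>ActUnit : i \<rightarrow> j \<bullet> i\<close>.  The last two turn \<open>\<bullet>\<close> into a
  monoidal functor; monoidality of \<open>Eta\<close> forces \<open>ActUnit = Eta i\<close>.
\<close>

record ('m, 'f, 'o, 'a) act =
  ActO :: "'m \<Rightarrow> 'o \<Rightarrow> 'o"
  ActA :: "'f \<Rightarrow> 'a \<Rightarrow> 'a"
  Eta :: "'o \<Rightarrow> 'a"
  Mult :: "'m \<Rightarrow> 'm \<Rightarrow> 'o \<Rightarrow> 'a"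
  Iota :: "'m \<Rightarrow> 'm \<Rightarrow> 'o \<Rightarrow> 'o \<Rightarrow> 'a"
  ActUnit :: 'a

definition act_func :: "('m, 'f, 'o, 'a) act \<Rightarrow> ('m \<times> 'o, 'f \<times> 'a, 'o, 'a) func" where
  "act_func A = \<lparr>FObj = (\<lambda>(m, c). ActO A m c), FArr = (\<lambda>(f, g). ActA A f g)\<rparr>"

locale left_action =
  M: monoidal_category M + C: category C + act_func: cat_functor "prod_cat M C" C "act_func A"
  for M :: "('m, 'f, 'z1) moncat_scheme" and C :: "('o, 'a, 'z2) cat_scheme"
    and A :: "('m, 'f, 'o, 'a) act" +
  assumes eta_hom: "c \<in> Obj C \<Longrightarrow> Eta A c \<in> hom C c (ActO A (Unit M) c)"
    and eta_iso: "c \<in> Obj C \<Longrightarrow> iso C (Eta A c)"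
    and eta_natural: "h \<in> hom C c c' \<Longrightarrow>
      ActA A (Ide M (Unit M)) h \<cdot>\<^bsub>C\<^esub> Eta A c = Eta A c' \<cdot>\<^bsub>C\<^esub> h"
    and mult_hom: "m \<in> Obj M \<Longrightarrow> n \<in> Obj M \<Longrightarrow> c \<in> Obj C \<Longrightarrow>
      Mult A m n c \<in> hom C (ActO A m (ActO A n c)) (ActO A (m \<otimes>\<^bsub>M\<^esub> n) c)"
    and mult_iso: "m \<in> Obj M \<Longrightarrow> n \<in> Obj M \<Longrightarrow> c \<in> Obj C \<Longrightarrow> iso C (Mult A m n c)"
    and mult_natural: "f \<in> hom M m m' \<Longrightarrow> g \<in> hom M n n' \<Longrightarrow> h \<in> hom C c c' \<Longrightarrow>
      ActA A (f \<odot>\<^bsub>M\<^esub> g) h \<cdot>\<^bsub>C\<^esub> Mult A m n c = Mult A m' n' c' \<cdot>\<^bsub>C\<^esub> ActA A f (ActA A g h)"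
    and mult_assoc: "m \<in> Obj M \<Longrightarrow> n \<in> Obj M \<Longrightarrow> p \<in> Obj M \<Longrightarrow> c \<in> Obj C \<Longrightarrow>
      ActA A (Assoc M m n p) (Ide C c) \<cdot>\<^bsub>C\<^esub> Mult A (m \<otimes>\<^bsub>M\<^esub> n) p c \<cdot>\<^bsub>C\<^esub> Mult A m n (ActO A p c) =
      Mult A m (n \<otimes>\<^bsub>M\<^esub> p) c \<cdot>\<^bsub>C\<^esub> ActA A (Ide M m) (Mult A n p c)"
    and mult_lun: "m \<in> Obj M \<Longrightarrow> c \<in> Obj C \<Longrightarrow>
      Mult A (Unit M) m c \<cdot>\<^bsub>C\<^esub> Eta A (ActO A m c) = ActA A (inv_arr M (Lun M m)) (Ide C c)"
    and mult_run: "m \<in> Obj M \<Longrightarrow> c \<in> Obj C \<Longrightarrow>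
      Mult A m (Unit M) c \<cdot>\<^bsub>C\<^esub> ActA A (Ide M m) (Eta A c) = ActA A (inv_arr M (Run M m)) (Ide C c)"

text \<open>
  \<open>\<bullet> : M \<times> C \<rightarrow> C\<close> as a monoidal functor.  The interchanger points from \<open>F (x \<otimes> y)\<close> to
  \<open>F x \<otimes> F y\<close>, hence the inverse.
\<close>

definition act_mfunc ::
  "('o, 'a) brmoncat \<Rightarrow> ('m, 'f, 'o, 'a) act \<Rightarrow> ('m \<times> 'o, 'f \<times> 'a, 'o, 'a) mfunc" where
  "act_mfunc C A =
     \<lparr>FObj = (\<lambda>(m, c). ActO A m c), FArr = (\<lambda>(f, g). ActA A f g),
      FUnit = ActUnit A,
      FTen = (\<lambda>(m, c) (n, d). inv_arr C (Iota A m n c d))\<rparr>"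

locale braided_action =
  M: symmetric_monoidal_category M + C: braided_monoidal_category C + left_action M C A +
  act_mfunc: strong_braided_monoidal_functor "prod_brmoncat M C" C "act_mfunc C A" +
  eta: monoidal_transformation C C
    "id_mfunc C"
    "comp_mfunc C (act_mfunc C A) (unit_mfunc M C)"
    "Eta A" +
  mult: monoidal_transformation "prod_brmoncat M (prod_brmoncat M C)" C
    "comp_mfunc C (act_mfunc C A) (prod_mfunc (id_mfunc M) (act_mfunc C A))"
    "comp_mfunc C (act_mfunc C A)
       (comp_mfunc (prod_brmoncat M C) (prod_mfunc (tensor_mfunc M) (id_mfunc C))
         (assoc_mfunc M M C))"
    "\<lambda>(m, n, c). Mult A m n c"
  for M :: "('m, 'f) brmoncat" and C :: "('o, 'a) brmoncat" and A :: "('m, 'f, 'o, 'a) act" +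
  assumes iota_hom: "m \<in> Obj M \<Longrightarrow> n \<in> Obj M \<Longrightarrow> c \<in> Obj C \<Longrightarrow> d \<in> Obj C \<Longrightarrow>
      Iota A m n c d \<in> hom C (ActO A (m \<otimes>\<^bsub>M\<^esub> n) (c \<otimes>\<^bsub>C\<^esub> d)) (ActO A m c \<otimes>\<^bsub>C\<^esub> ActO A n d)"
    and iota_iso: "m \<in> Obj M \<Longrightarrow> n \<in> Obj M \<Longrightarrow> c \<in> Obj C \<Longrightarrow> d \<in> Obj C \<Longrightarrow>
      iso C (Iota A m n c d)"

definition restrict_act ::
  "('m, 'f, 'n, 'g, 'z) mfunc_scheme \<Rightarrow> ('n, 'g) brmoncat \<Rightarrow> ('o, 'a) brmoncat
    \<Rightarrow> ('n, 'g, 'o, 'a) act \<Rightarrow> ('m, 'f, 'o, 'a) act" where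
  "restrict_act R N C B =
     \<lparr>ActO = (\<lambda>m c. ActO B (FObj R m) c),
      ActA = (\<lambda>f g. ActA B (FArr R f) g),
      Eta = (\<lambda>c. ActA B (FUnit R) (Ide C c) \<cdot>\<^bsub>C\<^esub> Eta B c),
      Mult = (\<lambda>m n c. ActA B (FTen R m n) (Ide C c) \<cdot>\<^bsub>C\<^esub> Mult B (FObj R m) (FObj R n) c),
      Iota = (\<lambda>m n c d. Iota B (FObj R m) (FObj R n) c d \<cdot>\<^bsub>C\<^esub>
                ActA B (inv_arr N (FTen R m n)) (Ide C (c \<otimes>\<^bsub>C\<^esub> d))),
      ActUnit = ActA B (FUnit R) (Ide C (Unit C)) \<cdot>\<^bsub>C\<^esub> ActUnit B\<rparr>"

definition action_isomorphism ::
  "('m, 'f) brmoncat \<Rightarrow> ('o, 'a) brmoncat \<Rightarrow> ('m, 'f, 'o, 'a) act \<Rightarrow> ('m, 'f, 'o, 'a) act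
    \<Rightarrow> ('m \<Rightarrow> 'o \<Rightarrow> 'a) \<Rightarrow> bool" where
  "action_isomorphism M C A B \<theta> \<longleftrightarrow>
     natural_isomorphism (prod_cat M C) C (act_func A) (act_func B) (\<lambda>(m, c). \<theta> m c) \<and>
     (\<forall>c\<in>Obj C. \<theta> (Unit M) c \<cdot>\<^bsub>C\<^esub> Eta A c = Eta B c) \<and>
     (\<forall>m\<in>Obj M. \<forall>n\<in>Obj M. \<forall>c\<in>Obj C.
        \<theta> (m \<otimes>\<^bsub>M\<^esub> n) c \<cdot>\<^bsub>C\<^esub> Mult A m n c =
        Mult B m n c \<cdot>\<^bsub>C\<^esub> ActA B (Ide M m) (\<theta> n c) \<cdot>\<^bsub>C\<^esub> \<theta> m (ActO A n c)) \<and>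
     (\<forall>m\<in>Obj M. \<forall>n\<in>Obj M. \<forall>c\<in>Obj C. \<forall>d\<in>Obj C.
        (\<theta> m c \<odot>\<^bsub>C\<^esub> \<theta> n d) \<cdot>\<^bsub>C\<^esub> Iota A m n c d =
        Iota B m n c d \<cdot>\<^bsub>C\<^esub> \<theta> (m \<otimes>\<^bsub>M\<^esub> n) (c \<otimes>\<^bsub>C\<^esub> d))"

text \<open>
  A morphism \<open>(M, A) \<rightarrow> (N, B)\<close> consists of a strong braided monoidal functor \<open>R : M \<rightarrow> N\<close>
  together with an identification \<open>Theta R m c : B (R m) c \<rightarrow> A m c\<close>.
\<close>

record ('m, 'f, 'n, 'g, 'o, 'a) act_mor = "('m, 'f, 'n, 'g) mfunc" +
  Theta :: "'m \<Rightarrow> 'o \<Rightarrow> 'a"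

definition act_morphism ::
  "('o, 'a) brmoncat \<Rightarrow> ('m, 'f) brmoncat \<Rightarrow> ('m, 'f, 'o, 'a) act
    \<Rightarrow> ('n, 'g) brmoncat \<Rightarrow> ('n, 'g, 'o, 'a) act \<Rightarrow> ('m, 'f, 'n, 'g, 'o, 'a) act_mor \<Rightarrow> bool" where
  "act_morphism C M A N B R \<longleftrightarrow>
     strong_braided_monoidal_functor M N R \<and>
     action_isomorphism M C (restrict_act R N C B) A (Theta R)"

definition act_2cell ::
  "('o, 'a) brmoncat \<Rightarrow> ('m, 'f) brmoncat \<Rightarrow> ('n, 'g) brmoncat \<Rightarrow> ('n, 'g, 'o, 'a) act
    \<Rightarrow> ('m, 'f, 'n, 'g, 'o, 'a) act_mor \<Rightarrow> ('m, 'f, 'n, 'g, 'o, 'a) act_mor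
    \<Rightarrow> ('m \<Rightarrow> 'g) \<Rightarrow> bool" where
  "act_2cell C M N B R S \<tau> \<longleftrightarrow>
     monoidal_transformation M N R S \<tau> \<and>
     (\<forall>m\<in>Obj M. \<forall>c\<in>Obj C. Theta S m c \<cdot>\<^bsub>C\<^esub> ActA B (\<tau> m) (Ide C c) = Theta R m c)"

text \<open>
  Transformations are required to be extensional, so that two of them are equal as soon as they
  agree on the objects of \<open>M\<close>.
\<close>

definition act_hom_cat ::
  "('o, 'a) brmoncat \<Rightarrow> ('m, 'f) brmoncat \<Rightarrow> ('m, 'f, 'o, 'a) act
    \<Rightarrow> ('n, 'g) brmoncat \<Rightarrow> ('n, 'g, 'o, 'a) act
    \<Rightarrow> (('m, 'f, 'n, 'g, 'o, 'a) act_mor,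
        ('m, 'f, 'n, 'g, 'o, 'a) act_mor \<times> ('m, 'f, 'n, 'g, 'o, 'a) act_mor \<times> ('m \<Rightarrow> 'g)) cat" where
  "act_hom_cat C M A N B =
     \<lparr>Obj = {R. act_morphism C M A N B R},
      Arr = {(R, S, \<tau>). act_morphism C M A N B R \<and> act_morphism C M A N B S \<and>
               act_2cell C M N B R S \<tau> \<and> \<tau> \<in> extensional (Obj M)},
      Dom = (\<lambda>(R, S, \<tau>). R),
      Cod = (\<lambda>(R, S, \<tau>). S),
      Ide = (\<lambda>R. (R, R, \<lambda>m\<in>Obj M. Ide N (FObj R m))),
      Comp = (\<lambda>(S', T, \<upsilon>) (R, S, \<tau>). (R, T, \<lambda>m\<in>Obj M. \<upsilon> m \<cdot>\<^bsub>N\<^esub> \<tau> m))\<rparr>"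

definition sym_center_obj :: "('o, 'a) brmoncat \<Rightarrow> 'o set" where
  "sym_center_obj C =
     {c \<in> Obj C. \<forall>d\<in>Obj C. Braid C d c \<cdot>\<^bsub>C\<^esub> Braid C c d = Ide C (c \<otimes>\<^bsub>C\<^esub> d)}"

definition sym_center :: "('o, 'a) brmoncat \<Rightarrow> ('o, 'a) brmoncat" where
  "sym_center C =
     C\<lparr>Obj := sym_center_obj C,
       Arr := {f \<in> Arr C. Dom C f \<in> sym_center_obj C \<and> Cod C f \<in> sym_center_obj C}\<rparr>"

definition sym_center_act :: "('o, 'a) brmoncat \<Rightarrow> ('o, 'a, 'o, 'a) act" where
  "sym_center_act C =
     \<lparr>ActO = TObj C, ActA = TArr C,
      Eta = (\<lambda>c. inv_arr C (Lun C c)),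
      Mult = (\<lambda>s t c. inv_arr C (Assoc C s t c)),
      Iota = interchange C,
      ActUnit = inv_arr C (Lun C (Unit C))\<rparr>"

end

theory Submission
  imports Defs
begin

text \<open>
  Given a braided action of \<open>M\<close> with unit object \<open>j\<close> on \<open>C\<close> with unit object \<open>i\<close>, the classifying functor
  sends \<open>m\<close> to \<open>m \<bullet> i\<close>.  This object lies in the symmetric center because \<open>\<bullet>\<close> turns
  \<open>\<sigma>\<close> and the trivial braiding with \<open>i\<close> into the braiding of \<open>m \<bullet> i\<close> with \<open>j \<bullet> d \<cong> d\<close>, and the
  interchanger gives \<open>(m \<bullet> i) \<boxtimes> c \<cong> (m \<bullet> i) \<boxtimes> (j \<bullet> c) \<cong> (m \<otimes> j) \<bullet> (i \<boxtimes> c) \<cong> m \<bullet> c\<close>.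
  Conversely, if \<open>R m \<boxtimes> c \<cong> m \<bullet> c\<close> is any identification, its component at \<open>c = i\<close> yields
  \<open>R m \<cong> m \<bullet> i\<close>, and compatibility with interchangers determines all other components from this one.
  Coherence diagrams of \<open>C\<close> are proved in a strictification, whose objects are words in the objects of \<open>C\<close>.
\<close>

section \<open>Categories\<close>

text \<open>The obstacle is bracketing: interchangers carry associators, so equations between
  composites of them are unwieldy in \<open>C\<close>. They are written as formal terms
  \<open>mterm\<close>; by \<open>coherence_iff\<close>, two parallel terms agree in
  \<open>C\<close> exactly if they agree in \<open>strict C\<close>, where they become short braid
  identities. Both directions are used, because hypotheses such as the symmetry of a pair of objects
  must be carried from \<open>C\<close> to \<open>strict C\<close>. Multiplicators are tied to
  interchangers by the monoidality of \<open>Mult\<close>: together with the unit laws of the action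
  it forces \<open>Mult\<close>, preceded by \<open>\<theta>\<close>, to be an inverse interchanger
  up to a left unitor (\<open>mult_\<theta>\<close>). This identity is the key both to the
  compatibility of \<open>\<theta>\<close> with multiplicators and to the monoidality of the
  comparison between an arbitrary morphism and the classifier. Terminality is reduced to a statement
  about arrows: every object of the hom-category has exactly one arrow to the classifier, and this
  arrow is invertible.\<close>

lemma homI: "f \<in> Arr C \<Longrightarrow> Dom C f = a \<Longrightarrow> Cod C f = b \<Longrightarrow> f \<in> hom C a b"
  by (auto simp: hom_def)

context category
begin

lemmas dom_obj [simp] = dom_obj and cod_obj [simp] = cod_obj

lemma comp_simps [simp]:
  assumes "f \<in> Arr C" "g \<in> Arr C" "Dom C g = Cod C f"
  shows "g \<cdot> f \<in> Arr C" "Dom C (g \<cdot> f) = Dom C f" "Cod C (g \<cdot> f) = Cod C g"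
  using comp_hom[of f "Dom C f" "Cod C f" g "Cod C g"] assms by (auto simp: hom_def)

lemma ide_simps [simp]:
  assumes "a \<in> Obj C"
  shows "Ide C a \<in> Arr C" "Dom C (Ide C a) = a" "Cod C (Ide C a) = a"
  using ide_hom[OF assms] by (auto simp: hom_def)

lemma comp_ide [simp]:
  "f \<in> Arr C \<Longrightarrow> Cod C f = b \<Longrightarrow> Ide C b \<cdot> f = f"
  "f \<in> Arr C \<Longrightarrow> Dom C f = a \<Longrightarrow> f \<cdot> Ide C a = f"
  using comp_ide_left comp_ide_right by (auto simp: hom_def)

lemma comp_assoc_simp [simp]:
  assumes "f \<in> Arr C" "g \<in> Arr C" "h \<in> Arr C" "Dom C g = Cod C f" "Dom C h = Cod C g"
  shows "(h \<cdot> g) \<cdot> f = h \<cdot> (g \<cdot> f)"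
  using comp_assoc[of f "Dom C f" "Cod C f" g "Cod C g" h "Cod C h"] assms by (auto simp: hom_def)

text \<open>Composites are normalized to right-nested form, where the left side of
  \<open>g \<cdot> f = k\<close> no longer occurs inside a longer chain. The version with a tail
  \<open>x\<close> rewrites the head of such a chain; \<open>comp_chain2\<close> does the same for
  commuting squares.\<close>

lemma comp_chain:
  assumes "g \<cdot> f = k" "f \<in> Arr C" "g \<in> Arr C" "Dom C g = Cod C f" "x \<in> Arr C" "Cod C x = Dom C f"
  shows "g \<cdot> (f \<cdot> x) = k \<cdot> x"
  using assms by (metis comp_assoc_simp)

lemma comp_chain2:
  assumes "g \<cdot> f = k \<cdot> h" "f \<in> Arr C" "g \<in> Arr C" "Dom C g = Cod C f"
    "h \<in> Arr C" "k \<in> Arr C" "Dom C k = Cod C h" "Dom C h = Dom C f"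
    "x \<in> Arr C" "Cod C x = Dom C f"
  shows "g \<cdot> (f \<cdot> x) = k \<cdot> (h \<cdot> x)"
  using assms by (metis comp_assoc_simp)

lemma inverse_arrows_unique:
  assumes "inverse_arrows C f g" "inverse_arrows C f h"
  shows "g = h"
proof -
  have "(g \<cdot> f) \<cdot> h = g \<cdot> (f \<cdot> h)"
    using assms by (intro comp_assoc_simp) (auto simp: inverse_arrows_def hom_def)
  then show ?thesis using assms by (auto simp: inverse_arrows_def hom_def)
qed

lemma inv_arr_eqI: "inverse_arrows C f g \<Longrightarrow> inv_arr C f = g"
  unfolding inv_arr_def using inverse_arrows_unique by blast

lemma iso_inverse: "iso C f \<Longrightarrow> inverse_arrows C f (inv_arr C f)"
  using inv_arr_eqI iso_def by metis

lemma iso_arr: "iso C f \<Longrightarrow> f \<in> Arr C"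
  using iso_inverse by (auto simp: inverse_arrows_def hom_def)

lemma inv_simps [simp]:
  assumes "iso C f"
  shows "inv_arr C f \<in> Arr C" "Dom C (inv_arr C f) = Cod C f" "Cod C (inv_arr C f) = Dom C f"
    "inv_arr C f \<cdot> f = Ide C (Dom C f)" "f \<cdot> inv_arr C f = Ide C (Cod C f)"
  using iso_inverse[OF assms] by (auto simp: inverse_arrows_def hom_def)

lemma inv_chain [simp]:
  assumes "iso C f"
  shows "x \<in> Arr C \<Longrightarrow> Cod C x = Dom C f \<Longrightarrow> inv_arr C f \<cdot> (f \<cdot> x) = x"
    "x \<in> Arr C \<Longrightarrow> Cod C x = Cod C f \<Longrightarrow> f \<cdot> (inv_arr C f \<cdot> x) = x"
  using assms iso_arr[OF assms] by (subst comp_assoc_simp[symmetric]; simp)+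

lemma inverse_arrows_iso:
  assumes "inverse_arrows C f g"
  shows "iso C f" "inv_arr C f = g" "iso C g" "inv_arr C g = f"
proof -
  show "iso C f" "inv_arr C f = g" using assms inv_arr_eqI by (auto simp: iso_def)
  have "inverse_arrows C g f" using assms by (auto simp: inverse_arrows_def hom_def)
  then show "iso C g" "inv_arr C g = f" using inv_arr_eqI by (auto simp: iso_def)
qed

lemma inverse_arrowsI:
  assumes "f \<in> Arr C" "g \<in> Arr C" "Dom C g = Cod C f" "Cod C g = Dom C f"
    "g \<cdot> f = Ide C (Dom C f)" "f \<cdot> g = Ide C (Cod C f)"
  shows "inverse_arrows C f g"
  using assms by (auto simp: inverse_arrows_def hom_def)

lemma iso_inv [simp]: "iso C f \<Longrightarrow> iso C (inv_arr C f)"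
  and inv_inv [simp]: "iso C f \<Longrightarrow> inv_arr C (inv_arr C f) = f"
  using inverse_arrows_iso[OF iso_inverse] by auto

lemma iso_ide [simp]: "a \<in> Obj C \<Longrightarrow> iso C (Ide C a)"
  and inv_ide [simp]: "a \<in> Obj C \<Longrightarrow> inv_arr C (Ide C a) = Ide C a"
  using inverse_arrows_iso[OF inverse_arrowsI[of "Ide C a" "Ide C a"]] by auto

lemma
  assumes "iso C f" "iso C g" "Dom C g = Cod C f"
  shows iso_comp [simp]: "iso C (g \<cdot> f)"
    and inv_comp: "inv_arr C (g \<cdot> f) = inv_arr C f \<cdot> inv_arr C g"
proof -
  have "inverse_arrows C (g \<cdot> f) (inv_arr C f \<cdot> inv_arr C g)"
    using assms iso_arr by (intro inverse_arrowsI) auto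
  then show "iso C (g \<cdot> f)" "inv_arr C (g \<cdot> f) = inv_arr C f \<cdot> inv_arr C g"
    by (rule inverse_arrows_iso)+
qed

lemma iso_cancel_left:
  assumes "iso C g" "g \<cdot> f = g \<cdot> f'" "f \<in> Arr C" "f' \<in> Arr C" "Cod C f = Dom C g" "Cod C f' = Dom C g"
  shows "f = f'"
  using arg_cong[OF assms(2), of "\<lambda>x. inv_arr C g \<cdot> x"] assms(1,3-6) by simp

lemma iso_cancel_right:
  assumes "iso C g" "f \<cdot> g = f' \<cdot> g" "f \<in> Arr C" "f' \<in> Arr C" "Dom C f = Cod C g" "Dom C f' = Cod C g"
  shows "f = f'"
  using arg_cong[OF assms(2), of "\<lambda>x. x \<cdot> inv_arr C g"] assms(1,3-6) iso_arr[OF assms(1)] by simp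

lemma comp_inv_eq:
  assumes "iso C g" "f \<cdot> g = h" "f \<in> Arr C" "Dom C f = Cod C g"
  shows "f = h \<cdot> inv_arr C g"
  unfolding assms(2)[symmetric] using assms(1,3,4) iso_arr[OF assms(1)] by simp

text \<open>A commuting square with two opposite invertible sides may have these sides reversed.
  This yields naturality of the inverse unitors and associators and of inverse
  transformations.\<close>

lemma inv_natural:
  assumes "iso C s" "iso C t" "g \<cdot> s = t \<cdot> f"
    "f \<in> Arr C" "g \<in> Arr C" "Dom C f = Dom C s" "Cod C f = Dom C t" "Dom C g = Cod C s" "Cod C g = Cod C t"
  shows "f \<cdot> inv_arr C s = inv_arr C t \<cdot> g"
proof (rule iso_cancel_left[OF assms(2)])
  have "t \<cdot> f \<cdot> inv_arr C s = (g \<cdot> s) \<cdot> inv_arr C s"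
    unfolding assms(3) using assms(1,2,4-9) iso_arr by simp
  then show "t \<cdot> f \<cdot> inv_arr C s = t \<cdot> inv_arr C t \<cdot> g" using assms(1,2,4-9) iso_arr by simp
qed (use assms(1,2,4-9) iso_arr in auto)

end

section \<open>Unit coherence in monoidal categories\<close>

context monoidal_category
begin

lemmas unit_obj [simp] = unit_obj and tensor_obj [simp] = tensor_obj

lemma tensor_simps [simp]:
  assumes "f \<in> Arr C" "g \<in> Arr C"
  shows "f \<odot> g \<in> Arr C" "Dom C (f \<odot> g) = Dom C f \<otimes> Dom C g" "Cod C (f \<odot> g) = Cod C f \<otimes> Cod C g"
  using tensor_hom[of f "Dom C f" "Cod C f" g "Dom C g" "Cod C g"] assms by (auto simp: hom_def)

lemmas tensor_ide [simp] = tensor_ide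

text \<open>Oriented so that composites of tensors collapse into one tensor. Where a proof needs the
  split form, it states that form and lets this rule merge it back.\<close>

lemma tensor_merge [simp]:
  assumes "f \<in> Arr C" "f' \<in> Arr C" "g \<in> Arr C" "g' \<in> Arr C" "Dom C f' = Cod C f" "Dom C g' = Cod C g"
  shows "(f' \<odot> g') \<cdot> (f \<odot> g) = (f' \<cdot> f) \<odot> (g' \<cdot> g)"
  using tensor_comp[of f "Dom C f" "Cod C f" f' "Cod C f'" g "Dom C g" "Cod C g" g' "Cod C g'"] assms
  by (auto simp: hom_def)

lemma tensor_merge_chain [simp]:
  assumes "f \<in> Arr C" "f' \<in> Arr C" "g \<in> Arr C" "g' \<in> Arr C" "Dom C f' = Cod C f" "Dom C g' = Cod C g"
    "x \<in> Arr C" "Cod C x = Dom C f \<otimes> Dom C g"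
  shows "(f' \<odot> g') \<cdot> (f \<odot> g) \<cdot> x = ((f' \<cdot> f) \<odot> (g' \<cdot> g)) \<cdot> x"
  using assms by (intro comp_chain) auto

lemma
  assumes "iso C f" "iso C g"
  shows iso_tensor [simp]: "iso C (f \<odot> g)"
    and inv_tensor: "inv_arr C (f \<odot> g) = inv_arr C f \<odot> inv_arr C g"
proof -
  have "inverse_arrows C (f \<odot> g) (inv_arr C f \<odot> inv_arr C g)"
    using assms iso_arr by (intro inverse_arrowsI) auto
  then show "iso C (f \<odot> g)" "inv_arr C (f \<odot> g) = inv_arr C f \<odot> inv_arr C g"
    by (rule inverse_arrows_iso)+
qed

lemma lun_simps [simp]:
  assumes "a \<in> Obj C"
  shows "Lun C a \<in> Arr C" "Dom C (Lun C a) = Unit C \<otimes> a" "Cod C (Lun C a) = a" "iso C (Lun C a)"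
  using lun_hom lun_iso assms by (auto simp: hom_def)

lemma run_simps [simp]:
  assumes "a \<in> Obj C"
  shows "Run C a \<in> Arr C" "Dom C (Run C a) = a \<otimes> Unit C" "Cod C (Run C a) = a" "iso C (Run C a)"
  using run_hom run_iso assms by (auto simp: hom_def)

lemma assoc_simps [simp]:
  assumes "a \<in> Obj C" "b \<in> Obj C" "c \<in> Obj C"
  shows "Assoc C a b c \<in> Arr C" "Dom C (Assoc C a b c) = (a \<otimes> b) \<otimes> c"
    "Cod C (Assoc C a b c) = a \<otimes> b \<otimes> c" "iso C (Assoc C a b c)"
  using assoc_hom assoc_iso assms by (auto simp: hom_def)

lemma lun_nat: "f \<in> Arr C \<Longrightarrow> Dom C f = a \<Longrightarrow> Cod C f = b \<Longrightarrow>
    Lun C b \<cdot> (Ide C (Unit C) \<odot> f) = f \<cdot> Lun C a"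
  by (rule lun_natural[symmetric, OF homI])

lemma run_nat: "f \<in> Arr C \<Longrightarrow> Dom C f = a \<Longrightarrow> Cod C f = b \<Longrightarrow>
    Run C b \<cdot> (f \<odot> Ide C (Unit C)) = f \<cdot> Run C a"
  by (rule run_natural[symmetric, OF homI])

lemma assoc_nat: "f \<in> Arr C \<Longrightarrow> g \<in> Arr C \<Longrightarrow> h \<in> Arr C \<Longrightarrow>
    Dom C f = a \<Longrightarrow> Dom C g = b \<Longrightarrow> Dom C h = c \<Longrightarrow> Cod C f = a' \<Longrightarrow> Cod C g = b' \<Longrightarrow> Cod C h = c' \<Longrightarrow>
    Assoc C a' b' c' \<cdot> ((f \<odot> g) \<odot> h) = (f \<odot> g \<odot> h) \<cdot> Assoc C a b c"
  by (rule assoc_natural[symmetric, OF homI homI homI])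

lemma lun_inv_nat: "f \<in> Arr C \<Longrightarrow> Dom C f = a \<Longrightarrow> Cod C f = b \<Longrightarrow>
    (Ide C (Unit C) \<odot> f) \<cdot> inv_arr C (Lun C a) = inv_arr C (Lun C b) \<cdot> f"
  by (rule inv_natural) (auto simp: lun_nat)

lemma run_inv_nat: "f \<in> Arr C \<Longrightarrow> Dom C f = a \<Longrightarrow> Cod C f = b \<Longrightarrow>
    (f \<odot> Ide C (Unit C)) \<cdot> inv_arr C (Run C a) = inv_arr C (Run C b) \<cdot> f"
  by (rule inv_natural) (auto simp: run_nat)

lemma assoc_inv_nat: "f \<in> Arr C \<Longrightarrow> g \<in> Arr C \<Longrightarrow> h \<in> Arr C \<Longrightarrow>
    Dom C f = a \<Longrightarrow> Dom C g = b \<Longrightarrow> Dom C h = c \<Longrightarrow> Cod C f = a' \<Longrightarrow> Cod C g = b' \<Longrightarrow> Cod C h = c' \<Longrightarrow>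
    ((f \<odot> g) \<odot> h) \<cdot> inv_arr C (Assoc C a b c) = inv_arr C (Assoc C a' b' c') \<cdot> (f \<odot> g \<odot> h)"
  by (rule inv_natural) (auto simp: assoc_nat)

text \<open>\<open>Lun\<close> is a natural isomorphism from tensoring with the unit to the
  identity. The extra unit factor gives room for the pentagon in proofs of unit laws.\<close>

lemma unit_tensor_faithful:
  assumes "Ide C (Unit C) \<odot> f = Ide C (Unit C) \<odot> g" "f \<in> hom C a b" "g \<in> hom C a b"
  shows "f = g"
proof (rule iso_cancel_right[of "Lun C a"])
  show "f \<cdot> Lun C a = g \<cdot> Lun C a" using assms lun_natural by metis
qed (use assms dom_obj in \<open>auto simp: hom_def\<close>)

lemma tensor_unit_faithful:
  assumes "f \<odot> Ide C (Unit C) = g \<odot> Ide C (Unit C)" "f \<in> hom C a b" "g \<in> hom C a b"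
  shows "f = g"
proof (rule iso_cancel_right[of "Run C a"])
  show "f \<cdot> Run C a = g \<cdot> Run C a" using assms run_natural by metis
qed (use assms dom_obj in \<open>auto simp: hom_def\<close>)

text \<open>Kelly's argument: after tensoring with the unit \<open>I\<close>, the pentagon at
  \<open>I, I, a, b\<close> and two triangles connect both sides, and the isomorphism that was
  composed on the right is cancelled.\<close>

lemma lun_tensor:
  assumes [simp]: "a \<in> Obj C" "b \<in> Obj C"
  shows "Lun C (a \<otimes> b) \<cdot> Assoc C (Unit C) a b = Lun C a \<odot> Ide C b"
proof (rule unit_tensor_faithful)
  let ?I = "Unit C" and ?i = "Ide C (Unit C)"
  show "?i \<odot> (Lun C (a \<otimes> b) \<cdot> Assoc C ?I a b) = ?i \<odot> (Lun C a \<odot> Ide C b)"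
  proof (rule iso_cancel_right[of "Assoc C ?I (?I \<otimes> a) b \<cdot> (Assoc C ?I ?I a \<odot> Ide C b)"])
    have "(?i \<odot> (Lun C (a \<otimes> b) \<cdot> Assoc C ?I a b)) \<cdot> Assoc C ?I (?I \<otimes> a) b \<cdot> (Assoc C ?I ?I a \<odot> Ide C b)
        = ((?i \<odot> Lun C (a \<otimes> b)) \<cdot> (?i \<odot> Assoc C ?I a b)) \<cdot> Assoc C ?I (?I \<otimes> a) b \<cdot> (Assoc C ?I ?I a \<odot> Ide C b)"
      by (subst tensor_merge) auto
    also have "\<dots> = (?i \<odot> Lun C (a \<otimes> b)) \<cdot> Assoc C ?I ?I (a \<otimes> b) \<cdot> Assoc C (?I \<otimes> ?I) a b"
      using pentagon[of ?I ?I a b] by (subst comp_assoc_simp) auto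
    also have "\<dots> = (Run C ?I \<odot> Ide C (a \<otimes> b)) \<cdot> Assoc C (?I \<otimes> ?I) a b"
      by (rule comp_chain[OF triangle]) auto
    also have "\<dots> = Assoc C ?I a b \<cdot> ((Run C ?I \<odot> Ide C a) \<odot> Ide C b)"
      by (subst assoc_nat) auto
    also have "\<dots> = Assoc C ?I a b \<cdot> ((?i \<odot> Lun C a) \<odot> Ide C b) \<cdot> (Assoc C ?I ?I a \<odot> Ide C b)"
      by (subst tensor_merge) (auto simp: triangle)
    also have "\<dots> = (?i \<odot> (Lun C a \<odot> Ide C b)) \<cdot> Assoc C ?I (?I \<otimes> a) b \<cdot> (Assoc C ?I ?I a \<odot> Ide C b)"
      by (rule comp_chain2[OF assoc_nat]) auto
    finally show "(?i \<odot> (Lun C (a \<otimes> b) \<cdot> Assoc C ?I a b)) \<cdot> Assoc C ?I (?I \<otimes> a) b \<cdot> (Assoc C ?I ?I a \<odot> Ide C b)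
      = (?i \<odot> (Lun C a \<odot> Ide C b)) \<cdot> Assoc C ?I (?I \<otimes> a) b \<cdot> (Assoc C ?I ?I a \<odot> Ide C b)" .
  qed auto
qed (auto simp: hom_def)

text \<open>Mirror image of \<open>lun_tensor\<close>, through the pentagon at
  \<open>a, b, I, I\<close> and two triangles.\<close>

lemma run_tensor:
  assumes [simp]: "a \<in> Obj C" "b \<in> Obj C"
  shows "(Ide C a \<odot> Run C b) \<cdot> Assoc C a b (Unit C) = Run C (a \<otimes> b)"
proof (rule tensor_unit_faithful)
  let ?I = "Unit C" and ?i = "Ide C (Unit C)" and ?A = "Assoc C"
  show "((Ide C a \<odot> Run C b) \<cdot> ?A a b ?I) \<odot> ?i = Run C (a \<otimes> b) \<odot> ?i"
  proof (rule iso_cancel_left[of "?A a b ?I"])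
    have "?A a b ?I \<cdot> (((Ide C a \<odot> Run C b) \<cdot> ?A a b ?I) \<odot> ?i)
        = ?A a b ?I \<cdot> (((Ide C a \<odot> Run C b) \<odot> ?i) \<cdot> (?A a b ?I \<odot> ?i))"
      by (subst tensor_merge) auto
    also have "\<dots> = (Ide C a \<odot> Run C b \<odot> ?i) \<cdot> ?A a (b \<otimes> ?I) ?I \<cdot> (?A a b ?I \<odot> ?i)"
      by (rule comp_chain2[OF assoc_nat]) auto
    also have "\<dots> = ((Ide C a \<odot> Ide C b \<odot> Lun C ?I) \<cdot> (Ide C a \<odot> ?A b ?I ?I)) \<cdot> ?A a (b \<otimes> ?I) ?I \<cdot> (?A a b ?I \<odot> ?i)"
      by (subst tensor_merge) (auto simp: triangle)
    also have "\<dots> = (Ide C a \<odot> Ide C b \<odot> Lun C ?I) \<cdot> ?A a b (?I \<otimes> ?I) \<cdot> ?A (a \<otimes> b) ?I ?I"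
      using pentagon[of a b ?I ?I] by (subst comp_assoc_simp) auto
    also have "\<dots> = ?A a b ?I \<cdot> ((Ide C a \<odot> Ide C b) \<odot> Lun C ?I) \<cdot> ?A (a \<otimes> b) ?I ?I"
      by (rule comp_chain2[OF assoc_nat[symmetric]]) auto
    also have "\<dots> = ?A a b ?I \<cdot> (Run C (a \<otimes> b) \<odot> ?i)"
      by (simp add: triangle)
    finally show "?A a b ?I \<cdot> (((Ide C a \<odot> Run C b) \<cdot> ?A a b ?I) \<odot> ?i) = ?A a b ?I \<cdot> (Run C (a \<otimes> b) \<odot> ?i)" .
  qed auto
qed (auto simp: hom_def)

text \<open>Naturality of \<open>Lun\<close> at its own component identifies
  \<open>Lun (I \<otimes> I)\<close> with \<open>I \<odot> Lun I\<close>. Then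
  \<open>lun_tensor\<close> and the triangle have the same left-hand side.\<close>

lemma lun_unit: "Lun C (Unit C) = Run C (Unit C)"
proof (rule tensor_unit_faithful)
  let ?I = "Unit C" and ?i = "Ide C (Unit C)"
  have "Lun C ?I \<cdot> Lun C (?I \<otimes> ?I) = Lun C ?I \<cdot> (?i \<odot> Lun C ?I)"
    by (subst lun_nat) auto
  then have "Lun C (?I \<otimes> ?I) = ?i \<odot> Lun C ?I"
    by (rule iso_cancel_left[rotated]) auto
  then show "Lun C ?I \<odot> ?i = Run C ?I \<odot> ?i"
    using lun_tensor[of ?I ?I] triangle[of ?I ?I] by simp
qed (auto simp: hom_def)

end

section \<open>Braiding with the unit object\<close>

context braided_monoidal_category
begin

lemma braid_simps [simp]:
  assumes "a \<in> Obj C" "b \<in> Obj C"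
  shows "Braid C a b \<in> Arr C" "Dom C (Braid C a b) = a \<otimes> b"
    "Cod C (Braid C a b) = b \<otimes> a" "iso C (Braid C a b)"
  using braid_hom braid_iso assms by (auto simp: hom_def)

lemma braid_nat: "f \<in> Arr C \<Longrightarrow> g \<in> Arr C \<Longrightarrow>
    Dom C f = a \<Longrightarrow> Dom C g = b \<Longrightarrow> Cod C f = a' \<Longrightarrow> Cod C g = b' \<Longrightarrow>
    Braid C a' b' \<cdot> (f \<odot> g) = (g \<odot> f) \<cdot> Braid C a b"
  by (rule braid_natural[symmetric, OF homI homI])

text \<open>The hexagon at \<open>a, I, I\<close>, contracted by \<open>Lun\<close> and compared
  with the triangle, contains the invertible braiding \<open>Braid C a I\<close> once too often on
  both sides; cancelling it leaves the claim tensored with the unit.\<close>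

lemma lun_braid:
  assumes [simp]: "a \<in> Obj C"
  shows "Lun C a \<cdot> Braid C a (Unit C) = Run C a"
proof (rule tensor_unit_faithful)
  let ?I = "Unit C" and ?i = "Ide C (Unit C)" and ?A = "Assoc C" and ?B = "Braid C"
  show "(Lun C a \<cdot> ?B a ?I) \<odot> ?i = Run C a \<odot> ?i"
  proof (rule iso_cancel_left[of "?B a ?I"])
    have "?B a ?I \<cdot> ((Lun C a \<cdot> ?B a ?I) \<odot> ?i) = ?B a ?I \<cdot> (Lun C a \<odot> ?i) \<cdot> (?B a ?I \<odot> ?i)"
      by (subst tensor_merge) auto
    also have "\<dots> = (?B a ?I \<cdot> Lun C (a \<otimes> ?I)) \<cdot> ?A ?I a ?I \<cdot> (?B a ?I \<odot> ?i)"
      by (simp add: lun_tensor[symmetric])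
    also have "?B a ?I \<cdot> Lun C (a \<otimes> ?I) = Lun C (?I \<otimes> a) \<cdot> (?i \<odot> ?B a ?I)"
      by (rule lun_nat[symmetric]) auto
    also have "(Lun C (?I \<otimes> a) \<cdot> (?i \<odot> ?B a ?I)) \<cdot> ?A ?I a ?I \<cdot> (?B a ?I \<odot> ?i)
       = Lun C (?I \<otimes> a) \<cdot> ?A ?I ?I a \<cdot> ?B a (?I \<otimes> ?I) \<cdot> ?A a ?I ?I"
      by (simp add: hexagon1)
    also have "\<dots> = (Lun C ?I \<odot> Ide C a) \<cdot> ?B a (?I \<otimes> ?I) \<cdot> ?A a ?I ?I"
      by (rule comp_chain[OF lun_tensor]) auto
    also have "\<dots> = ?B a ?I \<cdot> (Ide C a \<odot> Lun C ?I) \<cdot> ?A a ?I ?I"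
      by (rule comp_chain2[OF braid_nat[symmetric]]) auto
    also have "\<dots> = ?B a ?I \<cdot> (Run C a \<odot> ?i)" by (simp add: triangle)
    finally show "?B a ?I \<cdot> ((Lun C a \<cdot> ?B a ?I) \<odot> ?i) = ?B a ?I \<cdot> (Run C a \<odot> ?i)" .
  qed auto
qed (auto simp: hom_def)

text \<open>Same argument with the second hexagon at \<open>I, I, a\<close>, using the laws of the
  inverse associator.\<close>

lemma run_braid:
  assumes [simp]: "a \<in> Obj C"
  shows "Run C a \<cdot> Braid C (Unit C) a = Lun C a"
proof (rule unit_tensor_faithful)
  let ?I = "Unit C" and ?i = "Ide C (Unit C)" and ?A = "\<lambda>a b c. inv_arr C (Assoc C a b c)" and ?B = "Braid C"
  have rt: "Run C (x \<otimes> y) \<cdot> ?A x y ?I = Ide C x \<odot> Run C y" if [simp]: "x \<in> Obj C" "y \<in> Obj C" for x y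
    by (subst comp_inv_eq[OF _ run_tensor]) auto
  have tr: "(Run C x \<odot> Ide C y) \<cdot> ?A x ?I y = Ide C x \<odot> Lun C y" if [simp]: "x \<in> Obj C" "y \<in> Obj C" for x y
    by (subst comp_inv_eq[OF _ triangle]) auto
  show "?i \<odot> (Run C a \<cdot> ?B ?I a) = ?i \<odot> Lun C a"
  proof (rule iso_cancel_left[of "?B ?I a"])
    have "?B ?I a \<cdot> (?i \<odot> (Run C a \<cdot> ?B ?I a)) = ?B ?I a \<cdot> (?i \<odot> Run C a) \<cdot> (?i \<odot> ?B ?I a)"
      by (subst tensor_merge) auto
    also have "\<dots> = (?B ?I a \<cdot> Run C (?I \<otimes> a)) \<cdot> ?A ?I a ?I \<cdot> (?i \<odot> ?B ?I a)"
      by (simp add: rt[symmetric])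
    also have "?B ?I a \<cdot> Run C (?I \<otimes> a) = Run C (a \<otimes> ?I) \<cdot> (?B ?I a \<odot> ?i)"
      by (rule run_nat[symmetric]) auto
    also have "(Run C (a \<otimes> ?I) \<cdot> (?B ?I a \<odot> ?i)) \<cdot> ?A ?I a ?I \<cdot> (?i \<odot> ?B ?I a)
       = Run C (a \<otimes> ?I) \<cdot> ?A a ?I ?I \<cdot> ?B (?I \<otimes> ?I) a \<cdot> ?A ?I ?I a"
      by (simp add: hexagon2)
    also have "\<dots> = (Ide C a \<odot> Run C ?I) \<cdot> ?B (?I \<otimes> ?I) a \<cdot> ?A ?I ?I a"
      by (rule comp_chain[OF rt]) auto
    also have "\<dots> = ?B ?I a \<cdot> (Run C ?I \<odot> Ide C a) \<cdot> ?A ?I ?I a"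
      by (rule comp_chain2[OF braid_nat[symmetric]]) auto
    also have "\<dots> = ?B ?I a \<cdot> (?i \<odot> Lun C a)" by (simp add: tr)
    finally show "?B ?I a \<cdot> (?i \<odot> (Run C a \<cdot> ?B ?I a)) = ?B ?I a \<cdot> (?i \<odot> Lun C a)" .
  qed auto
qed (auto simp: hom_def)

end

section \<open>Strictification\<close>

text \<open>Words are bracketed to the right and end in the unit, so \<open>[a]\<close> evaluates to
  \<open>a \<otimes> I\<close> and not to \<open>a\<close>. The price of this uniform recursion is
  the right unitor in \<open>norm\<close>.\<close>

primrec word :: "('o, 'a, 'z) moncat_scheme \<Rightarrow> 'o list \<Rightarrow> 'o" where
  "word C [] = Unit C"
| "word C (a # l) = a \<otimes>\<^bsub>C\<^esub> word C l"

primrec merge :: "('o, 'a, 'z) moncat_scheme \<Rightarrow> 'o list \<Rightarrow> 'o list \<Rightarrow> 'a" where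
  "merge C [] m = Lun C (word C m)"
| "merge C (a # l) m = (Ide C a \<odot>\<^bsub>C\<^esub> merge C l m) \<cdot>\<^bsub>C\<^esub> Assoc C a (word C l) (word C m)"

definition sten :: "('o, 'a, 'z) moncat_scheme \<Rightarrow> 'o list \<times> 'a \<times> 'o list \<Rightarrow> 'o list \<times> 'a \<times> 'o list
    \<Rightarrow> 'o list \<times> 'a \<times> 'o list" where
  "sten C = (\<lambda>(l, f, m) (l', f', m'). (l @ l',
     merge C m m' \<cdot>\<^bsub>C\<^esub> (f \<odot>\<^bsub>C\<^esub> f') \<cdot>\<^bsub>C\<^esub> inv_arr C (merge C l l'), m @ m'))"

text \<open>An arrow between words is an arrow of \<open>C\<close> between their values. The words
  are stored with it, since different words can have the same value. Tensor and braiding are those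
  of \<open>C\<close> conjugated by \<open>merge\<close>.\<close>

definition strict :: "('o, 'a, 'z) brmoncat_scheme \<Rightarrow> ('o list, 'o list \<times> 'a \<times> 'o list) brmoncat" where
  "strict C = (let ide = (\<lambda>l. (l, Ide C (word C l), l)) in
     \<lparr>Obj = lists (Obj C),
      Arr = {(l, f, m). l \<in> lists (Obj C) \<and> m \<in> lists (Obj C) \<and> f \<in> hom C (word C l) (word C m)},
      Dom = fst, Cod = snd \<circ> snd,
      Ide = ide, Comp = (\<lambda>(_, g, n) (l, f, _). (l, g \<cdot>\<^bsub>C\<^esub> f, n)),
      Unit = [], TObj = (@), TArr = sten C,
      Lun = ide, Run = ide, Assoc = (\<lambda>l m n. ide (l @ m @ n)),
      Braid = (\<lambda>l m. (l @ m,
        merge C m l \<cdot>\<^bsub>C\<^esub> Braid C (word C l) (word C m) \<cdot>\<^bsub>C\<^esub> inv_arr C (merge C l m), m @ l))\<rparr>)"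

text \<open>The strictness equations carry no membership conditions, as is true for concatenation of
  lists, so the simplifier can rebracket freely. Braid identities are proved in this abstract
  setting, without looking inside words.\<close>

locale strict_braided_monoidal_category = braided_monoidal_category S
  for S :: "('o, 'a, 'z) brmoncat_scheme" (structure) +
  assumes obj_assoc [simp]: "(a \<otimes> b) \<otimes> c = a \<otimes> b \<otimes> c"
    and obj_unit [simp]: "Unit S \<otimes> a = a" "a \<otimes> Unit S = a"
    and assoc_strict [simp]: "Assoc S a b c = Ide S (a \<otimes> b \<otimes> c)"
    and lun_strict [simp]: "Lun S a = Ide S a"
    and run_strict [simp]: "Run S a = Ide S a"
begin

text \<open>Naturality of the associator, with both associators being identities.\<close>

lemma arr_assoc [simp]: "f \<in> Arr S \<Longrightarrow> g \<in> Arr S \<Longrightarrow> h \<in> Arr S \<Longrightarrow> (f \<odot> g) \<odot> h = f \<odot> g \<odot> h"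
  using assoc_nat[of f g h] by simp

lemma arr_unit [simp]:
  "f \<in> Arr S \<Longrightarrow> Ide S (Unit S) \<odot> f = f" "f \<in> Arr S \<Longrightarrow> f \<odot> Ide S (Unit S) = f"
  using lun_nat[of f] run_nat[of f] by simp_all

lemma braid_tensor_right:
  "a \<in> Obj S \<Longrightarrow> b \<in> Obj S \<Longrightarrow> c \<in> Obj S \<Longrightarrow>
    Braid S a (b \<otimes> c) = (Ide S b \<odot> Braid S a c) \<cdot> (Braid S a b \<odot> Ide S c)"
  using hexagon1[of a b c] by simp

lemma braid_tensor_left:
  "a \<in> Obj S \<Longrightarrow> b \<in> Obj S \<Longrightarrow> c \<in> Obj S \<Longrightarrow>
    Braid S (a \<otimes> b) c = (Braid S a c \<odot> Ide S b) \<cdot> (Ide S a \<odot> Braid S b c)"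
  using hexagon2[of a b c] by simp

lemma braid_unit [simp]:
  "a \<in> Obj S \<Longrightarrow> Braid S a (Unit S) = Ide S a" "a \<in> Obj S \<Longrightarrow> Braid S (Unit S) a = Ide S a"
  using lun_braid[of a] run_braid[of a] by simp_all

end

section \<open>Values of words and their concatenation\<close>

context monoidal_category
begin

lemma word_obj [simp]: "l \<in> lists (Obj C) \<Longrightarrow> word C l \<in> Obj C"
  by (induction l) auto

lemma merge_simps [simp]:
  assumes "l \<in> lists (Obj C)" "m \<in> lists (Obj C)"
  shows "merge C l m \<in> Arr C" "Dom C (merge C l m) = word C l \<otimes> word C m"
    "Cod C (merge C l m) = word C (l @ m)" "iso C (merge C l m)"
  using assms by (induction l) auto

lemma merge_nil: "l \<in> lists (Obj C) \<Longrightarrow> merge C l [] = Run C (word C l)"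
  by (induction l) (auto simp: lun_unit run_tensor)

text \<open>The empty word is \<open>lun_tensor\<close>, a further letter is the pentagon. This
  coherence of \<open>merge\<close> is the source of the strictly associative tensor of arrows and
  of both hexagons in the strictification.\<close>

lemma merge_assoc:
  assumes "l \<in> lists (Obj C)" and [simp]: "m \<in> lists (Obj C)" "n \<in> lists (Obj C)"
  shows "merge C (l @ m) n \<cdot> (merge C l m \<odot> Ide C (word C n)) =
    merge C l (m @ n) \<cdot> (Ide C (word C l) \<odot> merge C m n) \<cdot> Assoc C (word C l) (word C m) (word C n)"
  using assms(1)
proof (induction l)
  case Nil
  show ?case using lun_tensor[of "word C m" "word C n"]
    by (simp add: comp_chain2[OF lun_nat])
next
  case (Cons a l)
  then have [simp]: "a \<in> Obj C" "l \<in> lists (Obj C)" by auto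
  let ?A = "Assoc C" and ?l = "word C l" and ?m = "word C m" and ?n = "word C n" and ?i = "Ide C"
  have "merge C ((a # l) @ m) n \<cdot> (merge C (a # l) m \<odot> ?i ?n)
      = (?i a \<odot> merge C (l @ m) n) \<cdot> (?A a (word C (l @ m)) ?n \<cdot> ((?i a \<odot> merge C l m) \<odot> ?i ?n)) \<cdot> (?A a ?l ?m \<odot> ?i ?n)"
    by simp
  also have "\<dots> = (?i a \<odot> (merge C (l @ m) n \<cdot> (merge C l m \<odot> ?i ?n))) \<cdot> ?A a (?l \<otimes> ?m) ?n \<cdot> (?A a ?l ?m \<odot> ?i ?n)"
    by (subst assoc_nat) auto
  also have "\<dots> = (?i a \<odot> (merge C l (m @ n) \<cdot> (?i ?l \<odot> merge C m n))) \<cdot> (?i a \<odot> ?A ?l ?m ?n) \<cdot> ?A a (?l \<otimes> ?m) ?n \<cdot> (?A a ?l ?m \<odot> ?i ?n)"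
    by (subst Cons.IH) auto
  also have "\<dots> = (?i a \<odot> merge C l (m @ n)) \<cdot> (?i a \<odot> ?i ?l \<odot> merge C m n) \<cdot> ?A a ?l (?m \<otimes> ?n) \<cdot> ?A (a \<otimes> ?l) ?m ?n"
    by (simp del: tensor_ide add: pentagon)
  also have "(?i a \<odot> ?i ?l \<odot> merge C m n) \<cdot> ?A a ?l (?m \<otimes> ?n) \<cdot> ?A (a \<otimes> ?l) ?m ?n
      = ?A a ?l (word C (m @ n)) \<cdot> ((?i a \<odot> ?i ?l) \<odot> merge C m n) \<cdot> ?A (a \<otimes> ?l) ?m ?n"
    by (rule comp_chain2[OF assoc_nat[symmetric]]) auto
  finally show ?case by simp
qed

text \<open>Describes the tensor of arrows by a commuting square without inverses of
  \<open>merge\<close>, the form used for strict associativity and for the hexagons.\<close>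

lemma sten_simps:
  assumes [simp]: "f \<in> Arr C" "f' \<in> Arr C" "Dom C f = word C l" "Dom C f' = word C l'"
    "Cod C f = word C m" "Cod C f' = word C m'"
    "l \<in> lists (Obj C)" "l' \<in> lists (Obj C)" "m \<in> lists (Obj C)" "m' \<in> lists (Obj C)"
  shows "\<exists>g. sten C (l, f, m) (l', f', m') = (l @ l', g, m @ m') \<and> g \<in> Arr C \<and>
    Dom C g = word C (l @ l') \<and> Cod C g = word C (m @ m') \<and>
    g \<cdot> merge C l l' = merge C m m' \<cdot> (f \<odot> f')"
  by (simp add: sten_def)

end

section \<open>The strictification as a braided monoidal category\<close>

context braided_monoidal_category
begin

lemma strict_simps [simp]:
  "Obj (strict C) = lists (Obj C)"
  "Unit (strict C) = []" "a \<otimes>\<^bsub>strict C\<^esub> b = a @ b"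
  "Lun (strict C) = Ide (strict C)" "Run (strict C) = Ide (strict C)"
  "Assoc (strict C) a b c = Ide (strict C) (a @ b @ c)"
  "Dom (strict C) s = fst s" "Cod (strict C) s = snd (snd s)"
  "Ide (strict C) l = (l, Ide C (word C l), l)"
  "(l, f, m) \<in> Arr (strict C) \<longleftrightarrow>
    l \<in> lists (Obj C) \<and> m \<in> lists (Obj C) \<and> f \<in> Arr C \<and> Dom C f = word C l \<and> Cod C f = word C m"
  "(l', g, n) \<cdot>\<^bsub>strict C\<^esub> (l, f, m) = (l, g \<cdot> f, n)"
  "TArr (strict C) = sten C"
  by (auto simp: strict_def Let_def hom_def)

lemma strict_braid: "Braid (strict C) l m = (l @ m,
        merge C m l \<cdot> Braid C (word C l) (word C m) \<cdot> inv_arr C (merge C l m), m @ l)"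
  by (simp add: strict_def Let_def)

lemma category_strict: "category (strict C)"
proof
  fix f g h :: "'o list \<times> 'a \<times> 'o list" and a b c d
  show "f \<in> Arr (strict C) \<Longrightarrow> Dom (strict C) f \<in> Obj (strict C)"
    and "f \<in> Arr (strict C) \<Longrightarrow> Cod (strict C) f \<in> Obj (strict C)"
    by (cases f; simp)+
  show "a \<in> Obj (strict C) \<Longrightarrow> Ide (strict C) a \<in> hom (strict C) a a"
    by (simp add: hom_def)
  show "f \<in> hom (strict C) a b \<Longrightarrow> g \<in> hom (strict C) b c \<Longrightarrow> g \<cdot>\<^bsub>strict C\<^esub> f \<in> hom (strict C) a c"
    by (cases f; cases g) (auto simp: hom_def)
  show "f \<in> hom (strict C) a b \<Longrightarrow> Ide (strict C) b \<cdot>\<^bsub>strict C\<^esub> f = f"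
    "f \<in> hom (strict C) a b \<Longrightarrow> f \<cdot>\<^bsub>strict C\<^esub> Ide (strict C) a = f"
    by (cases f; auto simp: hom_def)+
  show "f \<in> hom (strict C) a b \<Longrightarrow> g \<in> hom (strict C) b c \<Longrightarrow> h \<in> hom (strict C) c d \<Longrightarrow>
      (h \<cdot>\<^bsub>strict C\<^esub> g) \<cdot>\<^bsub>strict C\<^esub> f = h \<cdot>\<^bsub>strict C\<^esub> (g \<cdot>\<^bsub>strict C\<^esub> f)"
    by (cases f; cases g; cases h) (auto simp: hom_def)
qed

lemma iso_strict:
  assumes "iso C f" "l \<in> lists (Obj C)" "m \<in> lists (Obj C)" "Dom C f = word C l" "Cod C f = word C m"
  shows "iso (strict C) (l, f, m)"
  unfolding iso_def inverse_arrows_def using assms iso_arr[OF assms(1)]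
  by (intro exI[of _ "(m, inv_arr C f, l)"]) (auto simp: hom_def)

lemma sten_unit:
  assumes [simp]: "l \<in> lists (Obj C)" "m \<in> lists (Obj C)" "f \<in> Arr C" "Dom C f = word C l" "Cod C f = word C m"
  shows "sten C ([], Ide C (Unit C), []) (l, f, m) = (l, f, m)"
    "sten C (l, f, m) ([], Ide C (Unit C), []) = (l, f, m)"
proof -
  show "sten C ([], Ide C (Unit C), []) (l, f, m) = (l, f, m)"
    by (simp add: sten_def comp_chain2[OF lun_nat])
  show "sten C (l, f, m) ([], Ide C (Unit C), []) = (l, f, m)"
    by (simp add: sten_def merge_nil comp_chain2[OF run_nat])
qed

text \<open>Precomposed with the iterated \<open>merge\<close>, each bracketing becomes the
  threefold tensor in \<open>C\<close> followed by an iterated \<open>merge\<close>. Then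
  \<open>merge_assoc\<close> identifies the two, and the isomorphism cancels.\<close>

lemma sten_assoc:
  assumes [simp]: "l \<in> lists (Obj C)" "m \<in> lists (Obj C)" "f \<in> Arr C" "Dom C f = word C l" "Cod C f = word C m"
    "l' \<in> lists (Obj C)" "m' \<in> lists (Obj C)" "f' \<in> Arr C" "Dom C f' = word C l'" "Cod C f' = word C m'"
    "l'' \<in> lists (Obj C)" "m'' \<in> lists (Obj C)" "f'' \<in> Arr C" "Dom C f'' = word C l''" "Cod C f'' = word C m''"
  shows "sten C (sten C (l, f, m) (l', f', m')) (l'', f'', m'') = sten C (l, f, m) (sten C (l', f', m') (l'', f'', m''))"
proof -
  obtain g where g: "sten C (l, f, m) (l', f', m') = (l @ l', g, m @ m')" "g \<cdot> merge C l l' = merge C m m' \<cdot> (f \<odot> f')"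
    and [simp]: "g \<in> Arr C" "Dom C g = word C (l @ l')" "Cod C g = word C (m @ m')"
    using sten_simps[of f f' l l' m m'] by auto
  obtain h where h: "sten C (l', f', m') (l'', f'', m'') = (l' @ l'', h, m' @ m'')" "h \<cdot> merge C l' l'' = merge C m' m'' \<cdot> (f' \<odot> f'')"
    and [simp]: "h \<in> Arr C" "Dom C h = word C (l' @ l'')" "Cod C h = word C (m' @ m'')"
    using sten_simps[of f' f'' l' l'' m' m''] by auto
  obtain p where p: "sten C (l @ l', g, m @ m') (l'', f'', m'') = ((l @ l') @ l'', p, (m @ m') @ m'')"
      "p \<cdot> merge C (l @ l') l'' = merge C (m @ m') m'' \<cdot> (g \<odot> f'')"
    and [simp]: "p \<in> Arr C" "Dom C p = word C ((l @ l') @ l'')" "Cod C p = word C ((m @ m') @ m'')"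
    using sten_simps[of g f'' "l @ l'" l'' "m @ m'" m''] by auto
  obtain q where q: "sten C (l, f, m) (l' @ l'', h, m' @ m'') = (l @ l' @ l'', q, m @ m' @ m'')"
      "q \<cdot> merge C l (l' @ l'') = merge C m (m' @ m'') \<cdot> (f \<odot> h)"
    and [simp]: "q \<in> Arr C" "Dom C q = word C (l @ l' @ l'')" "Cod C q = word C (m @ m' @ m'')"
    using sten_simps[of f h l "l' @ l''" m "m' @ m''"] by auto
  let ?w = "word C" and ?A = "Assoc C (word C l) (word C l') (word C l'')"
  have "p = q"
  proof (rule iso_cancel_right[of "merge C (l @ l') l'' \<cdot> (merge C l l' \<odot> Ide C (?w l''))"])
    have "p \<cdot> merge C (l @ l') l'' \<cdot> (merge C l l' \<odot> Ide C (?w l''))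
       = merge C (m @ m') m'' \<cdot> (merge C m m' \<odot> Ide C (?w m'')) \<cdot> ((f \<odot> f') \<odot> f'')"
      by (simp add: comp_chain2[OF p(2)] g(2))
    also have "\<dots> = merge C m (m' @ m'') \<cdot> (Ide C (?w m) \<odot> merge C m' m'') \<cdot> Assoc C (?w m) (?w m') (?w m'') \<cdot> ((f \<odot> f') \<odot> f'')"
      by (subst comp_chain[OF merge_assoc]) auto
    also have "\<dots> = merge C m (m' @ m'') \<cdot> (f \<odot> (h \<cdot> merge C l' l'')) \<cdot> ?A"
      by (simp add: assoc_nat h(2))
    also have "\<dots> = merge C m (m' @ m'') \<cdot> (f \<odot> h) \<cdot> (Ide C (?w l) \<odot> merge C l' l'') \<cdot> ?A"
      by simp
    also have "\<dots> = q \<cdot> merge C l (l' @ l'') \<cdot> (Ide C (?w l) \<odot> merge C l' l'') \<cdot> ?A"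
      by (rule comp_chain2[OF q(2)[symmetric]]) auto
    finally show "p \<cdot> merge C (l @ l') l'' \<cdot> (merge C l l' \<odot> Ide C (?w l''))
      = q \<cdot> merge C (l @ l') l'' \<cdot> (merge C l l' \<odot> Ide C (?w l''))"
      by (simp add: merge_assoc)
  qed auto
  then show ?thesis using g(1) h(1) p(1) q(1) by simp
qed

lemma monoidal_strict: "monoidal_category (strict C)"
proof -
  interpret S: category "strict C" by (rule category_strict)
  show ?thesis
  proof
    fix f g h f' g' :: "'o list \<times> 'a \<times> 'o list" and a b c d a' b' c' a'' b''
    let ?S = "strict C"
    show "f \<in> hom ?S a a' \<Longrightarrow> g \<in> hom ?S b b' \<Longrightarrow> f \<odot>\<^bsub>?S\<^esub> g \<in> hom ?S (a \<otimes>\<^bsub>?S\<^esub> b) (a' \<otimes>\<^bsub>?S\<^esub> b')"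
      by (cases f; cases g) (auto simp: hom_def sten_def)
    show "a \<in> Obj ?S \<Longrightarrow> b \<in> Obj ?S \<Longrightarrow> Ide ?S a \<odot>\<^bsub>?S\<^esub> Ide ?S b = Ide ?S (a \<otimes>\<^bsub>?S\<^esub> b)"
      by (simp add: sten_def)
    show "f \<in> hom ?S a a' \<Longrightarrow> f' \<in> hom ?S a' a'' \<Longrightarrow> g \<in> hom ?S b b' \<Longrightarrow> g' \<in> hom ?S b' b'' \<Longrightarrow>
       (f' \<cdot>\<^bsub>?S\<^esub> f) \<odot>\<^bsub>?S\<^esub> (g' \<cdot>\<^bsub>?S\<^esub> g) = (f' \<odot>\<^bsub>?S\<^esub> g') \<cdot>\<^bsub>?S\<^esub> (f \<odot>\<^bsub>?S\<^esub> g)"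
      by (cases f; cases g; cases f'; cases g') (auto simp: hom_def sten_def)
    show "f \<in> hom ?S a b \<Longrightarrow> f \<cdot>\<^bsub>?S\<^esub> Lun ?S a = Lun ?S b \<cdot>\<^bsub>?S\<^esub> (Ide ?S (Unit ?S) \<odot>\<^bsub>?S\<^esub> f)"
      by (cases f) (auto simp: hom_def sten_unit)
    show "f \<in> hom ?S a b \<Longrightarrow> f \<cdot>\<^bsub>?S\<^esub> Run ?S a = Run ?S b \<cdot>\<^bsub>?S\<^esub> (f \<odot>\<^bsub>?S\<^esub> Ide ?S (Unit ?S))"
      by (cases f) (auto simp: hom_def sten_unit)
    \<comment> \<open>With identity associators, naturality is exactly \<open>sten_assoc\<close>;
      the names \<open>p\<close> and \<open>q\<close> only let the simplifier compute the composites
      with identities.\<close>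
    assume "f \<in> hom ?S a a'" "g \<in> hom ?S b b'" "h \<in> hom ?S c c'"
    then obtain f0 g0 h0 where [simp]: "f = (a, f0, a')" "g = (b, g0, b')" "h = (c, h0, c')"
      and "f \<in> Arr ?S" "g \<in> Arr ?S" "h \<in> Arr ?S"
      by (cases f; cases g; cases h) (auto simp: hom_def)
    then have [simp]: "a \<in> lists (Obj C)" "a' \<in> lists (Obj C)" "f0 \<in> Arr C" "Dom C f0 = word C a" "Cod C f0 = word C a'"
      "b \<in> lists (Obj C)" "b' \<in> lists (Obj C)" "g0 \<in> Arr C" "Dom C g0 = word C b" "Cod C g0 = word C b'"
      "c \<in> lists (Obj C)" "c' \<in> lists (Obj C)" "h0 \<in> Arr C" "Dom C h0 = word C c" "Cod C h0 = word C c'"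
      by auto
    obtain p where [simp]: "sten C (b, g0, b') (c, h0, c') = (b @ c, p, b' @ c')"
        "p \<in> Arr C" "Dom C p = word C (b @ c)" "Cod C p = word C (b' @ c')"
      using sten_simps[of g0 h0 b c b' c'] by auto
    obtain q where [simp]: "sten C (a, f0, a') (b @ c, p, b' @ c') = (a @ b @ c, q, a' @ b' @ c')"
        "q \<in> Arr C" "Dom C q = word C (a @ b @ c)" "Cod C q = word C (a' @ b' @ c')"
      using sten_simps[of f0 p a "b @ c" a' "b' @ c'"] by auto
    show "(f \<odot>\<^bsub>?S\<^esub> (g \<odot>\<^bsub>?S\<^esub> h)) \<cdot>\<^bsub>?S\<^esub> Assoc ?S a b c = Assoc ?S a' b' c' \<cdot>\<^bsub>?S\<^esub> ((f \<odot>\<^bsub>?S\<^esub> g) \<odot>\<^bsub>?S\<^esub> h)"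
      by (simp add: sten_assoc)
  \<comment> \<open>In the remaining laws, pentagon and triangle included, all structure arrows are
    identities.\<close>
  qed (simp_all add: hom_def iso_strict, simp_all add: sten_def)
qed

lemma merge_assoc_inv:
  assumes [simp]: "l \<in> lists (Obj C)" "m \<in> lists (Obj C)" "n \<in> lists (Obj C)"
  shows "merge C (l @ m) n \<cdot> (merge C l m \<odot> Ide C (word C n)) \<cdot> inv_arr C (Assoc C (word C l) (word C m) (word C n)) =
    merge C l (m @ n) \<cdot> (Ide C (word C l) \<odot> merge C m n)"
  by (subst comp_chain[OF merge_assoc]) auto

lemma braided_strict: "braided_monoidal_category (strict C)"
proof -
  interpret S: monoidal_category "strict C" by (rule monoidal_strict)
  have inv_ide: "inv_arr (strict C) (l, Ide C (word C l), l) = (l, Ide C (word C l), l)" if "l \<in> lists (Obj C)" for l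
    using S.inv_ide[of l] that by simp
  \<comment> \<open>The braiding of words as an arrow of \<open>C\<close>. The hexagons use it
    through the square \<open>B_merge\<close>, which contains no inverse of
    \<open>merge\<close>.\<close>
  define B where "B l m = merge C m l \<cdot> Braid C (word C l) (word C m) \<cdot> inv_arr C (merge C l m)" for l m
  have B [simp]: "B l m \<in> Arr C" "Dom C (B l m) = word C (l @ m)" "Cod C (B l m) = word C (m @ l)" "iso C (B l m)"
    and B_merge: "B l m \<cdot> merge C l m = merge C m l \<cdot> Braid C (word C l) (word C m)"
    if [simp]: "l \<in> lists (Obj C)" "m \<in> lists (Obj C)" for l m
    by (simp_all add: B_def)
  have SB [simp]: "Braid (strict C) l m = (l @ m, B l m, m @ l)" for l m
    by (simp add: B_def strict_braid)
  show ?thesis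
  proof
    fix f g :: "'o list \<times> 'a \<times> 'o list" and a b c a' b'
    let ?S = "strict C" and ?w = "word C" and ?m = "merge C" and ?i = "\<lambda>l. Ide C (word C l)"
    show "a \<in> Obj ?S \<Longrightarrow> b \<in> Obj ?S \<Longrightarrow> Braid ?S a b \<in> hom ?S (a \<otimes>\<^bsub>?S\<^esub> b) (b \<otimes>\<^bsub>?S\<^esub> a)"
      by (simp add: hom_def)
    show "a \<in> Obj ?S \<Longrightarrow> b \<in> Obj ?S \<Longrightarrow> iso ?S (Braid ?S a b)"
      by (simp add: iso_strict)
    show "f \<in> hom ?S a a' \<Longrightarrow> g \<in> hom ?S b b' \<Longrightarrow>
        (g \<odot>\<^bsub>?S\<^esub> f) \<cdot>\<^bsub>?S\<^esub> Braid ?S a b = Braid ?S a' b' \<cdot>\<^bsub>?S\<^esub> (f \<odot>\<^bsub>?S\<^esub> g)"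
      by (cases f; cases g) (auto simp: hom_def sten_def B_def comp_chain2[OF braid_nat])
    assume "a \<in> Obj ?S" "b \<in> Obj ?S" "c \<in> Obj ?S"
    then have [simp]: "a \<in> lists (Obj C)" "b \<in> lists (Obj C)" "c \<in> lists (Obj C)" by auto
    obtain g1 where g1: "sten C (b, ?i b, b) (a @ c, B a c, c @ a) = (b @ a @ c, g1, b @ c @ a)"
        "g1 \<cdot> ?m b (a @ c) = ?m b (c @ a) \<cdot> (?i b \<odot> B a c)"
      and [simp]: "g1 \<in> Arr C" "Dom C g1 = ?w (b @ a @ c)" "Cod C g1 = ?w (b @ c @ a)"
      using sten_simps[of "?i b" "B a c" b "a @ c" b "c @ a"] by auto
    obtain g2 where g2: "sten C (a @ b, B a b, b @ a) (c, ?i c, c) = ((a @ b) @ c, g2, (b @ a) @ c)"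
        "g2 \<cdot> ?m (a @ b) c = ?m (b @ a) c \<cdot> (B a b \<odot> ?i c)"
      and [simp]: "g2 \<in> Arr C" "Dom C g2 = ?w ((a @ b) @ c)" "Cod C g2 = ?w ((b @ a) @ c)"
      using sten_simps[of "B a b" "?i c" "a @ b" c "b @ a" c] by auto
    \<comment> \<open>Both sides are compared on the threefold tensor of the values. The squares for
      \<open>B\<close>, \<open>g1\<close> and \<open>g2\<close> move every \<open>merge\<close> to
      the far left, where the hexagon of \<open>C\<close> remains.\<close>
    have hex1: "B a (b @ c) = g1 \<cdot> g2"
    proof (rule iso_cancel_right[of "?m (a @ b) c \<cdot> (?m a b \<odot> ?i c)"])
      have "B a (b @ c) \<cdot> ?m (a @ b) c \<cdot> (?m a b \<odot> ?i c)
          = B a (b @ c) \<cdot> ?m a (b @ c) \<cdot> (?i a \<odot> ?m b c) \<cdot> Assoc C (?w a) (?w b) (?w c)"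
        by (simp add: merge_assoc)
      also have "\<dots> = ?m (b @ c) a \<cdot> (Braid C (?w a) (?w (b @ c)) \<cdot> (?i a \<odot> ?m b c)) \<cdot> Assoc C (?w a) (?w b) (?w c)"
        by (simp add: comp_chain2[OF B_merge])
      also have "\<dots> = (?m (b @ c) a \<cdot> (?m b c \<odot> ?i a)) \<cdot> Braid C (?w a) (?w b \<otimes> ?w c) \<cdot> Assoc C (?w a) (?w b) (?w c)"
        by (subst braid_nat) auto
      also have "\<dots> = ?m b (c @ a) \<cdot> (?i b \<odot> ?m c a) \<cdot> Assoc C (?w b) (?w c) (?w a) \<cdot> Braid C (?w a) (?w b \<otimes> ?w c) \<cdot> Assoc C (?w a) (?w b) (?w c)"
        by (subst merge_assoc) auto
      also have "\<dots> = ?m b (c @ a) \<cdot> (?i b \<odot> (?m c a \<cdot> Braid C (?w a) (?w c))) \<cdot> Assoc C (?w b) (?w a) (?w c) \<cdot> (Braid C (?w a) (?w b) \<odot> ?i c)"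
        by (simp add: hexagon1)
      also have "\<dots> = ?m b (c @ a) \<cdot> (?i b \<odot> B a c) \<cdot> (?i b \<odot> ?m a c) \<cdot> Assoc C (?w b) (?w a) (?w c) \<cdot> (Braid C (?w a) (?w b) \<odot> ?i c)"
        by (simp add: B_merge)
      also have "\<dots> = g1 \<cdot> ?m b (a @ c) \<cdot> (?i b \<odot> ?m a c) \<cdot> Assoc C (?w b) (?w a) (?w c) \<cdot> (Braid C (?w a) (?w b) \<odot> ?i c)"
        by (rule comp_chain2[OF g1(2)[symmetric]]) auto
      also have "\<dots> = g1 \<cdot> (?m (b @ a) c \<cdot> (?m b a \<odot> ?i c)) \<cdot> (Braid C (?w a) (?w b) \<odot> ?i c)"
        by (subst merge_assoc) auto
      also have "\<dots> = g1 \<cdot> ?m (b @ a) c \<cdot> (B a b \<odot> ?i c) \<cdot> (?m a b \<odot> ?i c)"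
        by (simp add: B_merge)
      also have "\<dots> = (g1 \<cdot> g2) \<cdot> ?m (a @ b) c \<cdot> (?m a b \<odot> ?i c)"
        by (simp add: comp_chain2[OF g2(2)] del: tensor_merge)
      finally show "B a (b @ c) \<cdot> ?m (a @ b) c \<cdot> (?m a b \<odot> ?i c) = (g1 \<cdot> g2) \<cdot> ?m (a @ b) c \<cdot> (?m a b \<odot> ?i c)" .
    qed auto
    show "Assoc ?S b c a \<cdot>\<^bsub>?S\<^esub> Braid ?S a (b \<otimes>\<^bsub>?S\<^esub> c) \<cdot>\<^bsub>?S\<^esub> Assoc ?S a b c =
      (Ide ?S b \<odot>\<^bsub>?S\<^esub> Braid ?S a c) \<cdot>\<^bsub>?S\<^esub> Assoc ?S b a c \<cdot>\<^bsub>?S\<^esub> (Braid ?S a b \<odot>\<^bsub>?S\<^esub> Ide ?S c)"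
      by (simp add: g1(1) g2(1) hex1)
    obtain h1 where h1: "sten C (a @ c, B a c, c @ a) (b, ?i b, b) = ((a @ c) @ b, h1, (c @ a) @ b)"
        "h1 \<cdot> ?m (a @ c) b = ?m (c @ a) b \<cdot> (B a c \<odot> ?i b)"
      and [simp]: "h1 \<in> Arr C" "Dom C h1 = ?w ((a @ c) @ b)" "Cod C h1 = ?w ((c @ a) @ b)"
      using sten_simps[of "B a c" "?i b" "a @ c" b "c @ a" b] by auto
    obtain h2 where h2: "sten C (a, ?i a, a) (b @ c, B b c, c @ b) = (a @ b @ c, h2, a @ c @ b)"
        "h2 \<cdot> ?m a (b @ c) = ?m a (c @ b) \<cdot> (?i a \<odot> B b c)"
      and [simp]: "h2 \<in> Arr C" "Dom C h2 = ?w (a @ b @ c)" "Cod C h2 = ?w (a @ c @ b)"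
      using sten_simps[of "?i a" "B b c" a "b @ c" a "c @ b"] by auto
    let ?A = "\<lambda>a b c. inv_arr C (Assoc C (?w a) (?w b) (?w c))"
    have hex2: "B (a @ b) c = h1 \<cdot> h2"
    proof (rule iso_cancel_right[of "?m a (b @ c) \<cdot> (?i a \<odot> ?m b c)"])
      have "B (a @ b) c \<cdot> ?m a (b @ c) \<cdot> (?i a \<odot> ?m b c)
          = B (a @ b) c \<cdot> ?m (a @ b) c \<cdot> (?m a b \<odot> ?i c) \<cdot> ?A a b c"
        by (simp add: merge_assoc_inv)
      also have "\<dots> = ?m c (a @ b) \<cdot> (Braid C (?w (a @ b)) (?w c) \<cdot> (?m a b \<odot> ?i c)) \<cdot> ?A a b c"
        by (simp add: comp_chain2[OF B_merge])
      also have "\<dots> = (?m c (a @ b) \<cdot> (?i c \<odot> ?m a b)) \<cdot> Braid C (?w a \<otimes> ?w b) (?w c) \<cdot> ?A a b c"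
        by (subst braid_nat) auto
      also have "\<dots> = ?m (c @ a) b \<cdot> (?m c a \<odot> ?i b) \<cdot> ?A c a b \<cdot> Braid C (?w a \<otimes> ?w b) (?w c) \<cdot> ?A a b c"
        by (subst merge_assoc_inv[symmetric]) auto
      also have "\<dots> = ?m (c @ a) b \<cdot> ((?m c a \<cdot> Braid C (?w a) (?w c)) \<odot> ?i b) \<cdot> ?A a c b \<cdot> (?i a \<odot> Braid C (?w b) (?w c))"
        by (simp add: hexagon2)
      also have "\<dots> = ?m (c @ a) b \<cdot> (B a c \<odot> ?i b) \<cdot> (?m a c \<odot> ?i b) \<cdot> ?A a c b \<cdot> (?i a \<odot> Braid C (?w b) (?w c))"
        by (simp add: B_merge)
      also have "\<dots> = h1 \<cdot> ?m (a @ c) b \<cdot> (?m a c \<odot> ?i b) \<cdot> ?A a c b \<cdot> (?i a \<odot> Braid C (?w b) (?w c))"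
        by (rule comp_chain2[OF h1(2)[symmetric]]) auto
      also have "\<dots> = h1 \<cdot> (?m (a @ c) b \<cdot> (?m a c \<odot> ?i b) \<cdot> ?A a c b) \<cdot> (?i a \<odot> Braid C (?w b) (?w c))"
        by simp
      also have "\<dots> = h1 \<cdot> ?m a (c @ b) \<cdot> (?i a \<odot> B b c) \<cdot> (?i a \<odot> ?m b c)"
        by (subst merge_assoc_inv) (auto simp: B_merge)
      also have "\<dots> = (h1 \<cdot> h2) \<cdot> ?m a (b @ c) \<cdot> (?i a \<odot> ?m b c)"
        by (simp add: comp_chain2[OF h2(2)] del: tensor_merge)
      finally show "B (a @ b) c \<cdot> ?m a (b @ c) \<cdot> (?i a \<odot> ?m b c) = (h1 \<cdot> h2) \<cdot> ?m a (b @ c) \<cdot> (?i a \<odot> ?m b c)" .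
    qed auto
    show "inv_arr ?S (Assoc ?S c a b) \<cdot>\<^bsub>?S\<^esub> Braid ?S (a \<otimes>\<^bsub>?S\<^esub> b) c \<cdot>\<^bsub>?S\<^esub> inv_arr ?S (Assoc ?S a b c) =
      (Braid ?S a c \<odot>\<^bsub>?S\<^esub> Ide ?S b) \<cdot>\<^bsub>?S\<^esub> inv_arr ?S (Assoc ?S a c b) \<cdot>\<^bsub>?S\<^esub> (Ide ?S a \<odot>\<^bsub>?S\<^esub> Braid ?S b c)"
      by (simp add: inv_ide h1(1) h2(1) hex2 del: word.simps)
  qed
qed

end

section \<open>Coherence\<close>

datatype 'v mexp = Var 'v | One | Ten "'v mexp" "'v mexp"

text \<open>Formal inverses exist for associators and unitors; the diagrams to be proved contain no
  inverse braiding.\<close>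

datatype 'v mterm =
    Id "'v mexp"
  | Asc "'v mexp" "'v mexp" "'v mexp" | AscI "'v mexp" "'v mexp" "'v mexp"
  | Lu "'v mexp" | LuI "'v mexp" | Ru "'v mexp" | RuI "'v mexp"
  | Brd "'v mexp" "'v mexp"
  | Cmp "'v mterm" "'v mterm" | Tns "'v mterm" "'v mterm"

primrec src :: "'v mterm \<Rightarrow> 'v mexp" where
  "src (Id X) = X"
| "src (Asc X Y Z) = Ten (Ten X Y) Z"
| "src (AscI X Y Z) = Ten X (Ten Y Z)"
| "src (Lu X) = Ten One X"
| "src (LuI X) = X"
| "src (Ru X) = Ten X One"
| "src (RuI X) = X"
| "src (Brd X Y) = Ten X Y"
| "src (Cmp t u) = src u"
| "src (Tns t u) = Ten (src t) (src u)"

primrec tgt :: "'v mterm \<Rightarrow> 'v mexp" where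
  "tgt (Id X) = X"
| "tgt (Asc X Y Z) = Ten X (Ten Y Z)"
| "tgt (AscI X Y Z) = Ten (Ten X Y) Z"
| "tgt (Lu X) = X"
| "tgt (LuI X) = Ten One X"
| "tgt (Ru X) = X"
| "tgt (RuI X) = Ten X One"
| "tgt (Brd X Y) = Ten Y X"
| "tgt (Cmp t u) = tgt t"
| "tgt (Tns t u) = Ten (tgt t) (tgt u)"

text \<open>Composability compares expressions and not their values, so one term is composable in
  \<open>C\<close> and in the strictification alike.\<close>

primrec typed :: "'v mterm \<Rightarrow> bool" where
  "typed (Id X) = True"
| "typed (Asc X Y Z) = True"
| "typed (AscI X Y Z) = True"
| "typed (Lu X) = True"
| "typed (LuI X) = True"
| "typed (Ru X) = True"
| "typed (RuI X) = True"
| "typed (Brd X Y) = True"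
| "typed (Cmp t u) = (typed t \<and> typed u \<and> tgt u = src t)"
| "typed (Tns t u) = (typed t \<and> typed u)"

primrec obj_val :: "('o, 'a, 'z) brmoncat_scheme \<Rightarrow> ('v \<Rightarrow> 'o) \<Rightarrow> 'v mexp \<Rightarrow> 'o" where
  "obj_val C v (Var x) = v x"
| "obj_val C v One = Unit C"
| "obj_val C v (Ten X Y) = obj_val C v X \<otimes>\<^bsub>C\<^esub> obj_val C v Y"

primrec arr_val :: "('o, 'a, 'z) brmoncat_scheme \<Rightarrow> ('v \<Rightarrow> 'o) \<Rightarrow> 'v mterm \<Rightarrow> 'a" where
  "arr_val C v (Id X) = Ide C (obj_val C v X)"
| "arr_val C v (Asc X Y Z) = Assoc C (obj_val C v X) (obj_val C v Y) (obj_val C v Z)"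
| "arr_val C v (AscI X Y Z) = inv_arr C (Assoc C (obj_val C v X) (obj_val C v Y) (obj_val C v Z))"
| "arr_val C v (Lu X) = Lun C (obj_val C v X)"
| "arr_val C v (LuI X) = inv_arr C (Lun C (obj_val C v X))"
| "arr_val C v (Ru X) = Run C (obj_val C v X)"
| "arr_val C v (RuI X) = inv_arr C (Run C (obj_val C v X))"
| "arr_val C v (Brd X Y) = Braid C (obj_val C v X) (obj_val C v Y)"
| "arr_val C v (Cmp t u) = arr_val C v t \<cdot>\<^bsub>C\<^esub> arr_val C v u"
| "arr_val C v (Tns t u) = arr_val C v t \<odot>\<^bsub>C\<^esub> arr_val C v u"

definition itc :: "'v mexp \<Rightarrow> 'v mexp \<Rightarrow> 'v mexp \<Rightarrow> 'v mexp \<Rightarrow> 'v mterm" where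
  "itc a b c d = Cmp (AscI a c (Ten b d))
     (Cmp (Tns (Id a) (Cmp (Asc c b d) (Cmp (Tns (Brd b c) (Id d)) (AscI b c d)))) (Asc a b (Ten c d)))"

lemma itc_simps [simp]:
  "src (itc a b c d) = Ten (Ten a b) (Ten c d)" "tgt (itc a b c d) = Ten (Ten a c) (Ten b d)"
  "typed (itc a b c d)" "set_mterm (itc a b c d) = set_mexp a \<union> set_mexp b \<union> set_mexp c \<union> set_mexp d"
  "arr_val C v (itc a b c d) = interchange C (obj_val C v a) (obj_val C v b) (obj_val C v c) (obj_val C v d)"
  by (auto simp: itc_def interchange_def)

text \<open>The canonical isomorphism from the value of an expression in \<open>C\<close> to the
  value of its flattened word. A variable needs the inverse right unitor because
  \<open>word C [a]\<close> is \<open>a \<otimes> I\<close>.\<close>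

primrec norm :: "('o, 'a, 'z) brmoncat_scheme \<Rightarrow> 'o mexp \<Rightarrow> 'a" where
  "norm C (Var a) = inv_arr C (Run C a)"
| "norm C One = Ide C (Unit C)"
| "norm C (Ten X Y) = merge C (obj_val (strict C) (\<lambda>a. [a]) X) (obj_val (strict C) (\<lambda>a. [a]) Y) \<cdot>\<^bsub>C\<^esub> (norm C X \<odot>\<^bsub>C\<^esub> norm C Y)"

section \<open>Comparison of formal terms with their strict values\<close>

context braided_monoidal_category
begin

interpretation S: strict_braided_monoidal_category "strict C"
proof -
  interpret S: braided_monoidal_category "strict C" by (rule braided_strict)
  show "strict_braided_monoidal_category (strict C)"
    by unfold_locales simp_all
qed

abbreviation "ob \<equiv> obj_val C (\<lambda>a. a)"
abbreviation "arr \<equiv> arr_val C (\<lambda>a. a)"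
abbreviation "flat \<equiv> obj_val (strict C) (\<lambda>a. [a])"
abbreviation "arr_flat \<equiv> arr_val (strict C) (\<lambda>a. [a])"

lemma obj_val_obj [simp]:
  "set_mexp X \<subseteq> Obj C \<Longrightarrow> ob X \<in> Obj C"
  "set_mexp X \<subseteq> Obj C \<Longrightarrow> flat X \<in> lists (Obj C)"
  by (induction X) auto

lemma norm_simps [simp]:
  assumes "set_mexp X \<subseteq> Obj C"
  shows "norm C X \<in> Arr C" "Dom C (norm C X) = ob X"
    "Cod C (norm C X) = word C (flat X)" "iso C (norm C X)"
  using assms by (induction X) simp_all

text \<open>Naturality of \<open>norm\<close> at an associator, whose strict value is an identity.
  The content is \<open>merge_assoc\<close>.\<close>

lemma norm_assoc:
  assumes [simp]: "set_mexp X \<subseteq> Obj C" "set_mexp Y \<subseteq> Obj C" "set_mexp Z \<subseteq> Obj C"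
  shows "norm C (Ten (Ten X Y) Z) =
    norm C (Ten X (Ten Y Z)) \<cdot> Assoc C (ob X) (ob Y) (ob Z)"
proof -
  let ?l = flat and ?n = "norm C" and ?m = "merge C"
  have "?n (Ten (Ten X Y) Z) =
      (?m (?l X @ ?l Y) (?l Z) \<cdot> (?m (?l X) (?l Y) \<odot> Ide C (word C (?l Z)))) \<cdot> ((?n X \<odot> ?n Y) \<odot> ?n Z)"
    by simp
  also have "\<dots> = ?m (?l X) (?l Y @ ?l Z) \<cdot> (Ide C (word C (?l X)) \<odot> ?m (?l Y) (?l Z)) \<cdot>
      Assoc C (word C (?l X)) (word C (?l Y)) (word C (?l Z)) \<cdot> ((?n X \<odot> ?n Y) \<odot> ?n Z)"
    by (subst merge_assoc) auto
  also have "\<dots> = ?n (Ten X (Ten Y Z)) \<cdot> Assoc C (ob X) (ob Y) (ob Z)"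
    by (subst assoc_nat) auto
  finally show ?thesis .
qed

lemma norm_unit:
  assumes [simp]: "set_mexp X \<subseteq> Obj C"
  shows "norm C (Ten One X) = norm C X \<cdot> Lun C (ob X)"
    "norm C (Ten X One) = norm C X \<cdot> Run C (ob X)"
  by (simp_all add: lun_nat run_nat merge_nil)

lemma norm_braid:
  assumes [simp]: "set_mexp X \<subseteq> Obj C" "set_mexp Y \<subseteq> Obj C"
  shows "norm C (Ten Y X) \<cdot> Braid C (ob X) (ob Y) =
    fst (snd (Braid (strict C) (flat X) (flat Y))) \<cdot> norm C (Ten X Y)"
  by (simp add: strict_braid braid_nat)

lemma inv_ide_strict: "l \<in> lists (Obj C) \<Longrightarrow> inv_arr (strict C) (l, Ide C (word C l), l) = (l, Ide C (word C l), l)"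
  using S.inv_ide[of l] by simp

text \<open>The square with \<open>norm\<close> that relates the two values of \<open>t\<close>,
  bundled with the typing facts so that the induction over terms carries them along.\<close>

definition strictifies :: "'o mterm \<Rightarrow> 'a \<Rightarrow> bool" where
  "strictifies t f \<longleftrightarrow> arr_flat t = (flat (src t), f, flat (tgt t)) \<and>
     f \<in> Arr C \<and> Dom C f = word C (flat (src t)) \<and> Cod C f = word C (flat (tgt t)) \<and>
     arr t \<in> Arr C \<and> Dom C (arr t) = ob (src t) \<and> Cod C (arr t) = ob (tgt t) \<and>
     set_mexp (src t) \<subseteq> Obj C \<and> set_mexp (tgt t) \<subseteq> Obj C \<and>
     f \<cdot> norm C (src t) = norm C (tgt t) \<cdot> arr t"

lemma ex_strictifies:
  assumes "typed t" "set_mterm t \<subseteq> Obj C"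
  shows "\<exists>f. strictifies t f"
  using assms
proof (induction t)
  case (Id X)
  then show ?case by (simp add: strictifies_def)
next
  case (Asc X Y Z)
  then show ?case by (simp add: strictifies_def norm_assoc del: norm.simps)
next
  case (AscI X Y Z)
  then show ?case by (simp add: strictifies_def norm_assoc inv_ide_strict del: norm.simps)
next
  case (Lu X)
  then show ?case by (simp add: strictifies_def norm_unit del: norm.simps)
next
  case (LuI X)
  then show ?case by (simp add: strictifies_def norm_unit inv_ide_strict del: norm.simps)
next
  case (Ru X)
  then show ?case by (simp add: strictifies_def norm_unit del: norm.simps)
next
  case (RuI X)
  then show ?case by (simp add: strictifies_def norm_unit inv_ide_strict del: norm.simps)
next
  case (Brd X Y)
  then show ?case using norm_braid[of X Y] by (simp add: strictifies_def strict_braid del: norm.simps)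
next
  case (Cmp t u)
  then obtain f g where f: "strictifies t f" and g: "strictifies u g" by auto
  have tu: "tgt u = src t" using Cmp.prems by simp
  have eq: "f \<cdot> norm C (src t) = norm C (tgt t) \<cdot> arr t" using f by (simp add: strictifies_def)
  show ?case using f g by (simp add: strictifies_def tu comp_chain2[OF eq])
next
  case (Tns t u)
  then obtain f g where f: "strictifies t f" and g: "strictifies u g" by auto
  then show ?case by (simp add: strictifies_def sten_def)
qed

text \<open>\<open>norm\<close> is invertible at source and target, so either value of a term
  determines the other. From right to left this lifts strict braid identities to \<open>C\<close>;
  from left to right it carries hypotheses about braidings of \<open>C\<close> to words.\<close>

lemma coherence_iff:
  assumes "typed t" "typed u" "src t = src u" "tgt t = tgt u" "set_mterm t \<subseteq> Obj C" "set_mterm u \<subseteq> Obj C"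
  shows "arr t = arr u \<longleftrightarrow> arr_flat t = arr_flat u" (is "?P \<longleftrightarrow> ?Q")
proof
  obtain f where F: "strictifies t f" using ex_strictifies[OF assms(1,5)] ..
  obtain g where G: "strictifies u g" using ex_strictifies[OF assms(2,6)] ..
  note * = F[unfolded strictifies_def assms(3,4)] G[unfolded strictifies_def]
  have [simp]: "set_mexp (src u) \<subseteq> Obj C" "set_mexp (tgt u) \<subseteq> Obj C" using *(2) by - (elim conjE, assumption)+
  from * have f: "f \<cdot> norm C (src u) = norm C (tgt u) \<cdot> arr t" "arr_flat t = (flat (src u), f, flat (tgt u))"
    and g: "g \<cdot> norm C (src u) = norm C (tgt u) \<cdot> arr u" "arr_flat u = (flat (src u), g, flat (tgt u))"
    by - (elim conjE, assumption)+
  from * have arrs: "f \<in> Arr C" "g \<in> Arr C" "Dom C f = word C (flat (src u))" "Dom C g = word C (flat (src u))"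
    "arr t \<in> Arr C" "arr u \<in> Arr C" "Cod C (arr t) = ob (tgt u)" "Cod C (arr u) = ob (tgt u)"
    by - (elim conjE, assumption)+
  show ?Q if ?P
  proof -
    have "f \<cdot> norm C (src u) = g \<cdot> norm C (src u)" by (simp add: f(1) g(1) that)
    then have "f = g" by (rule iso_cancel_right[rotated]) (use arrs in simp_all)
    then show ?Q by (simp add: f(2) g(2))
  qed
  show ?P if ?Q
  proof (rule iso_cancel_left[of "norm C (tgt u)"])
    have "f = g" using that f(2) g(2) by simp
    then show "norm C (tgt u) \<cdot> arr t = norm C (tgt u) \<cdot> arr u"
      using f(1) g(1) by metis
  qed (use arrs in simp_all)
qed

lemmas coherence = coherence_iff[THEN iffD2]

declare strict_simps [simp del]

end

section \<open>Braid identities in strict braided monoidal categories\<close>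

context strict_braided_monoidal_category
begin

lemma interchange_strict:
  assumes [simp]: "a \<in> Obj S" "b \<in> Obj S" "c \<in> Obj S" "d \<in> Obj S"
  shows "interchange S a b c d = Ide S a \<odot> Braid S b c \<odot> Ide S d"
  by (simp add: interchange_def)

lemma whisker_comp:
  assumes "p \<in> Arr S" "q \<in> Arr S" "Dom S p = Cod S q" "a \<in> Obj S" "c \<in> Obj S"
  shows "(Ide S a \<odot> p \<odot> Ide S c) \<cdot> (Ide S a \<odot> q \<odot> Ide S c) = Ide S a \<odot> (p \<cdot> q) \<odot> Ide S c"
  using assms by simp

text \<open>Both sides take the strands \<open>a a' b b' c c'\<close> to
  \<open>a b c a' b' c'\<close> and cross the pairs \<open>(a', b)\<close>, \<open>(b', c)\<close>,
  \<open>(a', c)\<close>. The crossings \<open>?z\<close> and \<open>?y\<close> are disjoint, so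
  their order is irrelevant and both sides are the whiskered braid \<open>?P\<close>.\<close>

lemma interchange_assoc_strict:
  assumes [simp]: "a \<in> Obj S" "b \<in> Obj S" "c \<in> Obj S" "a' \<in> Obj S" "b' \<in> Obj S" "c' \<in> Obj S"
  shows "interchange S (a \<otimes> b) (a' \<otimes> b') c c' \<cdot> (interchange S a a' b b' \<odot> Ide S (c \<otimes> c')) =
    interchange S a a' (b \<otimes> c) (b' \<otimes> c') \<cdot> (Ide S (a \<otimes> a') \<odot> interchange S b b' c c')"
proof -
  let ?i = "Ide S"
  let ?x = "Braid S a' c" and ?y = "Braid S b' c" and ?z = "Braid S a' b"
  let ?P = "(?i b \<odot> ?x \<odot> ?i b') \<cdot> (?z \<odot> ?y)"
  have ide_split: "?i (p \<otimes> q) = ?i p \<odot> ?i q" if "p \<in> Obj S" "q \<in> Obj S" for p q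
    using that by simp
  have l1: "interchange S (a \<otimes> b) (a' \<otimes> b') c c' = ?i a \<odot> ((?i b \<odot> ?x \<odot> ?i b') \<cdot> (?i (b \<otimes> a') \<odot> ?y)) \<odot> ?i c'"
    by (simp add: interchange_strict braid_tensor_left ide_split del: tensor_ide)
  have l2: "interchange S a a' b b' \<odot> ?i (c \<otimes> c') = ?i a \<odot> (?z \<odot> ?i (b' \<otimes> c)) \<odot> ?i c'"
    by (simp add: interchange_strict ide_split del: tensor_ide)
  have "((?i b \<odot> ?x) \<cdot> (?z \<odot> ?i c)) \<odot> ?i b' = ((?i b \<odot> ?x) \<odot> ?i b') \<cdot> ((?z \<odot> ?i c) \<odot> ?i b')"
    by (subst tensor_merge) auto
  then have w2: "((?i b \<odot> ?x) \<cdot> (?z \<odot> ?i c)) \<odot> ?i b' = (?i b \<odot> ?x \<odot> ?i b') \<cdot> (?z \<odot> ?i (c \<otimes> b'))"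
    by simp
  have "interchange S a a' (b \<otimes> c) (b' \<otimes> c') = ?i a \<odot> (((?i b \<odot> ?x) \<cdot> (?z \<odot> ?i c)) \<odot> ?i b') \<odot> ?i c'"
    by (simp add: interchange_strict braid_tensor_right ide_split del: tensor_ide)
  note r1 = this[unfolded w2]
  have r2: "?i (a \<otimes> a') \<odot> interchange S b b' c c' = ?i a \<odot> (?i (a' \<otimes> b) \<odot> ?y) \<odot> ?i c'"
    by (simp add: interchange_strict ide_split del: tensor_ide)
  have l: "((?i b \<odot> ?x \<odot> ?i b') \<cdot> (?i (b \<otimes> a') \<odot> ?y)) \<cdot> (?z \<odot> ?i (b' \<otimes> c)) = ?P"
    and r: "((?i b \<odot> ?x \<odot> ?i b') \<cdot> (?z \<odot> ?i (c \<otimes> b'))) \<cdot> (?i (a' \<otimes> b) \<odot> ?y) = ?P"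
    by simp_all
  show ?thesis unfolding l1 l2 r1 r2 by (subst (1 2) whisker_comp; simp add: l r del: arr_assoc tensor_merge)
qed

text \<open>Both sides cross the strand pairs \<open>(c, a')\<close>, \<open>(c, b')\<close>, \<open>(b, a')\<close> of \<open>a b c a' b' c'\<close>.\<close>

lemma interchange_mult_strict:
  assumes [simp]: "a \<in> Obj S" "b \<in> Obj S" "c \<in> Obj S" "a' \<in> Obj S" "b' \<in> Obj S" "c' \<in> Obj S"
  shows "(Ide S (a \<otimes> a') \<odot> interchange S b c b' c') \<cdot> interchange S a (b \<otimes> c) a' (b' \<otimes> c') =
    (interchange S a b a' b' \<odot> Ide S (c \<otimes> c')) \<cdot> interchange S (a \<otimes> b) c (a' \<otimes> b') c'"
proof -
  let ?i = "Ide S"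
  let ?x = "Braid S b a'" and ?y = "Braid S c a'" and ?z = "Braid S c b'"
  have ide_split: "?i (p \<otimes> q) = ?i p \<odot> ?i q" if "p \<in> Obj S" "q \<in> Obj S" for p q
    using that by simp
  have l1: "?i (a \<otimes> a') \<odot> interchange S b c b' c' = ?i a \<odot> (?i (a' \<otimes> b) \<odot> ?z) \<odot> ?i c'"
    by (simp add: interchange_strict ide_split del: tensor_ide)
  have "((?x \<odot> ?i c) \<cdot> (?i b \<odot> ?y)) \<odot> ?i b' = ((?x \<odot> ?i c) \<odot> ?i b') \<cdot> ((?i b \<odot> ?y) \<odot> ?i b')"
    by (subst tensor_merge) auto
  then have w2: "((?x \<odot> ?i c) \<cdot> (?i b \<odot> ?y)) \<odot> ?i b' = (?x \<odot> ?i (c \<otimes> b')) \<cdot> (?i b \<odot> ?y \<odot> ?i b')"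
    by simp
  have "interchange S a (b \<otimes> c) a' (b' \<otimes> c') = ?i a \<odot> (((?x \<odot> ?i c) \<cdot> (?i b \<odot> ?y)) \<odot> ?i b') \<odot> ?i c'"
    by (simp add: interchange_strict braid_tensor_left ide_split del: tensor_ide)
  note l2 = this[unfolded w2]
  have r1: "interchange S a b a' b' \<odot> ?i (c \<otimes> c') = ?i a \<odot> (?x \<odot> ?i (b' \<otimes> c)) \<odot> ?i c'"
    by (simp add: interchange_strict ide_split del: tensor_ide)
  have r2: "interchange S (a \<otimes> b) c (a' \<otimes> b') c' = ?i a \<odot> ((?i (b \<otimes> a') \<odot> ?z) \<cdot> (?i b \<odot> ?y \<odot> ?i b')) \<odot> ?i c'"
    by (simp add: interchange_strict braid_tensor_right ide_split del: tensor_ide)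
  let ?P = "(?x \<odot> ?z) \<cdot> (?i b \<odot> ?y \<odot> ?i b')"
  have l: "(?i (a' \<otimes> b) \<odot> ?z) \<cdot> ((?x \<odot> ?i (c \<otimes> b')) \<cdot> (?i b \<odot> ?y \<odot> ?i b')) = ?P"
    and r: "(?x \<odot> ?i (b' \<otimes> c)) \<cdot> ((?i (b \<otimes> a') \<odot> ?z) \<cdot> (?i b \<odot> ?y \<odot> ?i b')) = ?P"
    by simp_all
  show ?thesis unfolding l1 l2 r1 r2 by (subst (1 2) whisker_comp; simp add: l r del: arr_assoc tensor_merge)
qed

text \<open>Braiding two pairs past each other crosses \<open>(b, c)\<close>, \<open>(a, c)\<close>,
  \<open>(b, d)\<close> and \<open>(a, d)\<close>. The interchange after it crosses \<open>d\<close>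
  and \<open>a\<close> back, which by \<open>sym\<close> undoes the last of these. This is the point
  at which centrality makes the action of the center braided.\<close>

lemma interchange_braid_strict:
  assumes [simp]: "a \<in> Obj S" "b \<in> Obj S" "c \<in> Obj S" "d \<in> Obj S"
    and sym: "Braid S d a \<cdot> Braid S a d = Ide S (a \<otimes> d)"
  shows "(Braid S a c \<odot> Braid S b d) \<cdot> interchange S a b c d = interchange S c d a b \<cdot> Braid S (a \<otimes> b) (c \<otimes> d)"
proof -
  let ?i = "Ide S" and ?B = "Braid S"
  have ide_split: "?i (p \<otimes> q) = ?i p \<odot> ?i q" if "p \<in> Obj S" "q \<in> Obj S" for p q
    using that by simp
  \<comment> \<open>The crossing of \<open>a\<close> with \<open>d\<close> is put into the left
    factor, where it meets the crossing of \<open>d\<close> with \<open>a\<close> from the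
    interchange.\<close>
  have B1: "?B (a \<otimes> b) (c \<otimes> d) = (?i c \<odot> ((?B a d \<odot> ?i b) \<cdot> (?i a \<odot> ?B b d))) \<cdot> ((?B a c \<odot> ?i (b \<otimes> d)) \<cdot> (?i a \<odot> ?B b c \<odot> ?i d))"
  proof -
    have "((?B a c \<odot> ?i b) \<cdot> (?i a \<odot> ?B b c)) \<odot> ?i d = ((?B a c \<odot> ?i b) \<odot> ?i d) \<cdot> ((?i a \<odot> ?B b c) \<odot> ?i d)"
      by (subst tensor_merge) auto
    also have "\<dots> = (?B a c \<odot> ?i (b \<otimes> d)) \<cdot> (?i a \<odot> ?B b c \<odot> ?i d)"
      by simp
    finally show ?thesis
      by (subst braid_tensor_right) (simp_all add: braid_tensor_left)
  qed
  have B2: "interchange S c d a b \<cdot> (?i c \<odot> ((?B a d \<odot> ?i b) \<cdot> (?i a \<odot> ?B b d))) = ?i (c \<otimes> a) \<odot> ?B b d"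
  proof -
    have "((?B d a \<odot> ?i b) \<cdot> (?B a d \<odot> ?i b)) \<cdot> (?i a \<odot> ?B b d) = ?i a \<odot> ?B b d"
      by (subst tensor_merge) (auto simp: sym)
    then show ?thesis
      by (simp add: interchange_strict ide_split del: tensor_ide)
  qed
  have "interchange S c d a b \<cdot> ?B (a \<otimes> b) (c \<otimes> d)
      = (interchange S c d a b \<cdot> (?i c \<odot> ((?B a d \<odot> ?i b) \<cdot> (?i a \<odot> ?B b d)))) \<cdot> ((?B a c \<odot> ?i (b \<otimes> d)) \<cdot> (?i a \<odot> ?B b c \<odot> ?i d))"
    unfolding B1 by (subst comp_assoc_simp) (auto simp: interchange_strict simp del: tensor_merge)
  also have "\<dots> = (?i (c \<otimes> a) \<odot> ?B b d) \<cdot> ((?B a c \<odot> ?i (b \<otimes> d)) \<cdot> (?i a \<odot> ?B b c \<odot> ?i d))"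
    unfolding B2 ..
  also have "\<dots> = (?B a c \<odot> ?B b d) \<cdot> (?i a \<odot> ?B b c \<odot> ?i d)"
    by simp
  finally show ?thesis by (simp add: interchange_strict)
qed

text \<open>The double crossing of \<open>d\<close> with \<open>a\<close> is innermost and cancels
  first, then the one with \<open>b\<close>. This closes the symmetric center under tensor
  products.\<close>

lemma braid_tensor_symmetric_strict:
  assumes [simp]: "a \<in> Obj S" "b \<in> Obj S" "d \<in> Obj S"
    and sym: "Braid S d a \<cdot> Braid S a d = Ide S (a \<otimes> d)" "Braid S d b \<cdot> Braid S b d = Ide S (b \<otimes> d)"
  shows "Braid S d (a \<otimes> b) \<cdot> Braid S (a \<otimes> b) d = Ide S (a \<otimes> b \<otimes> d)"
proof -
  let ?i = "Ide S" and ?B = "Braid S"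
  have "?B d (a \<otimes> b) \<cdot> ?B (a \<otimes> b) d = (?i a \<odot> ?B d b) \<cdot> ((?B d a \<odot> ?i b) \<cdot> (?B a d \<odot> ?i b)) \<cdot> (?i a \<odot> ?B b d)"
    by (subst braid_tensor_right; simp add: braid_tensor_left)
  also have "(?B d a \<odot> ?i b) \<cdot> (?B a d \<odot> ?i b) = ?i (a \<otimes> d \<otimes> b)"
    by (subst tensor_merge) (auto simp: sym)
  finally show ?thesis by (simp add: sym)
qed

end

context braided_monoidal_category
begin

lemma interchange_simps [simp]:
  assumes "a \<in> Obj C" "b \<in> Obj C" "c \<in> Obj C" "d \<in> Obj C"
  shows "interchange C a b c d \<in> Arr C" "Dom C (interchange C a b c d) = (a \<otimes> b) \<otimes> c \<otimes> d"
    "Cod C (interchange C a b c d) = (a \<otimes> c) \<otimes> b \<otimes> d" "iso C (interchange C a b c d)"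
  using assms by (simp_all add: interchange_def)

text \<open>Proved directly in \<open>C\<close> from the naturality of each factor, since formal
  terms contain only structure arrows and cannot express arbitrary ones.\<close>

lemma interchange_natural:
  assumes [simp]: "f \<in> Arr C" "g \<in> Arr C" "h \<in> Arr C" "k \<in> Arr C"
    "Dom C f = a" "Dom C g = b" "Dom C h = c" "Dom C k = d"
    "Cod C f = a'" "Cod C g = b'" "Cod C h = c'" "Cod C k = d'"
  shows "interchange C a' b' c' d' \<cdot> ((f \<odot> g) \<odot> h \<odot> k) = ((f \<odot> h) \<odot> g \<odot> k) \<cdot> interchange C a b c d"
proof -
  have [simp]: "a \<in> Obj C" "b \<in> Obj C" "c \<in> Obj C" "d \<in> Obj C" "a' \<in> Obj C" "b' \<in> Obj C" "c' \<in> Obj C" "d' \<in> Obj C"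
    using dom_obj[OF assms(1)] dom_obj[OF assms(2)] dom_obj[OF assms(3)] dom_obj[OF assms(4)]
      cod_obj[OF assms(1)] cod_obj[OF assms(2)] cod_obj[OF assms(3)] cod_obj[OF assms(4)] by simp_all
  have "interchange C a' b' c' d' \<cdot> ((f \<odot> g) \<odot> h \<odot> k)
      = inv_arr C (Assoc C a' c' (b' \<otimes> d')) \<cdot> (f \<odot>
        (Assoc C c' b' d' \<cdot> (Braid C b' c' \<odot> Ide C d') \<cdot> inv_arr C (Assoc C b' c' d') \<cdot> (g \<odot> h \<odot> k))) \<cdot> Assoc C a b (c \<otimes> d)"
    by (simp add: interchange_def assoc_nat)
  also have "Assoc C c' b' d' \<cdot> (Braid C b' c' \<odot> Ide C d') \<cdot> inv_arr C (Assoc C b' c' d') \<cdot> (g \<odot> h \<odot> k)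
      = Assoc C c' b' d' \<cdot> ((Braid C b' c' \<cdot> (g \<odot> h)) \<odot> k) \<cdot> inv_arr C (Assoc C b c d)"
    by (simp add: assoc_inv_nat[symmetric])
  also have "\<dots> = (Assoc C c' b' d' \<cdot> ((h \<odot> g) \<odot> k)) \<cdot> (Braid C b c \<odot> Ide C d) \<cdot> inv_arr C (Assoc C b c d)"
    by (simp add: braid_nat)
  also have "\<dots> = (h \<odot> g \<odot> k) \<cdot> Assoc C c b d \<cdot> (Braid C b c \<odot> Ide C d) \<cdot> inv_arr C (Assoc C b c d)"
    by (subst assoc_nat) auto
  also have "inv_arr C (Assoc C a' c' (b' \<otimes> d')) \<cdot> (f \<odot> ((h \<odot> g \<odot> k) \<cdot> Assoc C c b d \<cdot> (Braid C b c \<odot> Ide C d) \<cdot> inv_arr C (Assoc C b c d))) \<cdot> Assoc C a b (c \<otimes> d)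
     = (inv_arr C (Assoc C a' c' (b' \<otimes> d')) \<cdot> (f \<odot> (h \<odot> g \<odot> k))) \<cdot> (Ide C a \<odot> (Assoc C c b d \<cdot> (Braid C b c \<odot> Ide C d) \<cdot> inv_arr C (Assoc C b c d))) \<cdot> Assoc C a b (c \<otimes> d)"
    by simp
  also have "\<dots> = ((f \<odot> h) \<odot> g \<odot> k) \<cdot> interchange C a b c d"
    by (subst assoc_inv_nat[symmetric]) (auto simp: interchange_def)
  finally show ?thesis .
qed

end

section \<open>Interchange identities lifted from the strictification\<close>

context braided_monoidal_category
begin

context
begin

interpretation S: strict_braided_monoidal_category "strict C"
proof -
  interpret S: braided_monoidal_category "strict C" by (rule braided_strict)
  show "strict_braided_monoidal_category (strict C)" by unfold_locales (simp_all add: strict_simps)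
qed

lemma single_obj: "a \<in> Obj C \<Longrightarrow> [a] \<in> Obj (strict C)"
  by (simp add: strict_simps)

text \<open>Reads \<open>coherence_iff\<close> from left to right, so that a symmetry hypothesis of
  \<open>C\<close> becomes available for one-letter words.\<close>

lemma symmetric_strict:
  assumes "a \<in> Obj C" "d \<in> Obj C" "Braid C d a \<cdot> Braid C a d = Ide C (a \<otimes> d)"
  shows "Braid (strict C) [d] [a] \<cdot>\<^bsub>strict C\<^esub> Braid (strict C) [a] [d] = Ide (strict C) ([a] \<otimes>\<^bsub>strict C\<^esub> [d])"
  using coherence_iff[of "Cmp (Brd (Var d) (Var a)) (Brd (Var a) (Var d))" "Id (Ten (Var a) (Var d))"] assms
  by simp

text \<open>The associativity law for the tensor product as a monoidal functor, and later for the
  action of the center. At one-letter words the associators vanish and the strict identity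
  remains.\<close>

lemma interchange_assoc:
  assumes "a \<in> Obj C" "b \<in> Obj C" "c \<in> Obj C" "a' \<in> Obj C" "b' \<in> Obj C" "c' \<in> Obj C"
  shows "(Assoc C a b c \<odot> Assoc C a' b' c') \<cdot> interchange C (a \<otimes> b) (a' \<otimes> b') c c' \<cdot>
      (interchange C a a' b b' \<odot> Ide C (c \<otimes> c')) =
    interchange C a a' (b \<otimes> c) (b' \<otimes> c') \<cdot> (Ide C (a \<otimes> a') \<odot> interchange C b b' c c') \<cdot>
      Assoc C (a \<otimes> a') (b \<otimes> b') (c \<otimes> c')"
  using coherence[of "Cmp (Tns (Asc (Var a) (Var b) (Var c)) (Asc (Var a') (Var b') (Var c')))
      (Cmp (itc (Ten (Var a) (Var b)) (Ten (Var a') (Var b')) (Var c) (Var c'))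
        (Tns (itc (Var a) (Var a') (Var b) (Var b')) (Id (Ten (Var c) (Var c')))))"
    "Cmp (itc (Var a) (Var a') (Ten (Var b) (Var c)) (Ten (Var b') (Var c')))
      (Cmp (Tns (Id (Ten (Var a) (Var a'))) (itc (Var b) (Var b') (Var c) (Var c')))
        (Asc (Ten (Var a) (Var a')) (Ten (Var b) (Var b')) (Ten (Var c) (Var c'))))"]
    S.interchange_assoc_strict[of "[a]" "[b]" "[c]" "[a']" "[b']" "[c']"] assms
  by (simp add: single_obj)

text \<open>This will say that the inverse associator, as multiplicator of the center's action, is a
  monoidal transformation.\<close>

lemma interchange_mult:
  assumes "a \<in> Obj C" "b \<in> Obj C" "c \<in> Obj C" "a' \<in> Obj C" "b' \<in> Obj C" "c' \<in> Obj C"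
  shows "inv_arr C (Assoc C (a \<otimes> a') (b \<otimes> b') (c \<otimes> c')) \<cdot>
      (Ide C (a \<otimes> a') \<odot> interchange C b c b' c') \<cdot> interchange C a (b \<otimes> c) a' (b' \<otimes> c') =
    (interchange C a b a' b' \<odot> Ide C (c \<otimes> c')) \<cdot> interchange C (a \<otimes> b) c (a' \<otimes> b') c' \<cdot>
      (inv_arr C (Assoc C a b c) \<odot> inv_arr C (Assoc C a' b' c'))"
  using coherence[of "Cmp (AscI (Ten (Var a) (Var a')) (Ten (Var b) (Var b')) (Ten (Var c) (Var c')))
      (Cmp (Tns (Id (Ten (Var a) (Var a'))) (itc (Var b) (Var c) (Var b') (Var c')))
        (itc (Var a) (Ten (Var b) (Var c)) (Var a') (Ten (Var b') (Var c'))))"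
    "Cmp (Tns (itc (Var a) (Var b) (Var a') (Var b')) (Id (Ten (Var c) (Var c'))))
      (Cmp (itc (Ten (Var a) (Var b)) (Var c) (Ten (Var a') (Var b')) (Var c'))
        (Tns (AscI (Var a) (Var b) (Var c)) (AscI (Var a') (Var b') (Var c'))))"]
    S.interchange_mult_strict[of "[a]" "[b]" "[c]" "[a']" "[b']" "[c']"] assms
  by (simp add: single_obj)

lemma interchange_lun:
  assumes "a \<in> Obj C" "b \<in> Obj C"
  shows "(Lun C a \<odot> Lun C b) \<cdot> interchange C (Unit C) (Unit C) a b \<cdot>
      (inv_arr C (Lun C (Unit C)) \<odot> Ide C (a \<otimes> b)) = Lun C (a \<otimes> b)"
  using coherence[of "Cmp (Tns (Lu (Var a)) (Lu (Var b)))
      (Cmp (itc One One (Var a) (Var b)) (Tns (LuI One) (Id (Ten (Var a) (Var b)))))" "Lu (Ten (Var a) (Var b))"]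
    assms
  by (simp add: single_obj S.interchange_strict)

lemma interchange_run:
  assumes "a \<in> Obj C" "b \<in> Obj C"
  shows "(Run C a \<odot> Run C b) \<cdot> interchange C a b (Unit C) (Unit C) \<cdot>
      (Ide C (a \<otimes> b) \<odot> inv_arr C (Lun C (Unit C))) = Run C (a \<otimes> b)"
  using coherence[of "Cmp (Tns (Ru (Var a)) (Ru (Var b)))
      (Cmp (itc (Var a) (Var b) One One) (Tns (Id (Ten (Var a) (Var b))) (LuI One)))" "Ru (Ten (Var a) (Var b))"]
    assms
  by (simp add: single_obj S.interchange_strict)

text \<open>The interchange crosses only a unit with a unit, which is an identity in the
  strictification.\<close>

lemma interchange_unit:
  assumes "a \<in> Obj C" "b \<in> Obj C"
  shows "(Run C a \<odot> Lun C b) \<cdot> interchange C a (Unit C) (Unit C) b \<cdot> (inv_arr C (Run C a) \<odot> inv_arr C (Lun C b)) =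
    Ide C (a \<otimes> b)"
  using coherence[of "Cmp (Tns (Ru (Var a)) (Lu (Var b)))
      (Cmp (itc (Var a) One One (Var b)) (Tns (RuI (Var a)) (LuI (Var b))))" "Id (Ten (Var a) (Var b))"]
    assms
  by (simp add: single_obj S.interchange_strict)

lemma interchange_eta:
  assumes "a \<in> Obj C" "b \<in> Obj C"
  shows "(Lun C (Unit C) \<odot> Ide C (a \<otimes> b)) \<cdot> interchange C (Unit C) a (Unit C) b \<cdot>
      (inv_arr C (Lun C a) \<odot> inv_arr C (Lun C b)) = inv_arr C (Lun C (a \<otimes> b))"
  using coherence[of "Cmp (Tns (Lu One) (Id (Ten (Var a) (Var b))))
      (Cmp (itc One (Var a) One (Var b)) (Tns (LuI (Var a)) (LuI (Var b))))" "LuI (Ten (Var a) (Var b))"]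
    assms
  by (simp add: single_obj S.interchange_strict)

lemma interchange_inverse:
  assumes "a \<in> Obj C" "b \<in> Obj C" "c \<in> Obj C" "d \<in> Obj C" "Braid C c b \<cdot> Braid C b c = Ide C (b \<otimes> c)"
  shows "interchange C a c b d \<cdot> interchange C a b c d = Ide C ((a \<otimes> b) \<otimes> c \<otimes> d)"
  using coherence[of "Cmp (itc (Var a) (Var c) (Var b) (Var d)) (itc (Var a) (Var b) (Var c) (Var d))"
      "Id (Ten (Ten (Var a) (Var b)) (Ten (Var c) (Var d)))"] assms symmetric_strict[of b c]
  by (simp add: single_obj S.interchange_strict)

lemma interchange_braid:
  assumes "a \<in> Obj C" "b \<in> Obj C" "c \<in> Obj C" "d \<in> Obj C" "Braid C d a \<cdot> Braid C a d = Ide C (a \<otimes> d)"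
  shows "(Braid C a c \<odot> Braid C b d) \<cdot> interchange C a b c d = interchange C c d a b \<cdot> Braid C (a \<otimes> b) (c \<otimes> d)"
  using coherence[of "Cmp (Tns (Brd (Var a) (Var c)) (Brd (Var b) (Var d))) (itc (Var a) (Var b) (Var c) (Var d))"
      "Cmp (itc (Var c) (Var d) (Var a) (Var b)) (Brd (Ten (Var a) (Var b)) (Ten (Var c) (Var d)))"] assms
      symmetric_strict[of a d] S.interchange_braid_strict[of "[a]" "[b]" "[c]" "[d]"]
  by (simp add: single_obj)

lemma braid_tensor_symmetric:
  assumes "a \<in> Obj C" "b \<in> Obj C" "d \<in> Obj C"
    "Braid C d a \<cdot> Braid C a d = Ide C (a \<otimes> d)" "Braid C d b \<cdot> Braid C b d = Ide C (b \<otimes> d)"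
  shows "Braid C d (a \<otimes> b) \<cdot> Braid C (a \<otimes> b) d = Ide C ((a \<otimes> b) \<otimes> d)"
  using coherence[of "Cmp (Brd (Var d) (Ten (Var a) (Var b))) (Brd (Ten (Var a) (Var b)) (Var d))"
      "Id (Ten (Ten (Var a) (Var b)) (Var d))"] assms
      symmetric_strict[of a d] symmetric_strict[of b d] S.braid_tensor_symmetric_strict[of "[a]" "[b]" "[d]"]
  by (simp add: single_obj)

end

lemma braid_unit_symmetric:
  assumes [simp]: "a \<in> Obj C"
  shows "Braid C a (Unit C) \<cdot> Braid C (Unit C) a = Ide C (Unit C \<otimes> a)"
    "Braid C (Unit C) a \<cdot> Braid C a (Unit C) = Ide C (a \<otimes> Unit C)"
proof -
  have "Lun C a \<cdot> Braid C a (Unit C) \<cdot> Braid C (Unit C) a = Lun C a \<cdot> Ide C (Unit C \<otimes> a)"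
    by (simp add: comp_chain[OF lun_braid] run_braid)
  then show "Braid C a (Unit C) \<cdot> Braid C (Unit C) a = Ide C (Unit C \<otimes> a)"
    by (rule iso_cancel_left[rotated]) auto
  have "Run C a \<cdot> Braid C (Unit C) a \<cdot> Braid C a (Unit C) = Run C a \<cdot> Ide C (a \<otimes> Unit C)"
    by (simp add: comp_chain[OF run_braid] lun_braid)
  then show "Braid C (Unit C) a \<cdot> Braid C a (Unit C) = Ide C (a \<otimes> Unit C)"
    by (rule iso_cancel_left[rotated]) auto
qed

end

section \<open>Monoidal functors\<close>

context cat_functor
begin

lemmas fobj [simp] = fobj

lemma farr_simps [simp]:
  assumes "f \<in> Arr C"
  shows "FArr F f \<in> Arr D" "Dom D (FArr F f) = FObj F (Dom C f)" "Cod D (FArr F f) = FObj F (Cod C f)"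
  using farr[OF homI[OF assms refl refl]] by (auto simp: hom_def)

lemmas fide [simp] = fide

lemma fcomp_simp [simp]:
  "f \<in> Arr C \<Longrightarrow> g \<in> Arr C \<Longrightarrow> Dom C g = Cod C f \<Longrightarrow> FArr F (g \<cdot>\<^bsub>C\<^esub> f) = FArr F g \<cdot>\<^bsub>D\<^esub> FArr F f"
  using fcomp[OF homI homI] by blast

lemma farr_inverse:
  assumes "iso C f"
  shows "inverse_arrows D (FArr F f) (FArr F (inv_arr C f))"
  using assms C.iso_arr[OF assms] by (intro D.inverse_arrowsI) (simp_all flip: fcomp_simp)

lemma farr_iso [simp]: "iso C f \<Longrightarrow> iso D (FArr F f)"
  using farr_inverse by (rule D.inverse_arrows_iso)

lemma farr_inv: "iso C f \<Longrightarrow> FArr F (inv_arr C f) = inv_arr D (FArr F f)"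
  using farr_inverse by (rule D.inverse_arrows_iso(2)[symmetric])

end

lemma cat_functorI:
  assumes "category C" "category D"
    and "\<And>x. x \<in> Obj C \<Longrightarrow> FObj F x \<in> Obj D"
    and "\<And>f. f \<in> Arr C \<Longrightarrow> FArr F f \<in> Arr D \<and>
      Dom D (FArr F f) = FObj F (Dom C f) \<and> Cod D (FArr F f) = FObj F (Cod C f)"
    and "\<And>x. x \<in> Obj C \<Longrightarrow> FArr F (Ide C x) = Ide D (FObj F x)"
    and "\<And>f g. f \<in> Arr C \<Longrightarrow> g \<in> Arr C \<Longrightarrow> Dom C g = Cod C f \<Longrightarrow>
      FArr F (g \<cdot>\<^bsub>C\<^esub> f) = FArr F g \<cdot>\<^bsub>D\<^esub> FArr F f"
  shows "cat_functor C D F"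
  unfolding cat_functor_def cat_functor_axioms_def using assms by (auto simp: hom_def)

context strong_monoidal_functor
begin

lemma funit_simps [simp]:
  "FUnit F \<in> Arr D" "Dom D (FUnit F) = Unit D" "Cod D (FUnit F) = FObj F (Unit C)"
  using funit_hom by (auto simp: hom_def)

lemmas funit_iso [simp] = funit_iso and ften_iso [simp] = ften_iso

lemma ften_simps [simp]:
  assumes "x \<in> Obj C" "y \<in> Obj C"
  shows "FTen F x y \<in> Arr D" "Dom D (FTen F x y) = FObj F x \<otimes>\<^bsub>D\<^esub> FObj F y"
    "Cod D (FTen F x y) = FObj F (x \<otimes>\<^bsub>C\<^esub> y)"
  using ften_hom[OF assms] by (auto simp: hom_def)

lemma ften_nat:
  "f \<in> Arr C \<Longrightarrow> g \<in> Arr C \<Longrightarrow> Dom C f = x \<Longrightarrow> Dom C g = y \<Longrightarrow> Cod C f = x' \<Longrightarrow> Cod C g = y' \<Longrightarrow>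
    FTen F x' y' \<cdot>\<^bsub>D\<^esub> (FArr F f \<odot>\<^bsub>D\<^esub> FArr F g) = FArr F (f \<odot>\<^bsub>C\<^esub> g) \<cdot>\<^bsub>D\<^esub> FTen F x y"
  by (rule ften_natural[symmetric, OF homI homI])

end

text \<open>The typing conditions are phrased with \<open>Dom\<close> and \<open>Cod\<close> in
  place of \<open>hom\<close>, the form in which the simplification rules solve them.\<close>

lemma strong_monoidal_functorI:
  assumes "monoidal_category C" "monoidal_category D"
    and "\<And>x. x \<in> Obj C \<Longrightarrow> FObj F x \<in> Obj D"
    and "\<And>f. f \<in> Arr C \<Longrightarrow> FArr F f \<in> Arr D \<and>
      Dom D (FArr F f) = FObj F (Dom C f) \<and> Cod D (FArr F f) = FObj F (Cod C f)"
    and "\<And>x. x \<in> Obj C \<Longrightarrow> FArr F (Ide C x) = Ide D (FObj F x)"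
    and "\<And>f g. f \<in> Arr C \<Longrightarrow> g \<in> Arr C \<Longrightarrow> Dom C g = Cod C f \<Longrightarrow>
      FArr F (g \<cdot>\<^bsub>C\<^esub> f) = FArr F g \<cdot>\<^bsub>D\<^esub> FArr F f"
    and "iso D (FUnit F) \<and> Dom D (FUnit F) = Unit D \<and> Cod D (FUnit F) = FObj F (Unit C)"
    and "\<And>x y. x \<in> Obj C \<Longrightarrow> y \<in> Obj C \<Longrightarrow> iso D (FTen F x y) \<and>
      Dom D (FTen F x y) = FObj F x \<otimes>\<^bsub>D\<^esub> FObj F y \<and> Cod D (FTen F x y) = FObj F (x \<otimes>\<^bsub>C\<^esub> y)"
    and "\<And>f g. f \<in> Arr C \<Longrightarrow> g \<in> Arr C \<Longrightarrow>
      FArr F (f \<odot>\<^bsub>C\<^esub> g) \<cdot>\<^bsub>D\<^esub> FTen F (Dom C f) (Dom C g) =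
      FTen F (Cod C f) (Cod C g) \<cdot>\<^bsub>D\<^esub> (FArr F f \<odot>\<^bsub>D\<^esub> FArr F g)"
    and "\<And>x y z. x \<in> Obj C \<Longrightarrow> y \<in> Obj C \<Longrightarrow> z \<in> Obj C \<Longrightarrow>
      FArr F (Assoc C x y z) \<cdot>\<^bsub>D\<^esub> FTen F (x \<otimes>\<^bsub>C\<^esub> y) z \<cdot>\<^bsub>D\<^esub> (FTen F x y \<odot>\<^bsub>D\<^esub> Ide D (FObj F z)) =
      FTen F x (y \<otimes>\<^bsub>C\<^esub> z) \<cdot>\<^bsub>D\<^esub> (Ide D (FObj F x) \<odot>\<^bsub>D\<^esub> FTen F y z) \<cdot>\<^bsub>D\<^esub>
        Assoc D (FObj F x) (FObj F y) (FObj F z)"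
    and "\<And>x. x \<in> Obj C \<Longrightarrow>
      FArr F (Lun C x) \<cdot>\<^bsub>D\<^esub> FTen F (Unit C) x \<cdot>\<^bsub>D\<^esub> (FUnit F \<odot>\<^bsub>D\<^esub> Ide D (FObj F x)) =
      Lun D (FObj F x)"
    and "\<And>x. x \<in> Obj C \<Longrightarrow>
      FArr F (Run C x) \<cdot>\<^bsub>D\<^esub> FTen F x (Unit C) \<cdot>\<^bsub>D\<^esub> (Ide D (FObj F x) \<odot>\<^bsub>D\<^esub> FUnit F) =
      Run D (FObj F x)"
  shows "strong_monoidal_functor C D F"
proof -
  interpret C: monoidal_category C by fact
  interpret D: monoidal_category D by fact
  interpret cat_functor C D F
    by (rule cat_functorI[OF C.category_axioms D.category_axioms assms(3-6)])
  show ?thesis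
  proof
    fix f g x x' y y' assume "f \<in> hom C x x'" "g \<in> hom C y y'"
    then show "FArr F (f \<odot>\<^bsub>C\<^esub> g) \<cdot>\<^bsub>D\<^esub> FTen F x y = FTen F x' y' \<cdot>\<^bsub>D\<^esub> (FArr F f \<odot>\<^bsub>D\<^esub> FArr F g)"
      using assms(9)[of f g] by (auto simp: hom_def)
  qed (use assms(7,8,10-12) D.iso_arr in \<open>auto simp: hom_def\<close>)
qed

lemma natural_transformationI:
  assumes "cat_functor C D F" "cat_functor C D G"
    and "\<And>x. x \<in> Obj C \<Longrightarrow> \<tau> x \<in> Arr D \<and> Dom D (\<tau> x) = FObj F x \<and> Cod D (\<tau> x) = FObj G x"
    and "\<And>f. f \<in> Arr C \<Longrightarrow> FArr G f \<cdot>\<^bsub>D\<^esub> \<tau> (Dom C f) = \<tau> (Cod C f) \<cdot>\<^bsub>D\<^esub> FArr F f"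
  shows "natural_transformation C D F G \<tau>"
  unfolding natural_transformation_def natural_transformation_axioms_def
  using assms by (auto simp: hom_def)

lemma (in natural_transformation) component_simps [simp]:
  assumes "x \<in> Obj C"
  shows "\<tau> x \<in> Arr D" "Dom D (\<tau> x) = FObj F x" "Cod D (\<tau> x) = FObj G x"
  using component[OF assms] by (auto simp: hom_def)

lemma (in natural_transformation) nat:
  "f \<in> Arr C \<Longrightarrow> Dom C f = x \<Longrightarrow> Cod C f = y \<Longrightarrow> \<tau> y \<cdot>\<^bsub>D\<^esub> FArr F f = FArr G f \<cdot>\<^bsub>D\<^esub> \<tau> x"
  by (rule natural[symmetric, OF homI])

lemma comp_mfunc_simps [simp]:
  "FObj (comp_mfunc E G F) x = FObj G (FObj F x)"
  "FArr (comp_mfunc E G F) f = FArr G (FArr F f)"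
  "FUnit (comp_mfunc E G F) = FArr G (FUnit F) \<cdot>\<^bsub>E\<^esub> FUnit G"
  "FTen (comp_mfunc E G F) x y = FArr G (FTen F x y) \<cdot>\<^bsub>E\<^esub> FTen G (FObj F x) (FObj F y)"
  by (simp_all add: comp_mfunc_def)

text \<open>The transformations required by \<open>braided_action\<close> run between composites and
  products of functors, so these must be strong monoidal before anything can be shown to be a
  braided action.\<close>

lemma comp_strong_monoidal:
  assumes "strong_monoidal_functor C D F" "strong_monoidal_functor D E G"
  shows "strong_monoidal_functor C E (comp_mfunc E G F)"
proof -
  interpret F: strong_monoidal_functor C D F by fact
  interpret G: strong_monoidal_functor D E G by fact
  let ?K = "comp_mfunc E G F"
  show ?thesis
  proof (rule strong_monoidal_functorI)
    fix f g assume [simp]: "f \<in> Arr C" "g \<in> Arr C"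
    have *: "FArr G (FArr F (f \<odot>\<^bsub>C\<^esub> g)) \<cdot>\<^bsub>E\<^esub> FArr G (FTen F (Dom C f) (Dom C g)) =
      FArr G (FTen F (Cod C f) (Cod C g)) \<cdot>\<^bsub>E\<^esub> FArr G (FArr F f \<odot>\<^bsub>D\<^esub> FArr F g)"
      by (simp flip: G.fcomp_simp add: F.ften_nat)
    show "FArr ?K (f \<odot>\<^bsub>C\<^esub> g) \<cdot>\<^bsub>E\<^esub> FTen ?K (Dom C f) (Dom C g) =
      FTen ?K (Cod C f) (Cod C g) \<cdot>\<^bsub>E\<^esub> (FArr ?K f \<odot>\<^bsub>E\<^esub> FArr ?K g)"
      by (simp add: G.ften_nat G.D.comp_chain2[OF *])
  next
    fix x y z assume [simp]: "x \<in> Obj C" "y \<in> Obj C" "z \<in> Obj C"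
    let ?x = "FObj F x" and ?y = "FObj F y" and ?z = "FObj F z"
    have "FArr G (FArr F (Assoc C x y z)) \<cdot>\<^bsub>E\<^esub> (FArr G (FTen F (x \<otimes>\<^bsub>C\<^esub> y) z) \<cdot>\<^bsub>E\<^esub> FTen G (FObj F (x \<otimes>\<^bsub>C\<^esub> y)) ?z) \<cdot>\<^bsub>E\<^esub>
          ((FArr G (FTen F x y) \<cdot>\<^bsub>E\<^esub> FTen G ?x ?y) \<odot>\<^bsub>E\<^esub> Ide E (FObj G ?z))
       = FArr G (FArr F (Assoc C x y z) \<cdot>\<^bsub>D\<^esub> FTen F (x \<otimes>\<^bsub>C\<^esub> y) z) \<cdot>\<^bsub>E\<^esub> (FTen G (FObj F (x \<otimes>\<^bsub>C\<^esub> y)) ?z \<cdot>\<^bsub>E\<^esub>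
          (FArr G (FTen F x y) \<odot>\<^bsub>E\<^esub> FArr G (Ide D ?z))) \<cdot>\<^bsub>E\<^esub> (FTen G ?x ?y \<odot>\<^bsub>E\<^esub> Ide E (FObj G ?z))"
      by simp
    also have "\<dots> = FArr G (FArr F (Assoc C x y z) \<cdot>\<^bsub>D\<^esub> FTen F (x \<otimes>\<^bsub>C\<^esub> y) z \<cdot>\<^bsub>D\<^esub> (FTen F x y \<odot>\<^bsub>D\<^esub> Ide D ?z)) \<cdot>\<^bsub>E\<^esub>
          FTen G (?x \<otimes>\<^bsub>D\<^esub> ?y) ?z \<cdot>\<^bsub>E\<^esub> (FTen G ?x ?y \<odot>\<^bsub>E\<^esub> Ide E (FObj G ?z))"
      by (subst G.ften_nat) auto
    also have "\<dots> = FArr G (FTen F x (y \<otimes>\<^bsub>C\<^esub> z)) \<cdot>\<^bsub>E\<^esub> FArr G (Ide D ?x \<odot>\<^bsub>D\<^esub> FTen F y z) \<cdot>\<^bsub>E\<^esub> FArr G (Assoc D ?x ?y ?z) \<cdot>\<^bsub>E\<^esub>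
          FTen G (?x \<otimes>\<^bsub>D\<^esub> ?y) ?z \<cdot>\<^bsub>E\<^esub> (FTen G ?x ?y \<odot>\<^bsub>E\<^esub> Ide E (FObj G ?z))"
      by (subst F.ften_assoc) auto
    also have "\<dots> = FArr G (FTen F x (y \<otimes>\<^bsub>C\<^esub> z)) \<cdot>\<^bsub>E\<^esub> (FArr G (Ide D ?x \<odot>\<^bsub>D\<^esub> FTen F y z) \<cdot>\<^bsub>E\<^esub> FTen G ?x (?y \<otimes>\<^bsub>D\<^esub> ?z)) \<cdot>\<^bsub>E\<^esub>
          (Ide E (FObj G ?x) \<odot>\<^bsub>E\<^esub> FTen G ?y ?z) \<cdot>\<^bsub>E\<^esub> Assoc E (FObj G ?x) (FObj G ?y) (FObj G ?z)"
      by (subst G.ften_assoc) auto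
    also have "FArr G (Ide D ?x \<odot>\<^bsub>D\<^esub> FTen F y z) \<cdot>\<^bsub>E\<^esub> FTen G ?x (?y \<otimes>\<^bsub>D\<^esub> ?z) =
        FTen G ?x (FObj F (y \<otimes>\<^bsub>C\<^esub> z)) \<cdot>\<^bsub>E\<^esub> (Ide E (FObj G ?x) \<odot>\<^bsub>E\<^esub> FArr G (FTen F y z))"
      by (subst G.ften_nat[symmetric]) auto
    finally show "FArr ?K (Assoc C x y z) \<cdot>\<^bsub>E\<^esub> FTen ?K (x \<otimes>\<^bsub>C\<^esub> y) z \<cdot>\<^bsub>E\<^esub>
        (FTen ?K x y \<odot>\<^bsub>E\<^esub> Ide E (FObj ?K z)) =
      FTen ?K x (y \<otimes>\<^bsub>C\<^esub> z) \<cdot>\<^bsub>E\<^esub> (Ide E (FObj ?K x) \<odot>\<^bsub>E\<^esub> FTen ?K y z) \<cdot>\<^bsub>E\<^esub>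
        Assoc E (FObj ?K x) (FObj ?K y) (FObj ?K z)"
      by simp
  next
    fix x assume [simp]: "x \<in> Obj C"
    let ?x = "FObj F x"
    have "FArr G (FArr F (Lun C x)) \<cdot>\<^bsub>E\<^esub> (FArr G (FTen F (Unit C) x) \<cdot>\<^bsub>E\<^esub> FTen G (FObj F (Unit C)) ?x) \<cdot>\<^bsub>E\<^esub>
        ((FArr G (FUnit F) \<cdot>\<^bsub>E\<^esub> FUnit G) \<odot>\<^bsub>E\<^esub> Ide E (FObj G ?x))
      = FArr G (FArr F (Lun C x) \<cdot>\<^bsub>D\<^esub> FTen F (Unit C) x) \<cdot>\<^bsub>E\<^esub> (FTen G (FObj F (Unit C)) ?x \<cdot>\<^bsub>E\<^esub>
        (FArr G (FUnit F) \<odot>\<^bsub>E\<^esub> FArr G (Ide D ?x))) \<cdot>\<^bsub>E\<^esub> (FUnit G \<odot>\<^bsub>E\<^esub> Ide E (FObj G ?x))"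
      by simp
    also have "\<dots> = FArr G (FArr F (Lun C x) \<cdot>\<^bsub>D\<^esub> FTen F (Unit C) x \<cdot>\<^bsub>D\<^esub> (FUnit F \<odot>\<^bsub>D\<^esub> Ide D ?x)) \<cdot>\<^bsub>E\<^esub> FTen G (Unit D) ?x \<cdot>\<^bsub>E\<^esub>
         (FUnit G \<odot>\<^bsub>E\<^esub> Ide E (FObj G ?x))"
      by (subst G.ften_nat) auto
    also have "\<dots> = Lun E (FObj G ?x)"
      by (simp only: F.ften_lun G.ften_lun F.fobj \<open>x \<in> Obj C\<close>)
    finally show "FArr ?K (Lun C x) \<cdot>\<^bsub>E\<^esub> FTen ?K (Unit C) x \<cdot>\<^bsub>E\<^esub>
        (FUnit ?K \<odot>\<^bsub>E\<^esub> Ide E (FObj ?K x)) = Lun E (FObj ?K x)"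
      by simp
    have "FArr G (FArr F (Run C x)) \<cdot>\<^bsub>E\<^esub> (FArr G (FTen F x (Unit C)) \<cdot>\<^bsub>E\<^esub> FTen G ?x (FObj F (Unit C))) \<cdot>\<^bsub>E\<^esub>
        (Ide E (FObj G ?x) \<odot>\<^bsub>E\<^esub> (FArr G (FUnit F) \<cdot>\<^bsub>E\<^esub> FUnit G))
      = FArr G (FArr F (Run C x) \<cdot>\<^bsub>D\<^esub> FTen F x (Unit C)) \<cdot>\<^bsub>E\<^esub> (FTen G ?x (FObj F (Unit C)) \<cdot>\<^bsub>E\<^esub>
        (FArr G (Ide D ?x) \<odot>\<^bsub>E\<^esub> FArr G (FUnit F))) \<cdot>\<^bsub>E\<^esub> (Ide E (FObj G ?x) \<odot>\<^bsub>E\<^esub> FUnit G)"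
      by simp
    also have "\<dots> = FArr G (FArr F (Run C x) \<cdot>\<^bsub>D\<^esub> FTen F x (Unit C) \<cdot>\<^bsub>D\<^esub> (Ide D ?x \<odot>\<^bsub>D\<^esub> FUnit F)) \<cdot>\<^bsub>E\<^esub> FTen G ?x (Unit D) \<cdot>\<^bsub>E\<^esub>
         (Ide E (FObj G ?x) \<odot>\<^bsub>E\<^esub> FUnit G)"
      by (subst G.ften_nat) auto
    also have "\<dots> = Run E (FObj G ?x)"
      by (simp only: F.ften_run G.ften_run F.fobj \<open>x \<in> Obj C\<close>)
    finally show "FArr ?K (Run C x) \<cdot>\<^bsub>E\<^esub> FTen ?K x (Unit C) \<cdot>\<^bsub>E\<^esub>
        (Ide E (FObj ?K x) \<odot>\<^bsub>E\<^esub> FUnit ?K) = Run E (FObj ?K x)"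
      by simp
  qed (simp_all add: F.C.monoidal_category_axioms G.D.monoidal_category_axioms)
qed

lemma id_mfunc_simps [simp]:
  "FObj (id_mfunc C) x = x" "FArr (id_mfunc C) f = f" "FUnit (id_mfunc C) = Ide C (Unit C)"
  "FTen (id_mfunc C) x y = Ide C (x \<otimes>\<^bsub>C\<^esub> y)"
  by (simp_all add: id_mfunc_def)

lemma id_strong_monoidal:
  assumes "monoidal_category C"
  shows "strong_monoidal_functor C C (id_mfunc C)"
proof -
  interpret monoidal_category C by fact
  show ?thesis by (rule strong_monoidal_functorI) (simp_all add: assms)
qed

section \<open>Products\<close>

lemma prod_cat_simps [simp]:
  "Obj (prod_cat C D) = Obj C \<times> Obj D" "Arr (prod_cat C D) = Arr C \<times> Arr D"
  "Dom (prod_cat C D) (f, f') = (Dom C f, Dom D f')" "Cod (prod_cat C D) (f, f') = (Cod C f, Cod D f')"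
  "Ide (prod_cat C D) (a, a') = (Ide C a, Ide D a')"
  "(g, g') \<cdot>\<^bsub>prod_cat C D\<^esub> (f, f') = (g \<cdot>\<^bsub>C\<^esub> f, g' \<cdot>\<^bsub>D\<^esub> f')"
  by (simp_all add: prod_cat_def)

lemma category_prod_cat:
  assumes "category C" "category D"
  shows "category (prod_cat C D)"
proof -
  interpret C: category C by fact
  interpret D: category D by fact
  show ?thesis by unfold_locales (auto simp: hom_def)
qed

lemma prod_simps [simp]:
  "Obj (prod_brmoncat C D) = Obj C \<times> Obj D" "Arr (prod_brmoncat C D) = Arr C \<times> Arr D"
  "Dom (prod_brmoncat C D) (f, f') = (Dom C f, Dom D f')" "Cod (prod_brmoncat C D) (f, f') = (Cod C f, Cod D f')"
  "Ide (prod_brmoncat C D) (a, a') = (Ide C a, Ide D a')"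
  "(g, g') \<cdot>\<^bsub>prod_brmoncat C D\<^esub> (f, f') = (g \<cdot>\<^bsub>C\<^esub> f, g' \<cdot>\<^bsub>D\<^esub> f')"
  "Unit (prod_brmoncat C D) = (Unit C, Unit D)"
  "(a, a') \<otimes>\<^bsub>prod_brmoncat C D\<^esub> (b, b') = (a \<otimes>\<^bsub>C\<^esub> b, a' \<otimes>\<^bsub>D\<^esub> b')"
  "(f, f') \<odot>\<^bsub>prod_brmoncat C D\<^esub> (g, g') = (f \<odot>\<^bsub>C\<^esub> g, f' \<odot>\<^bsub>D\<^esub> g')"
  "Lun (prod_brmoncat C D) (a, a') = (Lun C a, Lun D a')"
  "Run (prod_brmoncat C D) (a, a') = (Run C a, Run D a')"
  "Assoc (prod_brmoncat C D) (a, a') (b, b') (c, c') = (Assoc C a b c, Assoc D a' b' c')"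
  "Braid (prod_brmoncat C D) (a, a') (b, b') = (Braid C a b, Braid D a' b')"
  by (simp_all add: prod_brmoncat_def prod_cat_def)

lemma category_prod:
  assumes "category C" "category D"
  shows "category (prod_brmoncat C D)"
proof -
  interpret C: category C by fact
  interpret D: category D by fact
  show ?thesis by unfold_locales (auto simp: hom_def)
qed

lemma
  assumes "category C" "category D" "iso C f" "iso D g"
  shows iso_prod [simp]: "iso (prod_brmoncat C D) (f, g)"
    and inv_prod [simp]: "inv_arr (prod_brmoncat C D) (f, g) = (inv_arr C f, inv_arr D g)"
proof -
  interpret C: category C by fact
  interpret D: category D by fact
  interpret P: category "prod_brmoncat C D" by (rule category_prod) fact+
  have "inverse_arrows (prod_brmoncat C D) (f, g) (inv_arr C f, inv_arr D g)"
    using assms C.iso_arr D.iso_arr by (intro P.inverse_arrowsI) simp_all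
  then show "iso (prod_brmoncat C D) (f, g)" "inv_arr (prod_brmoncat C D) (f, g) = (inv_arr C f, inv_arr D g)"
    by (rule P.inverse_arrows_iso)+
qed

lemma braided_prod:
  assumes "braided_monoidal_category C" "braided_monoidal_category D"
  shows "braided_monoidal_category (prod_brmoncat C D)"
proof -
  interpret C: braided_monoidal_category C by fact
  interpret D: braided_monoidal_category D by fact
  interpret P: category "prod_brmoncat C D"
    by (rule category_prod[OF C.category_axioms D.category_axioms])
  show ?thesis
    by unfold_locales
      (auto simp: hom_def C.category_axioms D.category_axioms C.lun_nat D.lun_nat C.run_nat D.run_nat
        C.assoc_nat D.assoc_nat C.braid_nat D.braid_nat C.triangle D.triangle C.pentagon D.pentagon
        C.hexagon1 D.hexagon1 C.hexagon2 D.hexagon2)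
qed

lemma prod_mfunc_simps [simp]:
  "FObj (prod_mfunc F G) (x, x') = (FObj F x, FObj G x')"
  "FArr (prod_mfunc F G) (f, g) = (FArr F f, FArr G g)"
  "FUnit (prod_mfunc F G) = (FUnit F, FUnit G)"
  "FTen (prod_mfunc F G) (x, x') (y, y') = (FTen F x y, FTen G x' y')"
  by (simp_all add: prod_mfunc_def)

lemma prod_strong_monoidal:
  assumes "braided_monoidal_category A" "braided_monoidal_category A'"
    "braided_monoidal_category B" "braided_monoidal_category B'"
    "strong_monoidal_functor A A' F" "strong_monoidal_functor B B' G"
  shows "strong_monoidal_functor (prod_brmoncat A B) (prod_brmoncat A' B') (prod_mfunc F G)"
proof -
  interpret F: strong_monoidal_functor A A' F by fact
  interpret G: strong_monoidal_functor B B' G by fact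
  interpret P: braided_monoidal_category "prod_brmoncat A B" by (rule braided_prod) fact+
  interpret Q: braided_monoidal_category "prod_brmoncat A' B'" by (rule braided_prod) fact+
  show ?thesis
    by (rule strong_monoidal_functorI[OF P.monoidal_category_axioms Q.monoidal_category_axioms])
      (auto simp: F.D.category_axioms G.D.category_axioms F.ften_nat G.ften_nat F.ften_assoc G.ften_assoc
        F.ften_lun G.ften_lun F.ften_run G.ften_run)
qed

lemma unit_mfunc_simps [simp]:
  "FObj (unit_mfunc M C) c = (Unit M, c)"
  "FArr (unit_mfunc M C) f = (Ide M (Unit M), f)"
  "FUnit (unit_mfunc M C) = (Ide M (Unit M), Ide C (Unit C))"
  "FTen (unit_mfunc M C) c d = (Lun M (Unit M), Ide C (c \<otimes>\<^bsub>C\<^esub> d))"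
  by (simp_all add: unit_mfunc_def)

lemma unit_strong_monoidal:
  assumes "braided_monoidal_category M" "braided_monoidal_category C"
  shows "strong_monoidal_functor C (prod_brmoncat M C) (unit_mfunc M C)"
proof -
  interpret M: braided_monoidal_category M by fact
  interpret C: braided_monoidal_category C by fact
  interpret P: braided_monoidal_category "prod_brmoncat M C" by (rule braided_prod) fact+
  \<comment> \<open>In the first component every object is the unit. Associativity there is the
    triangle once the two unitors of the unit are identified.\<close>
  have 1: "Run M (Unit M) \<cdot>\<^bsub>M\<^esub> (Run M (Unit M) \<odot>\<^bsub>M\<^esub> Ide M (Unit M)) =
    Run M (Unit M) \<cdot>\<^bsub>M\<^esub> (Ide M (Unit M) \<odot>\<^bsub>M\<^esub> Run M (Unit M)) \<cdot>\<^bsub>M\<^esub> Assoc M (Unit M) (Unit M) (Unit M)"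
    using M.triangle[of "Unit M" "Unit M"] by (simp add: M.lun_unit)
  show ?thesis
    by (rule strong_monoidal_functorI[OF C.monoidal_category_axioms P.monoidal_category_axioms])
      (auto simp: M.category_axioms C.category_axioms 1 M.lun_unit)
qed

lemma assoc_mfunc_simps [simp]:
  "FObj (assoc_mfunc M N C) (m, n, c) = ((m, n), c)"
  "FArr (assoc_mfunc M N C) (f, g, h) = ((f, g), h)"
  "FUnit (assoc_mfunc M N C) = ((Ide M (Unit M), Ide N (Unit N)), Ide C (Unit C))"
  "FTen (assoc_mfunc M N C) (m, n, c) (m', n', c') =
    ((Ide M (m \<otimes>\<^bsub>M\<^esub> m'), Ide N (n \<otimes>\<^bsub>N\<^esub> n')), Ide C (c \<otimes>\<^bsub>C\<^esub> c'))"
  by (simp_all add: assoc_mfunc_def Let_def)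

lemma assoc_strong_monoidal:
  assumes "braided_monoidal_category M" "braided_monoidal_category N" "braided_monoidal_category C"
  shows "strong_monoidal_functor (prod_brmoncat M (prod_brmoncat N C)) (prod_brmoncat (prod_brmoncat M N) C)
    (assoc_mfunc M N C)"
proof -
  interpret M: braided_monoidal_category M by fact
  interpret N: braided_monoidal_category N by fact
  interpret C: braided_monoidal_category C by fact
  interpret P: braided_monoidal_category "prod_brmoncat M (prod_brmoncat N C)" by (intro braided_prod) fact+
  interpret Q: braided_monoidal_category "prod_brmoncat (prod_brmoncat M N) C" by (intro braided_prod) fact+
  show ?thesis
    by (rule strong_monoidal_functorI[OF P.monoidal_category_axioms Q.monoidal_category_axioms])
      (auto simp: M.category_axioms N.category_axioms C.category_axioms category_prod)
qed

lemma tensor_mfunc_simps [simp]: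
  "FObj (tensor_mfunc M) (m, n) = m \<otimes>\<^bsub>M\<^esub> n"
  "FArr (tensor_mfunc M) (f, g) = f \<odot>\<^bsub>M\<^esub> g"
  "FUnit (tensor_mfunc M) = inv_arr M (Lun M (Unit M))"
  "FTen (tensor_mfunc M) (m, n) (m', n') = interchange M m n m' n'"
  by (simp_all add: tensor_mfunc_def)

lemma tensor_strong_monoidal:
  assumes "braided_monoidal_category M"
  shows "strong_monoidal_functor (prod_brmoncat M M) M (tensor_mfunc M)"
proof -
  interpret M: braided_monoidal_category M by fact
  interpret P: braided_monoidal_category "prod_brmoncat M M" by (rule braided_prod) fact+
  show ?thesis
    by (rule strong_monoidal_functorI[OF P.monoidal_category_axioms M.monoidal_category_axioms])
      (auto simp: M.interchange_natural M.interchange_assoc M.interchange_lun M.interchange_run)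
qed

lemma (in monoidal_category) triangle_inv:
  assumes [simp]: "m \<in> Obj C" "c \<in> Obj C"
  shows "inv_arr C (Assoc C m (Unit C) c) \<cdot> (Ide C m \<odot> inv_arr C (Lun C c)) = inv_arr C (Run C m) \<odot> Ide C c"
proof -
  have "inv_arr C ((Ide C m \<odot> Lun C c) \<cdot> Assoc C m (Unit C) c) = inv_arr C (Run C m \<odot> Ide C c)"
    by (simp add: triangle)
  then show ?thesis by (simp add: inv_comp inv_tensor)
qed

section \<open>The symmetric center\<close>

lemma sym_center_simps [simp]:
  "Obj (sym_center C) = sym_center_obj C"
  "Arr (sym_center C) = {f \<in> Arr C. Dom C f \<in> sym_center_obj C \<and> Cod C f \<in> sym_center_obj C}"
  "Dom (sym_center C) = Dom C" "Cod (sym_center C) = Cod C" "Ide (sym_center C) = Ide C"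
  "Comp (sym_center C) = Comp C" "Unit (sym_center C) = Unit C" "TObj (sym_center C) = TObj C"
  "TArr (sym_center C) = TArr C" "Lun (sym_center C) = Lun C" "Run (sym_center C) = Run C"
  "Assoc (sym_center C) = Assoc C" "Braid (sym_center C) = Braid C"
  by (simp_all add: sym_center_def)

context
  fixes C :: "('o, 'a) brmoncat" (structure)
  assumes braided: "braided_monoidal_category C"
begin

interpretation braided_monoidal_category C by (rule braided)

lemma sym_center_objI:
  "a \<in> Obj C \<Longrightarrow> (\<And>d. d \<in> Obj C \<Longrightarrow> Braid C d a \<cdot> Braid C a d = Ide C (a \<otimes> d)) \<Longrightarrow> a \<in> sym_center_obj C"
  by (simp add: sym_center_obj_def)

lemma sym_center_obj_obj [simp]: "a \<in> sym_center_obj C \<Longrightarrow> a \<in> Obj C"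
  by (simp add: sym_center_obj_def)

text \<open>The definition of the center trivializes one of the two double braidings; the other
  follows by cancelling the invertible \<open>Braid C a d\<close>.\<close>

lemma sym_center_braid:
  assumes "a \<in> sym_center_obj C" "d \<in> Obj C"
  shows "Braid C d a \<cdot> Braid C a d = Ide C (a \<otimes> d)" "Braid C a d \<cdot> Braid C d a = Ide C (d \<otimes> a)"
proof -
  have [simp]: "a \<in> Obj C" "d \<in> Obj C" using assms by auto
  show *: "Braid C d a \<cdot> Braid C a d = Ide C (a \<otimes> d)"
    using assms unfolding sym_center_obj_def by blast
  have "(Braid C a d \<cdot> Braid C d a) \<cdot> Braid C a d = Ide C (d \<otimes> a) \<cdot> Braid C a d"
    by (simp add: *)
  then show "Braid C a d \<cdot> Braid C d a = Ide C (d \<otimes> a)"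
    by (rule iso_cancel_right[rotated]) simp_all
qed

lemma sym_center_closed [simp]:
  "Unit C \<in> sym_center_obj C"
  "a \<in> sym_center_obj C \<Longrightarrow> b \<in> sym_center_obj C \<Longrightarrow> a \<otimes> b \<in> sym_center_obj C"
  by (rule sym_center_objI; simp add: braid_unit_symmetric braid_tensor_symmetric sym_center_braid)+

text \<open>By fullness, the inverse in \<open>C\<close> of an arrow between central objects is
  again an arrow of the center.\<close>

lemma
  assumes "iso C f" "Dom C f \<in> sym_center_obj C" "Cod C f \<in> sym_center_obj C"
  shows sym_center_iso [simp]: "iso (sym_center C) f"
    and sym_center_inv [simp]: "inv_arr (sym_center C) f = inv_arr C f"
proof -
  have inv: "inverse_arrows (sym_center C) f g \<longleftrightarrow> inverse_arrows C f g" for g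
    using assms iso_arr[OF assms(1)] by (auto simp: inverse_arrows_def hom_def)
  show "iso (sym_center C) f" using iso_inverse[OF assms(1)] inv by (auto simp: iso_def)
  show "inv_arr (sym_center C) f = inv_arr C f" by (simp add: inv_arr_def inv)
qed

lemma sym_center_interchange [simp]:
  "a \<in> sym_center_obj C \<Longrightarrow> b \<in> sym_center_obj C \<Longrightarrow> c \<in> sym_center_obj C \<Longrightarrow> d \<in> sym_center_obj C \<Longrightarrow>
    interchange (sym_center C) a b c d = interchange C a b c d"
  by (simp add: interchange_def)

lemma symmetric_sym_center: "symmetric_monoidal_category (sym_center C)"
  by unfold_locales
    (auto simp: hom_def lun_nat run_nat assoc_nat braid_nat triangle pentagon hexagon1 hexagon2 sym_center_braid)

text \<open>Crossing the central object \<open>b\<close> with \<open>c\<close> and back is trivial.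
  Hence the monoidal structure of the action, defined by inverting \<open>Iota\<close>, is itself an
  interchange, and the interchange identities apply to it.\<close>

lemma inv_interchange:
  assumes "a \<in> Obj C" "b \<in> sym_center_obj C" "c \<in> Obj C" "d \<in> Obj C"
  shows "inv_arr C (interchange C a b c d) = interchange C a c b d"
  using assms interchange_inverse[of a b c d] interchange_inverse[of a c b d]
  by (intro inverse_arrows_iso(2) inverse_arrowsI) (simp_all add: sym_center_braid)

lemma sym_center_act_simps [simp]:
  "ActO (sym_center_act C) = TObj C" "ActA (sym_center_act C) = TArr C"
  "Eta (sym_center_act C) c = inv_arr C (Lun C c)" "Mult (sym_center_act C) m n c = inv_arr C (Assoc C m n c)"
  "Iota (sym_center_act C) = interchange C" "ActUnit (sym_center_act C) = inv_arr C (Lun C (Unit C))"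
  by (simp_all add: sym_center_act_def)

lemma act_mfunc_sym_center_simps [simp]:
  "FObj (act_mfunc C (sym_center_act C)) (s, c) = s \<otimes> c"
  "FArr (act_mfunc C (sym_center_act C)) (f, g) = f \<odot> g"
  "FUnit (act_mfunc C (sym_center_act C)) = inv_arr C (Lun C (Unit C))"
  "s \<in> sym_center_obj C \<Longrightarrow> s' \<in> sym_center_obj C \<Longrightarrow> c \<in> Obj C \<Longrightarrow> c' \<in> Obj C \<Longrightarrow>
    FTen (act_mfunc C (sym_center_act C)) (s, c) (s', c') = interchange C s c s' c'"
  by (simp_all add: act_mfunc_def inv_interchange)

lemma act_mfunc_sym_center:
  "strong_braided_monoidal_functor (prod_brmoncat (sym_center C) C) C (act_mfunc C (sym_center_act C))"
proof -
  interpret S: symmetric_monoidal_category "sym_center C" by (rule symmetric_sym_center)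
  interpret P: braided_monoidal_category "prod_brmoncat (sym_center C) C"
    by (rule braided_prod[OF S.braided_monoidal_category_axioms braided])
  interpret strong_monoidal_functor "prod_brmoncat (sym_center C) C" C "act_mfunc C (sym_center_act C)"
    by (rule strong_monoidal_functorI[OF P.monoidal_category_axioms monoidal_category_axioms])
      (auto simp: interchange_natural interchange_assoc interchange_lun interchange_run)
  show ?thesis
    by unfold_locales (auto simp: interchange_braid sym_center_braid)
qed

text \<open>Unitor and multiplicator are inverses of \<open>Lun\<close> and \<open>Assoc\<close>, so
  the action laws are \<open>lun_tensor\<close>, the pentagon and the triangle read
  backwards.\<close>

lemma sym_center_left_action: "left_action (sym_center C) C (sym_center_act C)"
proof -
  let ?S = "sym_center C" and ?A = "sym_center_act C" and ?B = "\<lambda>a b c. inv_arr C (Assoc C a b c)"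
  interpret S: symmetric_monoidal_category ?S by (rule symmetric_sym_center)
  have act_func: "cat_functor (prod_cat ?S C) C (act_func ?A)"
    by (rule cat_functorI[OF category_prod_cat[OF S.category_axioms category_axioms] category_axioms])
      (auto simp: act_func_def)
  have lun: "?B (Unit C) m c \<cdot> inv_arr C (Lun C (m \<otimes> c)) = inv_arr C (Lun C m) \<odot> Ide C c"
    if [simp]: "m \<in> Obj C" "c \<in> Obj C" for m c
  proof -
    have "inv_arr C (Lun C (m \<otimes> c) \<cdot> Assoc C (Unit C) m c) = inv_arr C (Lun C m \<odot> Ide C c)"
      by (simp add: lun_tensor)
    then show ?thesis by (simp add: inv_comp inv_tensor)
  qed
  have pent: "(Assoc C m n p \<odot> Ide C c) \<cdot> ?B (m \<otimes> n) p c \<cdot> ?B m n (p \<otimes> c) =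
      ?B m (n \<otimes> p) c \<cdot> (Ide C m \<odot> ?B n p c)"
    if [simp]: "m \<in> Obj C" "n \<in> Obj C" "p \<in> Obj C" "c \<in> Obj C" for m n p c
  proof -
    have "inv_arr C (Assoc C m n (p \<otimes> c) \<cdot> Assoc C (m \<otimes> n) p c) =
        inv_arr C ((Ide C m \<odot> Assoc C n p c) \<cdot> Assoc C m (n \<otimes> p) c \<cdot> (Assoc C m n p \<odot> Ide C c))"
      by (simp add: pentagon)
    also have "\<dots> = (?B m n p \<odot> Ide C c) \<cdot> ?B m (n \<otimes> p) c \<cdot> (Ide C m \<odot> ?B n p c)"
      by (simp add: inv_comp inv_tensor)
    finally show ?thesis by (simp add: inv_comp)
  qed
  show ?thesis
  proof (intro left_action.intro left_action_axioms.intro)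
    fix f m m' g n n' h c c'
    assume "f \<in> hom ?S m m'" "g \<in> hom ?S n n'" "h \<in> hom C c c'"
    then show "ActA ?A (f \<odot>\<^bsub>?S\<^esub> g) h \<cdot> Mult ?A m n c = Mult ?A m' n' c' \<cdot> ActA ?A f (ActA ?A g h)"
      by (auto simp: hom_def assoc_inv_nat)
  qed (simp_all add: hom_def S.monoidal_category_axioms category_axioms act_func triangle_inv lun pent,
      auto simp: lun_inv_nat)
qed

text \<open>Closure of strong monoidal functors under composition and products supplies the four
  functors \<open>E1\<close>, \<open>E2\<close>, \<open>M1\<close>, \<open>M2\<close>. The
  monoidality of unitor and multiplicator then rests on \<open>interchange_eta\<close> and
  \<open>interchange_mult\<close>.\<close>

theorem sym_center_braided_action: "braided_action (sym_center C) C (sym_center_act C)"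
proof -
  let ?S = "sym_center C" and ?A = "sym_center_act C"
  interpret S: symmetric_monoidal_category ?S by (rule symmetric_sym_center)
  note S = S.braided_monoidal_category_axioms
  interpret act: strong_braided_monoidal_functor "prod_brmoncat ?S C" C "act_mfunc C ?A"
    by (rule act_mfunc_sym_center)
  note act = act.strong_monoidal_functor_axioms
  interpret E1: strong_monoidal_functor C C "id_mfunc C"
    by (rule id_strong_monoidal) unfold_locales
  interpret E2: strong_monoidal_functor C C "comp_mfunc C (act_mfunc C ?A) (unit_mfunc ?S C)"
    by (rule comp_strong_monoidal[OF unit_strong_monoidal[OF S braided] act])
  interpret M1: strong_monoidal_functor "prod_brmoncat ?S (prod_brmoncat ?S C)" C
    "comp_mfunc C (act_mfunc C ?A) (prod_mfunc (id_mfunc ?S) (act_mfunc C ?A))"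
    by (rule comp_strong_monoidal[OF prod_strong_monoidal[OF S S _ braided id_strong_monoidal act] act])
      (auto intro: braided_prod S braided S.monoidal_category_axioms)
  interpret M2: strong_monoidal_functor "prod_brmoncat ?S (prod_brmoncat ?S C)" C
    "comp_mfunc C (act_mfunc C ?A)
       (comp_mfunc (prod_brmoncat ?S C) (prod_mfunc (tensor_mfunc ?S) (id_mfunc C)) (assoc_mfunc ?S ?S C))"
    by (rule comp_strong_monoidal[OF comp_strong_monoidal[OF assoc_strong_monoidal[OF S S braided]
          prod_strong_monoidal[OF _ S braided braided tensor_strong_monoidal[OF S] id_strong_monoidal]] act])
      (auto intro: braided_prod S braided monoidal_category_axioms)
  let ?F1 = "id_mfunc C" and ?G1 = "comp_mfunc C (act_mfunc C ?A) (unit_mfunc ?S C)"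
  have "natural_transformation C C ?F1 ?G1 (Eta ?A)"
    by (rule natural_transformationI[OF E1.cat_functor_axioms E2.cat_functor_axioms])
      (simp_all add: lun_inv_nat)
  moreover have "Eta ?A (Unit C) \<cdot> FUnit ?F1 = FUnit ?G1"
    by simp
  moreover have "Eta ?A (x \<otimes> y) \<cdot> FTen ?F1 x y = FTen ?G1 x y \<cdot> (Eta ?A x \<odot> Eta ?A y)"
    if "x \<in> Obj C" "y \<in> Obj C" for x y
    using that by (simp add: interchange_eta)
  ultimately have eta: "monoidal_transformation C C ?F1 ?G1 (Eta ?A)"
    by (intro monoidal_transformation.intro monoidal_transformation_axioms.intro
        E1.strong_monoidal_functor_axioms E2.strong_monoidal_functor_axioms)
  let ?P = "prod_brmoncat ?S (prod_brmoncat ?S C)"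
  let ?F2 = "comp_mfunc C (act_mfunc C ?A) (prod_mfunc (id_mfunc ?S) (act_mfunc C ?A))"
  let ?G2 = "comp_mfunc C (act_mfunc C ?A)
       (comp_mfunc (prod_brmoncat ?S C) (prod_mfunc (tensor_mfunc ?S) (id_mfunc C)) (assoc_mfunc ?S ?S C))"
  let ?mult = "\<lambda>(m, n, c). Mult ?A m n c"
  have "natural_transformation ?P C ?F2 ?G2 ?mult"
    by (rule natural_transformationI[OF M1.cat_functor_axioms M2.cat_functor_axioms])
      (clarsimp simp: assoc_inv_nat)+
  \<comment> \<open>Both sides consist of inverse unitors at the unit object, where left and right
    unitor agree.\<close>
  moreover have "?mult (Unit ?P) \<cdot> FUnit ?F2 = FUnit ?G2"
    by (simp add: lun_unit comp_chain[OF triangle_inv[of "Unit C" "Unit C", unfolded lun_unit]])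
  moreover have "?mult (x \<otimes>\<^bsub>?P\<^esub> y) \<cdot> FTen ?F2 x y = FTen ?G2 x y \<cdot> (?mult x \<odot> ?mult y)"
    if "x \<in> Obj ?P" "y \<in> Obj ?P" for x y
    using that by (clarsimp simp: interchange_mult)
  ultimately have mult: "monoidal_transformation ?P C ?F2 ?G2 ?mult"
    by (intro monoidal_transformation.intro monoidal_transformation_axioms.intro
        M1.strong_monoidal_functor_axioms M2.strong_monoidal_functor_axioms)
  show ?thesis
    by (intro braided_action.intro braided_action_axioms.intro eta mult)
      (simp_all add: hom_def S.symmetric_monoidal_category_axioms braided sym_center_left_action
        act_mfunc_sym_center)
qed

end

section \<open>Braided actions\<close>

context strong_braided_monoidal_functor
begin

text \<open>The interchange is made of associators and one braiding, and the functor respects each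
  of them. Applied to the action as a functor on the product of \<open>M\<close> and
  \<open>C\<close>, this gives \<open>\<kappa>_interchange\<close>.\<close>

lemma ften_interchange:
  assumes [simp]: "a \<in> Obj C" "b \<in> Obj C" "c \<in> Obj C" "d \<in> Obj C"
  shows "FArr F (interchange C a b c d) \<cdot>\<^bsub>D\<^esub> FTen F (a \<otimes>\<^bsub>C\<^esub> b) (c \<otimes>\<^bsub>C\<^esub> d) \<cdot>\<^bsub>D\<^esub> (FTen F a b \<odot>\<^bsub>D\<^esub> FTen F c d) =
    FTen F (a \<otimes>\<^bsub>C\<^esub> c) (b \<otimes>\<^bsub>C\<^esub> d) \<cdot>\<^bsub>D\<^esub> (FTen F a c \<odot>\<^bsub>D\<^esub> FTen F b d) \<cdot>\<^bsub>D\<^esub>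
      interchange D (FObj F a) (FObj F b) (FObj F c) (FObj F d)"
proof -
  let ?F = "FObj F" and ?T = "FTen F" and ?i = "\<lambda>a. Ide D (FObj F a)"
  let ?A = "\<lambda>a b c. Assoc D (?F a) (?F b) (?F c)"
  \<comment> \<open>\<open>K3\<close> and \<open>K\<close> are the structure arrows for
    right-bracketed products of three and four factors. Expressing every bracketing through them
    separates the associators from the braiding.\<close>
  define K3 where "K3 b c d = ?T b (c \<otimes>\<^bsub>C\<^esub> d) \<cdot>\<^bsub>D\<^esub> (?i b \<odot>\<^bsub>D\<^esub> ?T c d)" for b c d
  define K where "K a b c d = ?T a (b \<otimes>\<^bsub>C\<^esub> c \<otimes>\<^bsub>C\<^esub> d) \<cdot>\<^bsub>D\<^esub> (?i a \<odot>\<^bsub>D\<^esub> K3 b c d)" for a b c d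
  have K3 [simp]: "K3 b c d \<in> Arr D" "Dom D (K3 b c d) = ?F b \<otimes>\<^bsub>D\<^esub> ?F c \<otimes>\<^bsub>D\<^esub> ?F d" "Cod D (K3 b c d) = ?F (b \<otimes>\<^bsub>C\<^esub> c \<otimes>\<^bsub>C\<^esub> d)"
    if "b \<in> Obj C" "c \<in> Obj C" "d \<in> Obj C" for b c d
    using that by (simp_all add: K3_def)
  have K [simp]: "K a b c d \<in> Arr D" "Dom D (K a b c d) = ?F a \<otimes>\<^bsub>D\<^esub> ?F b \<otimes>\<^bsub>D\<^esub> ?F c \<otimes>\<^bsub>D\<^esub> ?F d"
      "Cod D (K a b c d) = ?F (a \<otimes>\<^bsub>C\<^esub> b \<otimes>\<^bsub>C\<^esub> c \<otimes>\<^bsub>C\<^esub> d)"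
    if "a \<in> Obj C" "b \<in> Obj C" "c \<in> Obj C" "d \<in> Obj C" for a b c d
    using that by (simp_all add: K_def)
  have K3_assoc: "FArr F (Assoc C b c d) \<cdot>\<^bsub>D\<^esub> ?T (b \<otimes>\<^bsub>C\<^esub> c) d \<cdot>\<^bsub>D\<^esub> (?T b c \<odot>\<^bsub>D\<^esub> ?i d) = K3 b c d \<cdot>\<^bsub>D\<^esub> ?A b c d"
    if "b \<in> Obj C" "c \<in> Obj C" "d \<in> Obj C" for b c d
    using that by (simp add: K3_def ften_assoc)
  have K_assoc: "FArr F (Assoc C a b (c \<otimes>\<^bsub>C\<^esub> d)) \<cdot>\<^bsub>D\<^esub> ?T (a \<otimes>\<^bsub>C\<^esub> b) (c \<otimes>\<^bsub>C\<^esub> d) \<cdot>\<^bsub>D\<^esub> (?T a b \<odot>\<^bsub>D\<^esub> ?T c d) =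
      K a b c d \<cdot>\<^bsub>D\<^esub> Assoc D (?F a) (?F b) (?F c \<otimes>\<^bsub>D\<^esub> ?F d)"
    if [simp]: "a \<in> Obj C" "b \<in> Obj C" "c \<in> Obj C" "d \<in> Obj C" for a b c d
  proof -
    have "FArr F (Assoc C a b (c \<otimes>\<^bsub>C\<^esub> d)) \<cdot>\<^bsub>D\<^esub> ?T (a \<otimes>\<^bsub>C\<^esub> b) (c \<otimes>\<^bsub>C\<^esub> d) \<cdot>\<^bsub>D\<^esub> (?T a b \<odot>\<^bsub>D\<^esub> ?T c d) =
      (FArr F (Assoc C a b (c \<otimes>\<^bsub>C\<^esub> d)) \<cdot>\<^bsub>D\<^esub> ?T (a \<otimes>\<^bsub>C\<^esub> b) (c \<otimes>\<^bsub>C\<^esub> d) \<cdot>\<^bsub>D\<^esub> (?T a b \<odot>\<^bsub>D\<^esub> ?i (c \<otimes>\<^bsub>C\<^esub> d))) \<cdot>\<^bsub>D\<^esub> ((?i a \<odot>\<^bsub>D\<^esub> ?i b) \<odot>\<^bsub>D\<^esub> ?T c d)"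
      by simp
    also have "\<dots> = ?T a (b \<otimes>\<^bsub>C\<^esub> c \<otimes>\<^bsub>C\<^esub> d) \<cdot>\<^bsub>D\<^esub> (?i a \<odot>\<^bsub>D\<^esub> ?T b (c \<otimes>\<^bsub>C\<^esub> d)) \<cdot>\<^bsub>D\<^esub> ?A a b (c \<otimes>\<^bsub>C\<^esub> d) \<cdot>\<^bsub>D\<^esub> ((?i a \<odot>\<^bsub>D\<^esub> ?i b) \<odot>\<^bsub>D\<^esub> ?T c d)"
      by (subst ften_assoc) auto
    also have "\<dots> = K a b c d \<cdot>\<^bsub>D\<^esub> Assoc D (?F a) (?F b) (?F c \<otimes>\<^bsub>D\<^esub> ?F d)"
      by (subst D.assoc_nat) (auto simp: K_def K3_def)
    finally show ?thesis .
  qed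
  let ?X = "Assoc C c b d \<cdot>\<^bsub>C\<^esub> (Braid C b c \<odot>\<^bsub>C\<^esub> Ide C d) \<cdot>\<^bsub>C\<^esub> inv_arr C (Assoc C b c d)"
  let ?Y = "?A c b d \<cdot>\<^bsub>D\<^esub> (Braid D (?F b) (?F c) \<odot>\<^bsub>D\<^esub> ?i d) \<cdot>\<^bsub>D\<^esub> inv_arr D (?A b c d)"
  have XY: "FArr F ?X \<cdot>\<^bsub>D\<^esub> K3 b c d = K3 c b d \<cdot>\<^bsub>D\<^esub> ?Y"
  proof (rule D.iso_cancel_right[of "?A b c d"])
    have "(FArr F ?X \<cdot>\<^bsub>D\<^esub> K3 b c d) \<cdot>\<^bsub>D\<^esub> ?A b c d = FArr F ?X \<cdot>\<^bsub>D\<^esub> FArr F (Assoc C b c d) \<cdot>\<^bsub>D\<^esub> ?T (b \<otimes>\<^bsub>C\<^esub> c) d \<cdot>\<^bsub>D\<^esub> (?T b c \<odot>\<^bsub>D\<^esub> ?i d)"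
      by (simp add: K3_assoc)
    also have "\<dots> = FArr F (Assoc C c b d) \<cdot>\<^bsub>D\<^esub> (FArr F (Braid C b c \<odot>\<^bsub>C\<^esub> Ide C d) \<cdot>\<^bsub>D\<^esub> ?T (b \<otimes>\<^bsub>C\<^esub> c) d) \<cdot>\<^bsub>D\<^esub> (?T b c \<odot>\<^bsub>D\<^esub> ?i d)"
      by (simp add: farr_inv)
    also have "\<dots> = FArr F (Assoc C c b d) \<cdot>\<^bsub>D\<^esub> ?T (c \<otimes>\<^bsub>C\<^esub> b) d \<cdot>\<^bsub>D\<^esub> ((FArr F (Braid C b c) \<cdot>\<^bsub>D\<^esub> ?T b c) \<odot>\<^bsub>D\<^esub> ?i d)"
      by (subst ften_nat[symmetric]) auto
    also have "\<dots> = (FArr F (Assoc C c b d) \<cdot>\<^bsub>D\<^esub> ?T (c \<otimes>\<^bsub>C\<^esub> b) d \<cdot>\<^bsub>D\<^esub> (?T c b \<odot>\<^bsub>D\<^esub> ?i d)) \<cdot>\<^bsub>D\<^esub> (Braid D (?F b) (?F c) \<odot>\<^bsub>D\<^esub> ?i d)"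
      by (simp add: ften_braid)
    also have "\<dots> = (K3 c b d \<cdot>\<^bsub>D\<^esub> ?Y) \<cdot>\<^bsub>D\<^esub> ?A b c d"
      by (subst K3_assoc) auto
    finally show "(FArr F ?X \<cdot>\<^bsub>D\<^esub> K3 b c d) \<cdot>\<^bsub>D\<^esub> ?A b c d = (K3 c b d \<cdot>\<^bsub>D\<^esub> ?Y) \<cdot>\<^bsub>D\<^esub> ?A b c d" .
  qed simp_all
  have "(FArr F (Ide C a \<odot>\<^bsub>C\<^esub> ?X) \<cdot>\<^bsub>D\<^esub> ?T a (b \<otimes>\<^bsub>C\<^esub> c \<otimes>\<^bsub>C\<^esub> d)) \<cdot>\<^bsub>D\<^esub> (?i a \<odot>\<^bsub>D\<^esub> K3 b c d)
      = ?T a (c \<otimes>\<^bsub>C\<^esub> b \<otimes>\<^bsub>C\<^esub> d) \<cdot>\<^bsub>D\<^esub> (?i a \<odot>\<^bsub>D\<^esub> (FArr F ?X \<cdot>\<^bsub>D\<^esub> K3 b c d))"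
    by (subst ften_nat[symmetric]) (auto simp del: fcomp_simp)
  also have "\<dots> = K a c b d \<cdot>\<^bsub>D\<^esub> (?i a \<odot>\<^bsub>D\<^esub> ?Y)"
    unfolding XY by (simp add: K_def)
  finally have aXY: "FArr F (Ide C a \<odot>\<^bsub>C\<^esub> ?X) \<cdot>\<^bsub>D\<^esub> K a b c d = K a c b d \<cdot>\<^bsub>D\<^esub> (?i a \<odot>\<^bsub>D\<^esub> ?Y)"
    by (simp add: K_def del: fcomp_simp)
  have "FArr F (interchange C a b c d) \<cdot>\<^bsub>D\<^esub> ?T (a \<otimes>\<^bsub>C\<^esub> b) (c \<otimes>\<^bsub>C\<^esub> d) \<cdot>\<^bsub>D\<^esub> (?T a b \<odot>\<^bsub>D\<^esub> ?T c d)
     = FArr F (inv_arr C (Assoc C a c (b \<otimes>\<^bsub>C\<^esub> d))) \<cdot>\<^bsub>D\<^esub> FArr F (Ide C a \<odot>\<^bsub>C\<^esub> ?X) \<cdot>\<^bsub>D\<^esub>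
       FArr F (Assoc C a b (c \<otimes>\<^bsub>C\<^esub> d)) \<cdot>\<^bsub>D\<^esub> ?T (a \<otimes>\<^bsub>C\<^esub> b) (c \<otimes>\<^bsub>C\<^esub> d) \<cdot>\<^bsub>D\<^esub> (?T a b \<odot>\<^bsub>D\<^esub> ?T c d)"
    by (simp add: interchange_def)
  also have "\<dots> = FArr F (inv_arr C (Assoc C a c (b \<otimes>\<^bsub>C\<^esub> d))) \<cdot>\<^bsub>D\<^esub> (FArr F (Ide C a \<odot>\<^bsub>C\<^esub> ?X) \<cdot>\<^bsub>D\<^esub>
       K a b c d) \<cdot>\<^bsub>D\<^esub> Assoc D (?F a) (?F b) (?F c \<otimes>\<^bsub>D\<^esub> ?F d)"
    unfolding K_assoc[OF assms] by simp
  also have "\<dots> = inv_arr D (FArr F (Assoc C a c (b \<otimes>\<^bsub>C\<^esub> d))) \<cdot>\<^bsub>D\<^esub> (K a c b d \<cdot>\<^bsub>D\<^esub> Assoc D (?F a) (?F c) (?F b \<otimes>\<^bsub>D\<^esub> ?F d)) \<cdot>\<^bsub>D\<^esub>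
      interchange D (?F a) (?F b) (?F c) (?F d)"
    unfolding aXY by (simp add: farr_inv interchange_def)
  also have "\<dots> = ?T (a \<otimes>\<^bsub>C\<^esub> c) (b \<otimes>\<^bsub>C\<^esub> d) \<cdot>\<^bsub>D\<^esub> (?T a c \<odot>\<^bsub>D\<^esub> ?T b d) \<cdot>\<^bsub>D\<^esub> interchange D (?F a) (?F b) (?F c) (?F d)"
    by (subst K_assoc[symmetric]) auto
  finally show ?thesis .
qed

end

section \<open>The laws of a braided action in components\<close>

context braided_action
begin

abbreviation comp_C (infixr "\<cdot>\<^sub>C" 60) where "g \<cdot>\<^sub>C f \<equiv> Comp C g f"
abbreviation tens_C (infixr "\<odot>\<^sub>C" 70) where "f \<odot>\<^sub>C g \<equiv> TArr C f g"
abbreviation obj_tens_C (infixr "\<otimes>\<^sub>C" 70) where "c \<otimes>\<^sub>C d \<equiv> TObj C c d"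
abbreviation obj_tens_M (infixr "\<otimes>\<^sub>M" 70) where "m \<otimes>\<^sub>M n \<equiv> TObj M m n"

lemma actO_obj [simp]: "m \<in> Obj M \<Longrightarrow> c \<in> Obj C \<Longrightarrow> ActO A m c \<in> Obj C"
  using act_func.fobj[of "(m, c)"] by (simp add: act_func_def)

lemma actA_simps [simp]:
  assumes "f \<in> Arr M" "h \<in> Arr C"
  shows "ActA A f h \<in> Arr C" "Dom C (ActA A f h) = ActO A (Dom M f) (Dom C h)"
    "Cod C (ActA A f h) = ActO A (Cod M f) (Cod C h)"
  using act_func.farr_simps[of "(f, h)"] assms by (simp_all add: act_func_def)

lemma actA_ide [simp]: "m \<in> Obj M \<Longrightarrow> c \<in> Obj C \<Longrightarrow> ActA A (Ide M m) (Ide C c) = Ide C (ActO A m c)"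
  using act_func.fide[of "(m, c)"] by (simp add: act_func_def)

lemma actA_merge [simp]:
  "f \<in> Arr M \<Longrightarrow> f' \<in> Arr M \<Longrightarrow> h \<in> Arr C \<Longrightarrow> h' \<in> Arr C \<Longrightarrow> Dom M f' = Cod M f \<Longrightarrow> Dom C h' = Cod C h \<Longrightarrow>
    ActA A f' h' \<cdot>\<^sub>C ActA A f h = ActA A (f' \<cdot>\<^bsub>M\<^esub> f) (h' \<cdot>\<^sub>C h)"
  using act_func.fcomp_simp[of "(f, h)" "(f', h')"] by (simp add: act_func_def)

lemma actA_merge_chain [simp]:
  "f \<in> Arr M \<Longrightarrow> f' \<in> Arr M \<Longrightarrow> h \<in> Arr C \<Longrightarrow> h' \<in> Arr C \<Longrightarrow> Dom M f' = Cod M f \<Longrightarrow> Dom C h' = Cod C h \<Longrightarrow>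
    x \<in> Arr C \<Longrightarrow> Cod C x = ActO A (Dom M f) (Dom C h) \<Longrightarrow>
    ActA A f' h' \<cdot>\<^sub>C ActA A f h \<cdot>\<^sub>C x = ActA A (f' \<cdot>\<^bsub>M\<^esub> f) (h' \<cdot>\<^sub>C h) \<cdot>\<^sub>C x"
  by (rule C.comp_chain) auto

lemma actA_inverse:
  assumes "iso M f" "iso C h"
  shows "inverse_arrows C (ActA A f h) (ActA A (inv_arr M f) (inv_arr C h))"
  using assms M.iso_arr[OF assms(1)] C.iso_arr[OF assms(2)] by (intro C.inverse_arrowsI) simp_all

lemma actA_iso [simp]: "iso M f \<Longrightarrow> iso C h \<Longrightarrow> iso C (ActA A f h)"
  by (rule C.inverse_arrows_iso[OF actA_inverse])

lemma eta_simps [simp]: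
  assumes "c \<in> Obj C"
  shows "Eta A c \<in> Arr C" "Dom C (Eta A c) = c" "Cod C (Eta A c) = ActO A (Unit M) c" "iso C (Eta A c)"
  using eta_hom[OF assms] eta_iso[OF assms] by (auto simp: hom_def)

lemma eta_nat:
  "h \<in> Arr C \<Longrightarrow> Dom C h = c \<Longrightarrow> Cod C h = c' \<Longrightarrow>
    ActA A (Ide M (Unit M)) h \<cdot>\<^sub>C Eta A c = Eta A c' \<cdot>\<^sub>C h"
  by (rule eta_natural[OF homI])

lemma mult_simps [simp]:
  assumes "m \<in> Obj M" "n \<in> Obj M" "c \<in> Obj C"
  shows "Mult A m n c \<in> Arr C" "Dom C (Mult A m n c) = ActO A m (ActO A n c)"
    "Cod C (Mult A m n c) = ActO A (m \<otimes>\<^sub>M n) c" "iso C (Mult A m n c)"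
  using mult_hom[OF assms] mult_iso[OF assms] by (auto simp: hom_def)

lemma mult_nat:
  "f \<in> Arr M \<Longrightarrow> g \<in> Arr M \<Longrightarrow> h \<in> Arr C \<Longrightarrow> Dom M f = m \<Longrightarrow> Dom M g = n \<Longrightarrow> Dom C h = c \<Longrightarrow>
    Cod M f = m' \<Longrightarrow> Cod M g = n' \<Longrightarrow> Cod C h = c' \<Longrightarrow>
    Mult A m' n' c' \<cdot>\<^sub>C ActA A f (ActA A g h) = ActA A (f \<odot>\<^bsub>M\<^esub> g) h \<cdot>\<^sub>C Mult A m n c"
  by (rule mult_natural[symmetric, OF homI homI homI])

text \<open>The interchanger turned around, which is the direction in which the laws of a monoidal
  functor speak of it.\<close>

definition \<kappa> :: "'m \<Rightarrow> 'm \<Rightarrow> 'o \<Rightarrow> 'o \<Rightarrow> 'a" where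
  "\<kappa> m n c d = inv_arr C (Iota A m n c d)"

lemma iota_simps [simp]:
  assumes "m \<in> Obj M" "n \<in> Obj M" "c \<in> Obj C" "d \<in> Obj C"
  shows "Iota A m n c d \<in> Arr C" "Dom C (Iota A m n c d) = ActO A (m \<otimes>\<^sub>M n) (c \<otimes>\<^sub>C d)"
    "Cod C (Iota A m n c d) = ActO A m c \<otimes>\<^sub>C ActO A n d" "iso C (Iota A m n c d)"
  using iota_hom[OF assms] iota_iso[OF assms] by (auto simp: hom_def)

lemma \<kappa>_simps [simp]:
  assumes "m \<in> Obj M" "n \<in> Obj M" "c \<in> Obj C" "d \<in> Obj C"
  shows "\<kappa> m n c d \<in> Arr C" "Dom C (\<kappa> m n c d) = ActO A m c \<otimes>\<^sub>C ActO A n d"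
    "Cod C (\<kappa> m n c d) = ActO A (m \<otimes>\<^sub>M n) (c \<otimes>\<^sub>C d)" "iso C (\<kappa> m n c d)"
  using assms by (simp_all add: \<kappa>_def)

lemma act_mfunc_simps [simp]:
  "FObj (act_mfunc C A) (m, c) = ActO A m c" "FArr (act_mfunc C A) (f, h) = ActA A f h"
  "FUnit (act_mfunc C A) = ActUnit A" "FTen (act_mfunc C A) (m, c) (n, d) = \<kappa> m n c d"
  by (simp_all add: act_mfunc_def \<kappa>_def)

lemma \<kappa>_nat:
  "f \<in> Arr M \<Longrightarrow> g \<in> Arr M \<Longrightarrow> h \<in> Arr C \<Longrightarrow> k \<in> Arr C \<Longrightarrow>
    Dom M f = m \<Longrightarrow> Dom M g = n \<Longrightarrow> Dom C h = c \<Longrightarrow> Dom C k = d \<Longrightarrow>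
    Cod M f = m' \<Longrightarrow> Cod M g = n' \<Longrightarrow> Cod C h = c' \<Longrightarrow> Cod C k = d' \<Longrightarrow>
    \<kappa> m' n' c' d' \<cdot>\<^sub>C (ActA A f h \<odot>\<^sub>C ActA A g k) = ActA A (f \<odot>\<^bsub>M\<^esub> g) (h \<odot>\<^sub>C k) \<cdot>\<^sub>C \<kappa> m n c d"
  using act_mfunc.ften_nat[of "(f, h)" "(g, k)" "(m, c)" "(n, d)" "(m', c')" "(n', d')"] by simp

lemma \<kappa>_assoc:
  "m \<in> Obj M \<Longrightarrow> n \<in> Obj M \<Longrightarrow> p \<in> Obj M \<Longrightarrow> c \<in> Obj C \<Longrightarrow> d \<in> Obj C \<Longrightarrow> e \<in> Obj C \<Longrightarrow>
    ActA A (Assoc M m n p) (Assoc C c d e) \<cdot>\<^sub>C \<kappa> (m \<otimes>\<^sub>M n) p (c \<otimes>\<^sub>C d) e \<cdot>\<^sub>C (\<kappa> m n c d \<odot>\<^sub>C Ide C (ActO A p e)) =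
    \<kappa> m (n \<otimes>\<^sub>M p) c (d \<otimes>\<^sub>C e) \<cdot>\<^sub>C (Ide C (ActO A m c) \<odot>\<^sub>C \<kappa> n p d e) \<cdot>\<^sub>C
      Assoc C (ActO A m c) (ActO A n d) (ActO A p e)"
  using act_mfunc.ften_assoc[of "(m, c)" "(n, d)" "(p, e)"] by simp

lemma actUnit: "ActUnit A = Eta A (Unit C)"
  using eta.trans_unit act_mfunc.funit_simps by simp

lemma \<kappa>_lun:
  "m \<in> Obj M \<Longrightarrow> c \<in> Obj C \<Longrightarrow>
    ActA A (Lun M m) (Lun C c) \<cdot>\<^sub>C \<kappa> (Unit M) m (Unit C) c \<cdot>\<^sub>C (Eta A (Unit C) \<odot>\<^sub>C Ide C (ActO A m c)) = Lun C (ActO A m c)"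
  using act_mfunc.ften_lun[of "(m, c)"] by (simp add: actUnit)

lemma \<kappa>_run:
  "m \<in> Obj M \<Longrightarrow> c \<in> Obj C \<Longrightarrow>
    ActA A (Run M m) (Run C c) \<cdot>\<^sub>C \<kappa> m (Unit M) c (Unit C) \<cdot>\<^sub>C (Ide C (ActO A m c) \<odot>\<^sub>C Eta A (Unit C)) = Run C (ActO A m c)"
  using act_mfunc.ften_run[of "(m, c)"] by (simp add: actUnit)

lemma \<kappa>_braid:
  "m \<in> Obj M \<Longrightarrow> n \<in> Obj M \<Longrightarrow> c \<in> Obj C \<Longrightarrow> d \<in> Obj C \<Longrightarrow>
    ActA A (Braid M m n) (Braid C c d) \<cdot>\<^sub>C \<kappa> m n c d = \<kappa> n m d c \<cdot>\<^sub>C Braid C (ActO A m c) (ActO A n d)"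
  using act_mfunc.ften_braid[of "(m, c)" "(n, d)"] by simp

lemma eta_tensor:
  "c \<in> Obj C \<Longrightarrow> d \<in> Obj C \<Longrightarrow>
    ActA A (Lun M (Unit M)) (Ide C (c \<otimes>\<^sub>C d)) \<cdot>\<^sub>C \<kappa> (Unit M) (Unit M) c d \<cdot>\<^sub>C (Eta A c \<odot>\<^sub>C Eta A d) = Eta A (c \<otimes>\<^sub>C d)"
  using eta.trans_tensor[of c d] by simp

lemma mult_tensor:
  "m \<in> Obj M \<Longrightarrow> n \<in> Obj M \<Longrightarrow> m' \<in> Obj M \<Longrightarrow> n' \<in> Obj M \<Longrightarrow> c \<in> Obj C \<Longrightarrow> d \<in> Obj C \<Longrightarrow>
    Mult A (m \<otimes>\<^sub>M m') (n \<otimes>\<^sub>M n') (c \<otimes>\<^sub>C d) \<cdot>\<^sub>C ActA A (Ide M (m \<otimes>\<^sub>M m')) (\<kappa> n n' c d) \<cdot>\<^sub>C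
      \<kappa> m m' (ActO A n c) (ActO A n' d) =
    ActA A (interchange M m n m' n') (Ide C (c \<otimes>\<^sub>C d)) \<cdot>\<^sub>C \<kappa> (m \<otimes>\<^sub>M n) (m' \<otimes>\<^sub>M n') c d \<cdot>\<^sub>C
      (Mult A m n c \<odot>\<^sub>C Mult A m' n' d)"
  using mult.trans_tensor[of "(m, n, c)" "(m', n', d)"] by simp

lemma \<kappa>_interchange:
  assumes [simp]: "m \<in> Obj M" "n \<in> Obj M" "p \<in> Obj M" "q \<in> Obj M" "c \<in> Obj C" "d \<in> Obj C" "e \<in> Obj C" "b \<in> Obj C"
  shows "ActA A (interchange M m n p q) (interchange C c d e b) \<cdot>\<^sub>C \<kappa> (m \<otimes>\<^sub>M n) (p \<otimes>\<^sub>M q) (c \<otimes>\<^sub>C d) (e \<otimes>\<^sub>C b) \<cdot>\<^sub>C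
      (\<kappa> m n c d \<odot>\<^sub>C \<kappa> p q e b) =
    \<kappa> (m \<otimes>\<^sub>M p) (n \<otimes>\<^sub>M q) (c \<otimes>\<^sub>C e) (d \<otimes>\<^sub>C b) \<cdot>\<^sub>C (\<kappa> m p c e \<odot>\<^sub>C \<kappa> n q d b) \<cdot>\<^sub>C
      interchange C (ActO A m c) (ActO A n d) (ActO A p e) (ActO A q b)"
proof -
  have "interchange (prod_brmoncat M C) (m, c) (n, d) (p, e) (q, b) = (interchange M m n p q, interchange C c d e b)"
    by (simp add: interchange_def M.category_axioms C.category_axioms)
  then show ?thesis
    using act_mfunc.ften_interchange[of "(m, c)" "(n, d)" "(p, e)" "(q, b)"] by simp
qed

end

section \<open>The isomorphism from the restricted action of the center\<close>

context braided_action
begin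

abbreviation j where "j \<equiv> Unit M"
abbreviation i where "i \<equiv> Unit C"

definition \<theta> :: "'m \<Rightarrow> 'o \<Rightarrow> 'a" where
  "\<theta> m c = ActA A (Run M m) (Lun C c) \<cdot>\<^sub>C \<kappa> m j i c \<cdot>\<^sub>C (Ide C (ActO A m i) \<odot>\<^sub>C Eta A c)"

text \<open>The structure of the classifier as a monoidal functor: the inverse interchanger at unit
  objects, followed by the contraction of \<open>i \<otimes> i\<close>.\<close>

definition \<phi> :: "'m \<Rightarrow> 'm \<Rightarrow> 'a" where
  "\<phi> m n = ActA A (Ide M (m \<otimes>\<^sub>M n)) (Lun C i) \<cdot>\<^sub>C \<kappa> m n i i"

lemma \<theta>_simps [simp]:
  assumes "m \<in> Obj M" "c \<in> Obj C"
  shows "\<theta> m c \<in> Arr C" "Dom C (\<theta> m c) = ActO A m i \<otimes>\<^sub>C c" "Cod C (\<theta> m c) = ActO A m c" "iso C (\<theta> m c)"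
  using assms by (simp_all add: \<theta>_def)

lemma \<phi>_simps [simp]:
  assumes "m \<in> Obj M" "n \<in> Obj M"
  shows "\<phi> m n \<in> Arr C" "Dom C (\<phi> m n) = ActO A m i \<otimes>\<^sub>C ActO A n i" "Cod C (\<phi> m n) = ActO A (m \<otimes>\<^sub>M n) i"
    "iso C (\<phi> m n)"
  using assms by (simp_all add: \<phi>_def)

lemma \<theta>_nat:
  assumes [simp]: "f \<in> Arr M" "h \<in> Arr C" "Dom M f = m" "Cod M f = m'" "Dom C h = c" "Cod C h = c'"
  shows "\<theta> m' c' \<cdot>\<^sub>C (ActA A f (Ide C i) \<odot>\<^sub>C h) = ActA A f h \<cdot>\<^sub>C \<theta> m c"
proof -
  have [simp]: "m \<in> Obj M" "m' \<in> Obj M" "c \<in> Obj C" "c' \<in> Obj C"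
    using M.dom_obj[OF assms(1)] M.cod_obj[OF assms(1)] C.dom_obj[OF assms(2)] C.cod_obj[OF assms(2)] by simp_all
  have "\<theta> m' c' \<cdot>\<^sub>C (ActA A f (Ide C i) \<odot>\<^sub>C h) =
      ActA A (Run M m') (Lun C c') \<cdot>\<^sub>C \<kappa> m' j i c' \<cdot>\<^sub>C (ActA A f (Ide C i) \<odot>\<^sub>C ActA A (Ide M j) h) \<cdot>\<^sub>C
      (Ide C (ActO A m i) \<odot>\<^sub>C Eta A c)"
    by (simp add: \<theta>_def eta_nat)
  also have "\<dots> = ActA A (Run M m') (Lun C c') \<cdot>\<^sub>C ActA A (f \<odot>\<^bsub>M\<^esub> Ide M j) (Ide C i \<odot>\<^sub>C h) \<cdot>\<^sub>C \<kappa> m j i c \<cdot>\<^sub>C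
      (Ide C (ActO A m i) \<odot>\<^sub>C Eta A c)"
    by (subst C.comp_chain2[OF \<kappa>_nat]) auto
  also have "\<dots> = ActA A f h \<cdot>\<^sub>C \<theta> m c"
    by (simp add: \<theta>_def M.run_nat C.lun_nat)
  finally show ?thesis .
qed

text \<open>Since \<open>Run M j\<close> equals \<open>Lun M j\<close>, the left-hand side is an
  instance of the left unit law \<open>\<kappa>_lun\<close>.\<close>

lemma \<theta>_unit:
  assumes [simp]: "c \<in> Obj C"
  shows "\<theta> j c \<cdot>\<^sub>C (Eta A i \<odot>\<^sub>C Ide C c) = Eta A c \<cdot>\<^sub>C Lun C c"
proof -
  have "\<theta> j c \<cdot>\<^sub>C (Eta A i \<odot>\<^sub>C Ide C c) = (ActA A (Lun M j) (Lun C c) \<cdot>\<^sub>C \<kappa> j j i c \<cdot>\<^sub>C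
      (Eta A i \<odot>\<^sub>C Ide C (ActO A j c))) \<cdot>\<^sub>C (Ide C i \<odot>\<^sub>C Eta A c)"
    by (simp add: \<theta>_def M.lun_unit)
  also have "\<dots> = Lun C (ActO A j c) \<cdot>\<^sub>C (Ide C i \<odot>\<^sub>C Eta A c)"
    by (subst \<kappa>_lun) auto
  finally show ?thesis by (simp add: C.lun_nat)
qed

text \<open>An Eckmann-Hilton argument: monoidality of \<open>Mult\<close> for the triples
  \<open>(m, j, i)\<close> and \<open>(j, n, c)\<close> expresses a general multiplicator through
  \<open>Mult A m j i\<close> and \<open>Mult A j n c\<close>, which the unit laws of the action
  determine. So interchangers determine multiplicators.\<close>

lemma mult_\<theta>:
  assumes [simp]: "m \<in> Obj M" "n \<in> Obj M" "c \<in> Obj C"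
  shows "Mult A m n c \<cdot>\<^sub>C \<theta> m (ActO A n c) = ActA A (Ide M (m \<otimes>\<^sub>M n)) (Lun C c) \<cdot>\<^sub>C \<kappa> m n i c"
proof -
  let ?k = "\<kappa> m j i (ActO A n c)" and ?i = "\<lambda>m c. Ide C (ActO A m c)"
  let ?E = "?i m i \<odot>\<^sub>C Eta A (ActO A n c)"
  let ?R = "Run M m \<odot>\<^bsub>M\<^esub> Lun M n"
  have n1: "Mult A m n c \<cdot>\<^sub>C ActA A (Run M m) (ActA A (Lun M n) (Lun C c)) =
      ActA A ?R (Lun C c) \<cdot>\<^sub>C Mult A (m \<otimes>\<^sub>M j) (j \<otimes>\<^sub>M n) (i \<otimes>\<^sub>C c)"
    by (rule mult_nat) auto
  have n2: "\<kappa> m j (ActO A j i) (ActO A n c) \<cdot>\<^sub>C (ActA A (Ide M m) (Eta A i) \<odot>\<^sub>C ActA A (Ide M j) (?i n c)) =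
      ActA A (Ide M m \<odot>\<^bsub>M\<^esub> Ide M j) (Eta A i \<odot>\<^sub>C ?i n c) \<cdot>\<^sub>C ?k"
    by (rule \<kappa>_nat) auto
  have n3: "\<kappa> (m \<otimes>\<^sub>M j) (j \<otimes>\<^sub>M n) i c \<cdot>\<^sub>C (ActA A (inv_arr M (Run M m)) (Ide C i) \<odot>\<^sub>C ActA A (inv_arr M (Lun M n)) (Ide C c)) =
      ActA A (inv_arr M (Run M m) \<odot>\<^bsub>M\<^esub> inv_arr M (Lun M n)) (Ide C i \<odot>\<^sub>C Ide C c) \<cdot>\<^sub>C \<kappa> m n i c"
    by (rule \<kappa>_nat) auto
  \<comment> \<open>The left unitor of \<open>n \<bullet> c\<close> inside \<open>\<theta>\<close>
    is expanded by \<open>\<kappa>_lun\<close>; this creates the unit indices and the inverse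
    interchanger that \<open>mult_tensor\<close> requires.\<close>
  have "Mult A m n c \<cdot>\<^sub>C \<theta> m (ActO A n c) =
      Mult A m n c \<cdot>\<^sub>C ActA A (Run M m) (ActA A (Lun M n) (Lun C c) \<cdot>\<^sub>C \<kappa> j n i c \<cdot>\<^sub>C (Eta A i \<odot>\<^sub>C ?i n c)) \<cdot>\<^sub>C ?k \<cdot>\<^sub>C ?E"
    by (simp add: \<theta>_def \<kappa>_lun)
  also have "\<dots> = (Mult A m n c \<cdot>\<^sub>C ActA A (Run M m) (ActA A (Lun M n) (Lun C c))) \<cdot>\<^sub>C
      ActA A (Ide M (m \<otimes>\<^sub>M j)) (\<kappa> j n i c) \<cdot>\<^sub>C (ActA A (Ide M m \<odot>\<^bsub>M\<^esub> Ide M j) (Eta A i \<odot>\<^sub>C ?i n c) \<cdot>\<^sub>C ?k) \<cdot>\<^sub>C ?E"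
    by simp
  also have "\<dots> = ActA A ?R (Lun C c) \<cdot>\<^sub>C (Mult A (m \<otimes>\<^sub>M j) (j \<otimes>\<^sub>M n) (i \<otimes>\<^sub>C c) \<cdot>\<^sub>C
      ActA A (Ide M (m \<otimes>\<^sub>M j)) (\<kappa> j n i c) \<cdot>\<^sub>C \<kappa> m j (ActO A j i) (ActO A n c)) \<cdot>\<^sub>C
      (ActA A (Ide M m) (Eta A i) \<odot>\<^sub>C Eta A (ActO A n c))"
    unfolding n1 n2[symmetric] by simp
  also have "\<dots> = ActA A ?R (Lun C c) \<cdot>\<^sub>C ActA A (interchange M m j j n) (Ide C (i \<otimes>\<^sub>C c)) \<cdot>\<^sub>C
      \<kappa> (m \<otimes>\<^sub>M j) (j \<otimes>\<^sub>M n) i c \<cdot>\<^sub>C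
      ((Mult A m j i \<cdot>\<^sub>C ActA A (Ide M m) (Eta A i)) \<odot>\<^sub>C (Mult A j n c \<cdot>\<^sub>C Eta A (ActO A n c)))"
    by (subst mult_tensor) auto
  \<comment> \<open>The unit laws turn both multiplicators into actions of inverse unitors, and
    \<open>n3\<close> collects these in \<open>M\<close>, where they cancel the interchange of two
    units.\<close>
  also have "\<dots> = ActA A (?R \<cdot>\<^bsub>M\<^esub> interchange M m j j n \<cdot>\<^bsub>M\<^esub> (inv_arr M (Run M m) \<odot>\<^bsub>M\<^esub> inv_arr M (Lun M n))) (Lun C c) \<cdot>\<^sub>C \<kappa> m n i c"
    by (simp add: mult_run mult_lun n3)
  finally show ?thesis by (simp add: M.interchange_unit)
qed

text \<open>This is \<open>\<kappa>_assoc\<close> for the factors \<open>(m, i)\<close>,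
  \<open>(n, i)\<close>, \<open>(j, c)\<close>, with the unit objects contracted. Together with
  \<open>mult_\<theta>\<close> it gives the compatibility of \<open>\<theta>\<close> with
  multiplicators.\<close>

lemma \<phi>_\<theta>:
  assumes [simp]: "m \<in> Obj M" "n \<in> Obj M" "c \<in> Obj C"
  shows "ActA A (Ide M (m \<otimes>\<^sub>M n)) (Lun C c) \<cdot>\<^sub>C \<kappa> m n i c \<cdot>\<^sub>C (Ide C (ActO A m i) \<odot>\<^sub>C \<theta> n c) \<cdot>\<^sub>C
      Assoc C (ActO A m i) (ActO A n i) c =
    \<theta> (m \<otimes>\<^sub>M n) c \<cdot>\<^sub>C (\<phi> m n \<odot>\<^sub>C Ide C c)"
proof -
  let ?i = "\<lambda>m c. Ide C (ActO A m c)" and ?m = "ActO A m i" and ?n = "ActO A n i"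
  let ?E = "(?i m i \<odot>\<^sub>C ?i n i) \<odot>\<^sub>C Eta A c"
  let ?K = "\<kappa> (m \<otimes>\<^sub>M n) j (i \<otimes>\<^sub>C i) c \<cdot>\<^sub>C (\<kappa> m n i i \<odot>\<^sub>C ?i j c)"
  have n1: "\<kappa> m n i c \<cdot>\<^sub>C (ActA A (Ide M m) (Ide C i) \<odot>\<^sub>C ActA A (Run M n) (Lun C c)) =
      ActA A (Ide M m \<odot>\<^bsub>M\<^esub> Run M n) (Ide C i \<odot>\<^sub>C Lun C c) \<cdot>\<^sub>C \<kappa> m (n \<otimes>\<^sub>M j) i (i \<otimes>\<^sub>C c)"
    by (rule \<kappa>_nat) auto
  have n2: "\<kappa> (m \<otimes>\<^sub>M n) j i c \<cdot>\<^sub>C (ActA A (Ide M (m \<otimes>\<^sub>M n)) (Lun C i) \<odot>\<^sub>C ActA A (Ide M j) (Ide C c)) =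
      ActA A (Ide M (m \<otimes>\<^sub>M n) \<odot>\<^bsub>M\<^esub> Ide M j) (Lun C i \<odot>\<^sub>C Ide C c) \<cdot>\<^sub>C \<kappa> (m \<otimes>\<^sub>M n) j (i \<otimes>\<^sub>C i) c"
    by (rule \<kappa>_nat) auto
  have tri: "(Ide C i \<odot>\<^sub>C Lun C c) \<cdot>\<^sub>C Assoc C i i c = Lun C i \<odot>\<^sub>C Ide C c"
    by (simp add: C.triangle C.lun_unit)
  have "ActA A (Ide M (m \<otimes>\<^sub>M n)) (Lun C c) \<cdot>\<^sub>C \<kappa> m n i c \<cdot>\<^sub>C (?i m i \<odot>\<^sub>C \<theta> n c) \<cdot>\<^sub>C Assoc C ?m ?n c
      = ActA A (Ide M (m \<otimes>\<^sub>M n)) (Lun C c) \<cdot>\<^sub>C (\<kappa> m n i c \<cdot>\<^sub>C (ActA A (Ide M m) (Ide C i) \<odot>\<^sub>C ActA A (Run M n) (Lun C c))) \<cdot>\<^sub>C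
        (?i m i \<odot>\<^sub>C \<kappa> n j i c) \<cdot>\<^sub>C (?i m i \<odot>\<^sub>C ?i n i \<odot>\<^sub>C Eta A c) \<cdot>\<^sub>C Assoc C ?m ?n c"
    by (simp add: \<theta>_def)
  also have "\<dots> = ActA A (Ide M m \<odot>\<^bsub>M\<^esub> Run M n) (Lun C c \<cdot>\<^sub>C (Ide C i \<odot>\<^sub>C Lun C c)) \<cdot>\<^sub>C
        (\<kappa> m (n \<otimes>\<^sub>M j) i (i \<otimes>\<^sub>C c) \<cdot>\<^sub>C (?i m i \<odot>\<^sub>C \<kappa> n j i c) \<cdot>\<^sub>C Assoc C ?m ?n (ActO A j c)) \<cdot>\<^sub>C ?E"
    unfolding n1 by (subst C.assoc_nat[symmetric]) auto
  also have "\<dots> = ActA A (Ide M m \<odot>\<^bsub>M\<^esub> Run M n) (Lun C c \<cdot>\<^sub>C (Ide C i \<odot>\<^sub>C Lun C c)) \<cdot>\<^sub>C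
        ActA A (Assoc M m n j) (Assoc C i i c) \<cdot>\<^sub>C ?K \<cdot>\<^sub>C ?E"
    by (subst \<kappa>_assoc[symmetric]) auto
  also have "\<dots> = ActA A (Run M (m \<otimes>\<^sub>M n)) (Lun C c \<cdot>\<^sub>C (Lun C i \<odot>\<^sub>C Ide C c)) \<cdot>\<^sub>C ?K \<cdot>\<^sub>C ?E"
    by (simp add: M.run_tensor tri)
  also have "\<dots> = ActA A (Run M (m \<otimes>\<^sub>M n)) (Lun C c) \<cdot>\<^sub>C (ActA A (Ide M (m \<otimes>\<^sub>M n) \<odot>\<^bsub>M\<^esub> Ide M j) (Lun C i \<odot>\<^sub>C Ide C c) \<cdot>\<^sub>C
      \<kappa> (m \<otimes>\<^sub>M n) j (i \<otimes>\<^sub>C i) c) \<cdot>\<^sub>C (\<kappa> m n i i \<odot>\<^sub>C ?i j c) \<cdot>\<^sub>C ?E"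
    by simp
  also have "\<dots> = \<theta> (m \<otimes>\<^sub>M n) c \<cdot>\<^sub>C (\<phi> m n \<odot>\<^sub>C Ide C c)"
    unfolding n2[symmetric] by (simp add: \<theta>_def \<phi>_def)
  finally show ?thesis .
qed

text \<open>This is \<open>\<kappa>_interchange\<close> for the factors \<open>(m, i)\<close>,
  \<open>(n, i)\<close>, \<open>(j, c)\<close>, \<open>(j, d)\<close>. The units reduce the
  interchange of \<open>M\<close> to right unitors and that of \<open>C\<close> to left unitors, and
  the two unitors \<open>Eta\<close> of the action combine by \<open>eta_tensor\<close>.\<close>

lemma iota_\<theta>:
  assumes [simp]: "m \<in> Obj M" "n \<in> Obj M" "c \<in> Obj C" "d \<in> Obj C"
  shows "\<kappa> m n c d \<cdot>\<^sub>C (\<theta> m c \<odot>\<^sub>C \<theta> n d) \<cdot>\<^sub>C interchange C (ActO A m i) (ActO A n i) c d =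
    \<theta> (m \<otimes>\<^sub>M n) (c \<otimes>\<^sub>C d) \<cdot>\<^sub>C (\<phi> m n \<odot>\<^sub>C Ide C (c \<otimes>\<^sub>C d))"
proof -
  let ?i = "\<lambda>m c. Ide C (ActO A m c)" and ?m = "ActO A m i" and ?n = "ActO A n i"
  let ?P = "m \<otimes>\<^sub>M n" and ?Q = "c \<otimes>\<^sub>C d"
  let ?K = "\<kappa> ?P (j \<otimes>\<^sub>M j) (i \<otimes>\<^sub>C i) ?Q" and ?E = "Eta A c \<odot>\<^sub>C Eta A d"
  have x: "(Run M m \<odot>\<^bsub>M\<^esub> Run M n) \<cdot>\<^bsub>M\<^esub> interchange M m n j j = Run M ?P \<cdot>\<^bsub>M\<^esub> (Ide M ?P \<odot>\<^bsub>M\<^esub> Lun M j)"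
    by (simp add: M.interchange_run[symmetric])
  have y: "(Lun C c \<odot>\<^sub>C Lun C d) \<cdot>\<^sub>C interchange C i i c d = Lun C ?Q \<cdot>\<^sub>C (Lun C i \<odot>\<^sub>C Ide C ?Q)"
    by (simp add: C.interchange_lun[symmetric])
  have n1: "\<kappa> m n c d \<cdot>\<^sub>C (ActA A (Run M m) (Lun C c) \<odot>\<^sub>C ActA A (Run M n) (Lun C d)) =
      ActA A (Run M m \<odot>\<^bsub>M\<^esub> Run M n) (Lun C c \<odot>\<^sub>C Lun C d) \<cdot>\<^sub>C \<kappa> (m \<otimes>\<^sub>M j) (n \<otimes>\<^sub>M j) (i \<otimes>\<^sub>C c) (i \<otimes>\<^sub>C d)"
    by (rule \<kappa>_nat) auto
  have n2: "\<kappa> ?P j i ?Q \<cdot>\<^sub>C (ActA A (Ide M ?P) (Lun C i) \<odot>\<^sub>C ActA A (Lun M j) (Ide C ?Q)) =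
      ActA A (Ide M ?P \<odot>\<^bsub>M\<^esub> Lun M j) (Lun C i \<odot>\<^sub>C Ide C ?Q) \<cdot>\<^sub>C ?K"
    by (rule \<kappa>_nat) auto
  have n3: "((?i m i \<odot>\<^sub>C Eta A c) \<odot>\<^sub>C (?i n i \<odot>\<^sub>C Eta A d)) \<cdot>\<^sub>C interchange C ?m ?n c d =
      interchange C ?m ?n (ActO A j c) (ActO A j d) \<cdot>\<^sub>C ((?i m i \<odot>\<^sub>C ?i n i) \<odot>\<^sub>C ?E)"
    by (rule C.interchange_natural[symmetric]) auto
  have "\<kappa> m n c d \<cdot>\<^sub>C (\<theta> m c \<odot>\<^sub>C \<theta> n d) \<cdot>\<^sub>C interchange C ?m ?n c d
     = (\<kappa> m n c d \<cdot>\<^sub>C (ActA A (Run M m) (Lun C c) \<odot>\<^sub>C ActA A (Run M n) (Lun C d))) \<cdot>\<^sub>C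
       (\<kappa> m j i c \<odot>\<^sub>C \<kappa> n j i d) \<cdot>\<^sub>C ((?i m i \<odot>\<^sub>C Eta A c) \<odot>\<^sub>C (?i n i \<odot>\<^sub>C Eta A d)) \<cdot>\<^sub>C interchange C ?m ?n c d"
    by (simp add: \<theta>_def)
  also have "\<dots> = ActA A (Run M m \<odot>\<^bsub>M\<^esub> Run M n) (Lun C c \<odot>\<^sub>C Lun C d) \<cdot>\<^sub>C (\<kappa> (m \<otimes>\<^sub>M j) (n \<otimes>\<^sub>M j) (i \<otimes>\<^sub>C c) (i \<otimes>\<^sub>C d) \<cdot>\<^sub>C
       (\<kappa> m j i c \<odot>\<^sub>C \<kappa> n j i d) \<cdot>\<^sub>C interchange C ?m ?n (ActO A j c) (ActO A j d)) \<cdot>\<^sub>C ((?i m i \<odot>\<^sub>C ?i n i) \<odot>\<^sub>C ?E)"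
    unfolding n1 n3 by simp
  also have "\<dots> = ActA A (Run M m \<odot>\<^bsub>M\<^esub> Run M n) (Lun C c \<odot>\<^sub>C Lun C d) \<cdot>\<^sub>C ActA A (interchange M m n j j) (interchange C i i c d) \<cdot>\<^sub>C
       ?K \<cdot>\<^sub>C (\<kappa> m n i i \<odot>\<^sub>C (\<kappa> j j c d \<cdot>\<^sub>C ?E))"
    by (subst \<kappa>_interchange[symmetric]) auto
  also have "\<dots> = ActA A (Run M ?P) (Lun C ?Q) \<cdot>\<^sub>C (ActA A (Ide M ?P \<odot>\<^bsub>M\<^esub> Lun M j) (Lun C i \<odot>\<^sub>C Ide C ?Q) \<cdot>\<^sub>C ?K) \<cdot>\<^sub>C
       (\<kappa> m n i i \<odot>\<^sub>C (\<kappa> j j c d \<cdot>\<^sub>C ?E))"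
    by (simp add: x y)
  also have "\<dots> = \<theta> ?P ?Q \<cdot>\<^sub>C (\<phi> m n \<odot>\<^sub>C Ide C ?Q)"
    unfolding n2[symmetric] by (simp add: \<theta>_def \<phi>_def eta_tensor)
  finally show ?thesis .
qed

end

lemma act_func_simps [simp]:
  "FObj (act_func B) (m, c) = ActO B m c" "FArr (act_func B) (f, h) = ActA B f h"
  by (simp_all add: act_func_def)

lemma restrict_act_simps [simp]:
  "ActO (restrict_act R N C B) m c = ActO B (FObj R m) c"
  "ActA (restrict_act R N C B) f h = ActA B (FArr R f) h"
  "Eta (restrict_act R N C B) c = ActA B (FUnit R) (Ide C c) \<cdot>\<^bsub>C\<^esub> Eta B c"
  "Mult (restrict_act R N C B) m n c = ActA B (FTen R m n) (Ide C c) \<cdot>\<^bsub>C\<^esub> Mult B (FObj R m) (FObj R n) c"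
  "Iota (restrict_act R N C B) m n c d =
    Iota B (FObj R m) (FObj R n) c d \<cdot>\<^bsub>C\<^esub> ActA B (inv_arr N (FTen R m n)) (Ide C (c \<otimes>\<^bsub>C\<^esub> d))"
  by (simp_all add: restrict_act_def)

section \<open>The classifying functor\<close>

context braided_action
begin

lemmas braided_C [simp] = C.braided_monoidal_category_axioms

text \<open>
  \<open>m \<bullet> i\<close> braids trivially with \<open>j \<bullet> d\<close>, since \<open>\<sigma>\<close> is a symmetry and \<open>i\<close> is central; now transport
  along \<open>\<eta>\<close>.
\<close>

lemma actO_unit_center [simp]:
  assumes [simp]: "m \<in> Obj M"
  shows "ActO A m i \<in> sym_center_obj C"
proof (rule sym_center_objI[OF braided_C])
  fix d assume [simp]: "d \<in> Obj C"
  let ?m = "ActO A m i" and ?d = "ActO A j d" and ?B = "Braid C"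
  have "\<kappa> m j i d \<cdot>\<^sub>C ?B ?d ?m \<cdot>\<^sub>C ?B ?m ?d = ActA A (Braid M j m) (?B d i) \<cdot>\<^sub>C \<kappa> j m d i \<cdot>\<^sub>C ?B ?m ?d"
    by (rule C.comp_chain2[OF \<kappa>_braid[symmetric]]) auto
  also have "\<dots> = ActA A (Braid M j m) (?B d i) \<cdot>\<^sub>C ActA A (Braid M m j) (?B i d) \<cdot>\<^sub>C \<kappa> m j i d"
    by (simp add: \<kappa>_braid[symmetric] del: actA_merge_chain)
  also have "\<dots> = \<kappa> m j i d \<cdot>\<^sub>C Ide C (?m \<otimes>\<^sub>C ?d)"
    by (simp add: M.symmetry C.braid_unit_symmetric)
  finally have *: "?B ?d ?m \<cdot>\<^sub>C ?B ?m ?d = Ide C (?m \<otimes>\<^sub>C ?d)"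
    by (rule C.iso_cancel_left[rotated]) auto
  have "(Ide C ?m \<odot>\<^sub>C Eta A d) \<cdot>\<^sub>C ?B d ?m \<cdot>\<^sub>C ?B ?m d = ?B ?d ?m \<cdot>\<^sub>C (Eta A d \<odot>\<^sub>C Ide C ?m) \<cdot>\<^sub>C ?B ?m d"
    by (rule C.comp_chain2[OF C.braid_nat[symmetric]]) auto
  also have "\<dots> = ?B ?d ?m \<cdot>\<^sub>C ?B ?m ?d \<cdot>\<^sub>C (Ide C ?m \<odot>\<^sub>C Eta A d)"
    by (simp add: C.braid_nat[symmetric])
  also have "\<dots> = (Ide C ?m \<odot>\<^sub>C Eta A d) \<cdot>\<^sub>C Ide C (?m \<otimes>\<^sub>C d)"
    by (simp add: C.comp_chain[OF *])
  finally show "?B d ?m \<cdot>\<^sub>C ?B ?m d = Ide C (?m \<otimes>\<^sub>C d)"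
    by (rule C.iso_cancel_left[rotated]) auto
qed simp

definition classifier :: "('m, 'f, 'o, 'a, 'o, 'a) act_mor" where
  "classifier = \<lparr>FObj = (\<lambda>m. ActO A m i), FArr = (\<lambda>f. ActA A f (Ide C i)), FUnit = Eta A i, FTen = \<phi>, Theta = \<theta>\<rparr>"

lemma classifier_simps [simp]:
  "FObj classifier m = ActO A m i" "FArr classifier f = ActA A f (Ide C i)" "FUnit classifier = Eta A i"
  "FTen classifier m n = \<phi> m n" "Theta classifier = \<theta>"
  by (simp_all add: classifier_def)

text \<open>Associativity of \<open>\<kappa>\<close> at unit objects; the two contractions of a
  threefold product of \<open>i\<close> agree because left and right unitor of \<open>i\<close>
  do.\<close>

lemma \<phi>_assoc:
  assumes [simp]: "m \<in> Obj M" "n \<in> Obj M" "p \<in> Obj M"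
  shows "ActA A (Assoc M m n p) (Ide C i) \<cdot>\<^sub>C \<phi> (m \<otimes>\<^sub>M n) p \<cdot>\<^sub>C (\<phi> m n \<odot>\<^sub>C Ide C (ActO A p i)) =
    \<phi> m (n \<otimes>\<^sub>M p) \<cdot>\<^sub>C (Ide C (ActO A m i) \<odot>\<^sub>C \<phi> n p) \<cdot>\<^sub>C Assoc C (ActO A m i) (ActO A n i) (ActO A p i)"
proof -
  let ?i = "Ide C i" and ?mi = "Ide C (ActO A m i)" and ?pi = "Ide C (ActO A p i)"
  let ?A = "Assoc C (ActO A m i) (ActO A n i) (ActO A p i)"
  have n1: "\<kappa> (m \<otimes>\<^sub>M n) p i i \<cdot>\<^sub>C (ActA A (Ide M (m \<otimes>\<^sub>M n)) (Lun C i) \<odot>\<^sub>C ActA A (Ide M p) ?i) =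
      ActA A (Ide M (m \<otimes>\<^sub>M n) \<odot>\<^bsub>M\<^esub> Ide M p) (Lun C i \<odot>\<^sub>C ?i) \<cdot>\<^sub>C \<kappa> (m \<otimes>\<^sub>M n) p (i \<otimes>\<^sub>C i) i"
    by (rule \<kappa>_nat) auto
  have n2: "\<kappa> m (n \<otimes>\<^sub>M p) i i \<cdot>\<^sub>C (ActA A (Ide M m) ?i \<odot>\<^sub>C ActA A (Ide M (n \<otimes>\<^sub>M p)) (Lun C i)) =
      ActA A (Ide M m \<odot>\<^bsub>M\<^esub> Ide M (n \<otimes>\<^sub>M p)) (?i \<odot>\<^sub>C Lun C i) \<cdot>\<^sub>C \<kappa> m (n \<otimes>\<^sub>M p) i (i \<otimes>\<^sub>C i)"
    by (rule \<kappa>_nat) auto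
  have tri: "(?i \<odot>\<^sub>C Lun C i) \<cdot>\<^sub>C Assoc C i i i = Lun C i \<odot>\<^sub>C ?i"
    using C.triangle[of i i] by (simp add: C.lun_unit)
  have "\<phi> m (n \<otimes>\<^sub>M p) \<cdot>\<^sub>C (?mi \<odot>\<^sub>C \<phi> n p) \<cdot>\<^sub>C ?A =
      ActA A (Ide M (m \<otimes>\<^sub>M n \<otimes>\<^sub>M p)) (Lun C i) \<cdot>\<^sub>C (\<kappa> m (n \<otimes>\<^sub>M p) i i \<cdot>\<^sub>C
      (ActA A (Ide M m) ?i \<odot>\<^sub>C ActA A (Ide M (n \<otimes>\<^sub>M p)) (Lun C i))) \<cdot>\<^sub>C (?mi \<odot>\<^sub>C \<kappa> n p i i) \<cdot>\<^sub>C ?A"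
    by (simp add: \<phi>_def)
  also have "\<dots> = ActA A (Ide M (m \<otimes>\<^sub>M n \<otimes>\<^sub>M p)) (Lun C i \<cdot>\<^sub>C (?i \<odot>\<^sub>C Lun C i)) \<cdot>\<^sub>C
      \<kappa> m (n \<otimes>\<^sub>M p) i (i \<otimes>\<^sub>C i) \<cdot>\<^sub>C (?mi \<odot>\<^sub>C \<kappa> n p i i) \<cdot>\<^sub>C ?A"
    unfolding n2 by simp
  also have "\<dots> = ActA A (Assoc M m n p) (Lun C i \<cdot>\<^sub>C (Lun C i \<odot>\<^sub>C ?i)) \<cdot>\<^sub>C
      \<kappa> (m \<otimes>\<^sub>M n) p (i \<otimes>\<^sub>C i) i \<cdot>\<^sub>C (\<kappa> m n i i \<odot>\<^sub>C ?pi)"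
    by (subst \<kappa>_assoc[symmetric]) (auto simp: tri)
  also have "\<dots> = ActA A (Assoc M m n p) (Lun C i) \<cdot>\<^sub>C (ActA A (Ide M (m \<otimes>\<^sub>M n) \<odot>\<^bsub>M\<^esub> Ide M p) (Lun C i \<odot>\<^sub>C ?i) \<cdot>\<^sub>C
      \<kappa> (m \<otimes>\<^sub>M n) p (i \<otimes>\<^sub>C i) i) \<cdot>\<^sub>C (\<kappa> m n i i \<odot>\<^sub>C ?pi)"
    by simp
  also have "\<dots> = ActA A (Assoc M m n p) ?i \<cdot>\<^sub>C \<phi> (m \<otimes>\<^sub>M n) p \<cdot>\<^sub>C (\<phi> m n \<odot>\<^sub>C ?pi)"
    unfolding n1[symmetric] by (simp add: \<phi>_def)
  finally show ?thesis by simp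
qed

lemma \<phi>_nat:
  assumes [simp]: "f \<in> Arr M" "g \<in> Arr M"
  shows "ActA A (f \<odot>\<^bsub>M\<^esub> g) (Ide C i) \<cdot>\<^sub>C \<phi> (Dom M f) (Dom M g) =
    \<phi> (Cod M f) (Cod M g) \<cdot>\<^sub>C (ActA A f (Ide C i) \<odot>\<^sub>C ActA A g (Ide C i))"
  by (simp add: \<phi>_def \<kappa>_nat)

text \<open>The braiding of \<open>i\<close> with itself, which \<open>\<kappa>_braid\<close>
  introduces, is absorbed by the unitor: \<open>lun_braid\<close> turns \<open>Lun\<close> into
  \<open>Run\<close>, and at \<open>i\<close> these are equal.\<close>

lemma \<phi>_braid:
  assumes [simp]: "m \<in> Obj M" "n \<in> Obj M"
  shows "ActA A (Braid M m n) (Ide C i) \<cdot>\<^sub>C \<phi> m n = \<phi> n m \<cdot>\<^sub>C Braid C (ActO A m i) (ActO A n i)"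
  by (simp add: \<phi>_def \<kappa>_braid[symmetric] C.lun_braid) (simp add: C.lun_unit)

lemma classifier_braided: "strong_braided_monoidal_functor M (sym_center C) classifier"
proof -
  interpret S: symmetric_monoidal_category "sym_center C"
    by (rule symmetric_sym_center[OF braided_C])
  have run: "ActA A (Run M m) (Ide C i) \<cdot>\<^sub>C \<phi> m j \<cdot>\<^sub>C (Ide C (ActO A m i) \<odot>\<^sub>C Eta A i) = Run C (ActO A m i)"
    if [simp]: "m \<in> Obj M" for m
    using \<kappa>_run[of m i] by (simp add: \<phi>_def C.lun_unit)
  have lun: "ActA A (Lun M m) (Ide C i) \<cdot>\<^sub>C \<phi> j m \<cdot>\<^sub>C (Eta A i \<odot>\<^sub>C Ide C (ActO A m i)) = Lun C (ActO A m i)"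
    if [simp]: "m \<in> Obj M" for m
    using \<kappa>_lun[of m i] by (simp add: \<phi>_def)
  interpret strong_monoidal_functor M "sym_center C" classifier
    by (rule strong_monoidal_functorI[OF M.monoidal_category_axioms S.monoidal_category_axioms])
      (simp_all add: \<phi>_nat \<phi>_assoc run lun)
  show ?thesis
    by unfold_locales (simp add: \<phi>_braid)
qed

text \<open>Compatibility with unitors is \<open>\<theta>_unit\<close>, with multiplicators
  \<open>mult_\<theta>\<close> followed by \<open>\<phi>_\<theta>\<close>, and with interchangers
  \<open>iota_\<theta>\<close> after moving \<open>\<kappa>\<close> and \<open>\<phi>\<close> across
  as inverses.\<close>

lemma classifier_morphism: "act_morphism C M A (sym_center C) (sym_center_act C) classifier"
proof -
  let ?R = "restrict_act classifier (sym_center C) C (sym_center_act C)"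
  have func: "cat_functor (prod_cat M C) C (act_func ?R)"
    by (rule cat_functorI[OF category_prod_cat[OF M.category_axioms C.category_axioms] C.category_axioms]) auto
  have "natural_isomorphism (prod_cat M C) C (act_func ?R) (act_func A) (\<lambda>(m, c). \<theta> m c)"
    by (intro natural_isomorphism.intro natural_isomorphism_axioms.intro
        natural_transformationI[OF func act_func.cat_functor_axioms]) (auto simp: \<theta>_nat)
  moreover have "\<theta> j c \<cdot>\<^sub>C Eta ?R c = Eta A c" if "c \<in> Obj C" for c
    using that C.comp_chain2[OF \<theta>_unit] by simp
  moreover have "\<theta> (m \<otimes>\<^sub>M n) c \<cdot>\<^sub>C Mult ?R m n c = Mult A m n c \<cdot>\<^sub>C ActA A (Ide M m) (\<theta> n c) \<cdot>\<^sub>C \<theta> m (ActO ?R n c)"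
    if [simp]: "m \<in> Obj M" "n \<in> Obj M" "c \<in> Obj C" for m n c
  proof -
    let ?A = "Assoc C (ActO A m i) (ActO A n i) c"
    \<comment> \<open>Naturality in the second argument pulls \<open>\<theta> n c\<close> out to the
      right, so that \<open>\<theta> m\<close> stands directly behind \<open>Mult\<close> as in
      \<open>mult_\<theta>\<close>.\<close>
    have "Mult A m n c \<cdot>\<^sub>C ActA A (Ide M m) (\<theta> n c) \<cdot>\<^sub>C \<theta> m (ActO ?R n c)
        = Mult A m n c \<cdot>\<^sub>C \<theta> m (ActO A n c) \<cdot>\<^sub>C (Ide C (ActO A m i) \<odot>\<^sub>C \<theta> n c)"
      using \<theta>_nat[of "Ide M m" "\<theta> n c" m m "ActO A n i \<otimes>\<^sub>C c" "ActO A n c"] by simp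
    also have "\<dots> = (ActA A (Ide M (m \<otimes>\<^sub>M n)) (Lun C c) \<cdot>\<^sub>C \<kappa> m n i c \<cdot>\<^sub>C (Ide C (ActO A m i) \<odot>\<^sub>C \<theta> n c) \<cdot>\<^sub>C ?A) \<cdot>\<^sub>C inv_arr C ?A"
      by (subst C.comp_chain[OF mult_\<theta>]) auto
    also have "\<dots> = \<theta> (m \<otimes>\<^sub>M n) c \<cdot>\<^sub>C Mult ?R m n c"
      by (subst \<phi>_\<theta>) auto
    finally show ?thesis by simp
  qed
  moreover have "(\<theta> m c \<odot>\<^sub>C \<theta> n d) \<cdot>\<^sub>C Iota ?R m n c d = Iota A m n c d \<cdot>\<^sub>C \<theta> (m \<otimes>\<^sub>M n) (c \<otimes>\<^sub>C d)"
    if [simp]: "m \<in> Obj M" "n \<in> Obj M" "c \<in> Obj C" "d \<in> Obj C" for m n c d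
  proof -
    let ?int = "interchange C (ActO A m i) (ActO A n i) c d" and ?\<phi> = "\<phi> m n \<odot>\<^sub>C Ide C (c \<otimes>\<^sub>C d)"
    have "(\<theta> m c \<odot>\<^sub>C \<theta> n d) \<cdot>\<^sub>C ?int = Iota A m n c d \<cdot>\<^sub>C \<theta> (m \<otimes>\<^sub>M n) (c \<otimes>\<^sub>C d) \<cdot>\<^sub>C ?\<phi>"
      unfolding iota_\<theta>[OF that, symmetric] by (simp add: \<kappa>_def)
    then have "((\<theta> m c \<odot>\<^sub>C \<theta> n d) \<cdot>\<^sub>C ?int) \<cdot>\<^sub>C inv_arr C ?\<phi> = (Iota A m n c d \<cdot>\<^sub>C \<theta> (m \<otimes>\<^sub>M n) (c \<otimes>\<^sub>C d) \<cdot>\<^sub>C ?\<phi>) \<cdot>\<^sub>C inv_arr C ?\<phi>"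
      by simp
    then show ?thesis by (simp add: C.inv_tensor)
  qed
  ultimately show ?thesis
    unfolding act_morphism_def action_isomorphism_def by (simp add: classifier_braided)
qed

end

section \<open>Hom-categories of braided actions\<close>

lemma monoidal_transformationI:
  assumes "strong_monoidal_functor C D F" "strong_monoidal_functor C D G"
    and "\<And>x. x \<in> Obj C \<Longrightarrow> \<tau> x \<in> Arr D \<and> Dom D (\<tau> x) = FObj F x \<and> Cod D (\<tau> x) = FObj G x"
    and "\<And>f. f \<in> Arr C \<Longrightarrow> FArr G f \<cdot>\<^bsub>D\<^esub> \<tau> (Dom C f) = \<tau> (Cod C f) \<cdot>\<^bsub>D\<^esub> FArr F f"
    and "\<tau> (Unit C) \<cdot>\<^bsub>D\<^esub> FUnit F = FUnit G"
    and "\<And>x y. x \<in> Obj C \<Longrightarrow> y \<in> Obj C \<Longrightarrow>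
      \<tau> (x \<otimes>\<^bsub>C\<^esub> y) \<cdot>\<^bsub>D\<^esub> FTen F x y = FTen G x y \<cdot>\<^bsub>D\<^esub> (\<tau> x \<odot>\<^bsub>D\<^esub> \<tau> y)"
  shows "monoidal_transformation C D F G \<tau>"
  by (intro monoidal_transformation.intro monoidal_transformation_axioms.intro natural_transformationI
      strong_monoidal_functor.axioms(3) assms)

lemma id_monoidal_transformation:
  assumes "strong_monoidal_functor C D F"
  shows "monoidal_transformation C D F F (\<lambda>x\<in>Obj C. Ide D (FObj F x))"
proof -
  interpret F: strong_monoidal_functor C D F by fact
  show ?thesis by (rule monoidal_transformationI) (simp_all add: assms)
qed

lemma comp_monoidal_transformation:
  assumes "monoidal_transformation C D F G \<sigma>" "monoidal_transformation C D G H \<tau>"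
  shows "monoidal_transformation C D F H (\<lambda>x\<in>Obj C. \<tau> x \<cdot>\<^bsub>D\<^esub> \<sigma> x)"
proof -
  interpret \<sigma>: monoidal_transformation C D F G \<sigma> by fact
  interpret \<tau>: monoidal_transformation C D G H \<tau> by fact
  let ?\<upsilon> = "\<lambda>x\<in>Obj C. \<tau> x \<cdot>\<^bsub>D\<^esub> \<sigma> x"
  show ?thesis
  proof (rule monoidal_transformationI)
    fix f assume [simp]: "f \<in> Arr C"
    show "FArr H f \<cdot>\<^bsub>D\<^esub> ?\<upsilon> (Dom C f) = ?\<upsilon> (Cod C f) \<cdot>\<^bsub>D\<^esub> FArr F f"
      by (simp add: \<sigma>.nat \<sigma>.F.D.comp_chain2[OF \<tau>.nat])
  next
    fix x y assume [simp]: "x \<in> Obj C" "y \<in> Obj C"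
    show "?\<upsilon> (x \<otimes>\<^bsub>C\<^esub> y) \<cdot>\<^bsub>D\<^esub> FTen F x y =
      FTen H x y \<cdot>\<^bsub>D\<^esub> (?\<upsilon> x \<odot>\<^bsub>D\<^esub> ?\<upsilon> y)"
      by (simp add: \<sigma>.trans_tensor \<sigma>.F.D.comp_chain2[OF \<tau>.trans_tensor])
  qed (simp_all add: \<sigma>.F.strong_monoidal_functor_axioms \<tau>.G.strong_monoidal_functor_axioms \<sigma>.trans_unit \<tau>.trans_unit)
qed

lemma inv_monoidal_transformation:
  assumes "monoidal_transformation C D F G \<tau>" and iso [simp]: "\<And>x. x \<in> Obj C \<Longrightarrow> iso D (\<tau> x)"
  shows "monoidal_transformation C D G F (\<lambda>x\<in>Obj C. inv_arr D (\<tau> x))"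
proof -
  interpret \<tau>: monoidal_transformation C D F G \<tau> by fact
  let ?\<upsilon> = "\<lambda>x\<in>Obj C. inv_arr D (\<tau> x)"
  show ?thesis
  proof (rule monoidal_transformationI)
    fix f assume [simp]: "f \<in> Arr C"
    show "FArr F f \<cdot>\<^bsub>D\<^esub> ?\<upsilon> (Dom C f) = ?\<upsilon> (Cod C f) \<cdot>\<^bsub>D\<^esub> FArr G f"
      using \<tau>.F.D.inv_natural[of "\<tau> (Dom C f)" "\<tau> (Cod C f)" "FArr G f" "FArr F f"] by (simp add: \<tau>.nat)
  next
    have "inv_arr D (\<tau> (Unit C)) \<cdot>\<^bsub>D\<^esub> \<tau> (Unit C) \<cdot>\<^bsub>D\<^esub> FUnit F = FUnit F" by simp
    then show "?\<upsilon> (Unit C) \<cdot>\<^bsub>D\<^esub> FUnit G = FUnit F"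
      by (simp add: \<tau>.trans_unit)
  next
    fix x y assume [simp]: "x \<in> Obj C" "y \<in> Obj C"
    have "FTen F x y \<cdot>\<^bsub>D\<^esub> inv_arr D (\<tau> x \<odot>\<^bsub>D\<^esub> \<tau> y) = inv_arr D (\<tau> (x \<otimes>\<^bsub>C\<^esub> y)) \<cdot>\<^bsub>D\<^esub> FTen G x y"
      by (rule \<tau>.F.D.inv_natural) (auto simp: \<tau>.trans_tensor)
    then show "?\<upsilon> (x \<otimes>\<^bsub>C\<^esub> y) \<cdot>\<^bsub>D\<^esub> FTen G x y =
      FTen F x y \<cdot>\<^bsub>D\<^esub> (?\<upsilon> x \<odot>\<^bsub>D\<^esub> ?\<upsilon> y)"
      by (simp add: \<tau>.F.D.inv_tensor)
  qed (simp_all add: \<tau>.F.strong_monoidal_functor_axioms \<tau>.G.strong_monoidal_functor_axioms)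
qed

lemma act_morphism_theta:
  assumes "act_morphism C M A N B R" "m \<in> Obj M" "c \<in> Obj C"
  shows "Theta R m c \<in> Arr C" "Dom C (Theta R m c) = ActO B (FObj R m) c" "Cod C (Theta R m c) = ActO A m c"
    "iso C (Theta R m c)"
proof -
  interpret natural_isomorphism "prod_cat M C" C "act_func (restrict_act R N C B)" "act_func A" "\<lambda>(m, c). Theta R m c"
    using assms(1) by (simp add: act_morphism_def action_isomorphism_def)
  show "Theta R m c \<in> Arr C" "Dom C (Theta R m c) = ActO B (FObj R m) c" "Cod C (Theta R m c) = ActO A m c"
    "iso C (Theta R m c)"
    using component_simps[of "(m, c)"] component_iso[of "(m, c)"] assms(2,3) by simp_all
qed

section \<open>The category of morphisms between two braided actions\<close>

context
  fixes C :: "('o, 'a) brmoncat" and M :: "('m, 'f) brmoncat" and A :: "('m, 'f, 'o, 'a) act"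
    and N :: "('n, 'g) brmoncat" and B :: "('n, 'g, 'o, 'a) act"
  assumes B: "braided_action N C B"
begin

interpretation B: braided_action N C B by (rule B)

lemma id_2cell:
  assumes R: "act_morphism C M A N B R"
  shows "act_2cell C M N B R R (\<lambda>m\<in>Obj M. Ide N (FObj R m))"
proof -
  interpret R: strong_braided_monoidal_functor M N R using R by (simp add: act_morphism_def)
  show ?thesis unfolding act_2cell_def
    by (simp add: id_monoidal_transformation R.strong_monoidal_functor_axioms act_morphism_theta[OF R])
qed

lemma comp_2cell:
  assumes R: "act_morphism C M A N B R" and S: "act_morphism C M A N B S" and T: "act_morphism C M A N B T"
    and \<sigma>: "act_2cell C M N B R S \<sigma>" and \<tau>: "act_2cell C M N B S T \<tau>"
  shows "act_2cell C M N B R T (\<lambda>m\<in>Obj M. \<tau> m \<cdot>\<^bsub>N\<^esub> \<sigma> m)"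
proof -
  interpret \<sigma>: monoidal_transformation M N R S \<sigma> using \<sigma> by (simp add: act_2cell_def)
  interpret \<tau>: monoidal_transformation M N S T \<tau> using \<tau> by (simp add: act_2cell_def)
  have "Theta T m c \<cdot>\<^bsub>C\<^esub> ActA B (\<tau> m \<cdot>\<^bsub>N\<^esub> \<sigma> m) (Ide C c) = Theta R m c" if [simp]: "m \<in> Obj M" "c \<in> Obj C" for m c
  proof -
    have "Theta T m c \<cdot>\<^bsub>C\<^esub> ActA B (\<tau> m \<cdot>\<^bsub>N\<^esub> \<sigma> m) (Ide C c) = (Theta T m c \<cdot>\<^bsub>C\<^esub> ActA B (\<tau> m) (Ide C c)) \<cdot>\<^bsub>C\<^esub> ActA B (\<sigma> m) (Ide C c)"
      by (simp add: act_morphism_theta[OF T])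
    also have "\<dots> = Theta R m c" using \<sigma> \<tau> by (simp add: act_2cell_def)
    finally show ?thesis .
  qed
  then show ?thesis unfolding act_2cell_def
    using comp_monoidal_transformation[OF \<sigma>.monoidal_transformation_axioms \<tau>.monoidal_transformation_axioms] by simp
qed

lemma inv_2cell:
  assumes R: "act_morphism C M A N B R" and S: "act_morphism C M A N B S" and \<tau>: "act_2cell C M N B R S \<tau>"
    and iso [simp]: "\<And>m. m \<in> Obj M \<Longrightarrow> iso N (\<tau> m)"
  shows "act_2cell C M N B S R (\<lambda>m\<in>Obj M. inv_arr N (\<tau> m))"
proof -
  interpret \<tau>: monoidal_transformation M N R S \<tau> using \<tau> by (simp add: act_2cell_def)
  have "Theta R m c \<cdot>\<^bsub>C\<^esub> ActA B (inv_arr N (\<tau> m)) (Ide C c) = Theta S m c" if [simp]: "m \<in> Obj M" "c \<in> Obj C" for m c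
  proof -
    have "Theta R m c = Theta S m c \<cdot>\<^bsub>C\<^esub> ActA B (\<tau> m) (Ide C c)" using \<tau> by (simp add: act_2cell_def)
    then show ?thesis by (simp add: act_morphism_theta[OF S])
  qed
  then show ?thesis unfolding act_2cell_def
    using inv_monoidal_transformation[OF \<tau>.monoidal_transformation_axioms iso] by simp
qed

lemma act_hom_cat_simps:
  "Obj (act_hom_cat C M A N B) = {R. act_morphism C M A N B R}"
  "(R, S, \<tau>) \<in> Arr (act_hom_cat C M A N B) \<longleftrightarrow> act_morphism C M A N B R \<and> act_morphism C M A N B S \<and>
               act_2cell C M N B R S \<tau> \<and> \<tau> \<in> extensional (Obj M)"
  "Dom (act_hom_cat C M A N B) (R, S, \<tau>) = R"
  "Cod (act_hom_cat C M A N B) (R, S, \<tau>) = S"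
  "Ide (act_hom_cat C M A N B) R = (R, R, \<lambda>m\<in>Obj M. Ide N (FObj R m))"
  "(S', T, \<upsilon>) \<cdot>\<^bsub>act_hom_cat C M A N B\<^esub> (R, S, \<tau>) = (R, T, \<lambda>m\<in>Obj M. \<upsilon> m \<cdot>\<^bsub>N\<^esub> \<tau> m)"
  by (simp_all add: act_hom_cat_def)

lemma act_2cell_component:
  assumes "act_2cell C M N B R S \<tau>" "m \<in> Obj M"
  shows "\<tau> m \<in> Arr N" "Dom N (\<tau> m) = FObj R m" "Cod N (\<tau> m) = FObj S m"
proof -
  interpret \<tau>: monoidal_transformation M N R S \<tau> using assms by (simp add: act_2cell_def)
  show "\<tau> m \<in> Arr N" "Dom N (\<tau> m) = FObj R m" "Cod N (\<tau> m) = FObj S m" using assms by simp_all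
qed

lemma category_act_hom_cat: "category (act_hom_cat C M A N B)"
proof
  let ?H = "act_hom_cat C M A N B"
  fix f g h :: "('m, 'f, 'n, 'g, 'o, 'a) act_mor \<times> ('m, 'f, 'n, 'g, 'o, 'a) act_mor \<times> ('m \<Rightarrow> 'g)" and a b c d
  show "f \<in> Arr ?H \<Longrightarrow> Dom ?H f \<in> Obj ?H" "f \<in> Arr ?H \<Longrightarrow> Cod ?H f \<in> Obj ?H"
    by (cases f; simp add: act_hom_cat_simps)+
  show "a \<in> Obj ?H \<Longrightarrow> Ide ?H a \<in> hom ?H a a"
    by (simp add: hom_def act_hom_cat_simps id_2cell)
  show "f \<in> hom ?H a b \<Longrightarrow> g \<in> hom ?H b c \<Longrightarrow> g \<cdot>\<^bsub>?H\<^esub> f \<in> hom ?H a c"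
    by (cases f; cases g) (auto simp: hom_def act_hom_cat_simps comp_2cell)
  \<comment> \<open>Composites are restricted to the objects of \<open>M\<close>; extensionality of
    \<open>f\<close> makes the restriction invisible.\<close>
  show "f \<in> hom ?H a b \<Longrightarrow> Ide ?H b \<cdot>\<^bsub>?H\<^esub> f = f" "f \<in> hom ?H a b \<Longrightarrow> f \<cdot>\<^bsub>?H\<^esub> Ide ?H a = f"
    by (cases f; auto simp: hom_def act_hom_cat_simps act_2cell_component intro!: extensionalityI[of _ "Obj M"])+
  show "f \<in> hom ?H a b \<Longrightarrow> g \<in> hom ?H b c \<Longrightarrow> h \<in> hom ?H c d \<Longrightarrow>
      (h \<cdot>\<^bsub>?H\<^esub> g) \<cdot>\<^bsub>?H\<^esub> f = h \<cdot>\<^bsub>?H\<^esub> (g \<cdot>\<^bsub>?H\<^esub> f)"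
    by (cases f; cases g; cases h) (auto simp: hom_def act_hom_cat_simps act_2cell_component intro!: restrict_ext)
qed

text \<open>The pointwise inverse of a 2-cell is again monoidal and compatible with the
  identifications, so invertibility can be tested on components.\<close>

lemma iso_act_hom_cat:
  assumes "(R, S, \<tau>) \<in> Arr (act_hom_cat C M A N B)" and iso: "\<And>m. m \<in> Obj M \<Longrightarrow> iso N (\<tau> m)"
  shows "iso (act_hom_cat C M A N B) (R, S, \<tau>)"
proof -
  from assms(1) have R: "act_morphism C M A N B R" and S: "act_morphism C M A N B S"
    and \<tau>: "act_2cell C M N B R S \<tau>" and ext: "\<tau> \<in> extensional (Obj M)"
    by (simp_all add: act_hom_cat_simps)
  have "inverse_arrows (act_hom_cat C M A N B) (R, S, \<tau>) (S, R, \<lambda>m\<in>Obj M. inv_arr N (\<tau> m))"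
    using R S \<tau> ext inv_2cell[OF R S \<tau> iso]
    by (auto simp: inverse_arrows_def hom_def act_hom_cat_simps act_2cell_component[OF \<tau>] iso intro!: restrict_ext)
  then show ?thesis by (auto simp: iso_def)
qed

end

text \<open>The unique arrows to \<open>F\<close> form a natural isomorphism from the identity to
  the constant functor at \<open>F\<close>. Naturality is automatic, because the two sides of each
  square are arrows with target \<open>F\<close>.\<close>

lemma equivalent_one_cat:
  assumes "category H" "F \<in> Obj H"
    and "\<And>G. G \<in> Obj H \<Longrightarrow> \<exists>\<tau>. hom H G F = {\<tau>} \<and> iso H \<tau>"
  shows "equivalent_categories H one_cat"
proof -
  interpret H: category H by fact
  from assms(3) obtain \<tau> where \<tau>: "\<And>G. G \<in> Obj H \<Longrightarrow> hom H G F = {\<tau> G}" and iso: "\<And>G. G \<in> Obj H \<Longrightarrow> iso H (\<tau> G)"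
    by metis
  have one: "category one_cat" by unfold_locales (auto simp: one_cat_def hom_def)
  let ?K = "\<lparr>FObj = \<lambda>_. (), FArr = \<lambda>_. ()\<rparr>" and ?L = "\<lparr>FObj = \<lambda>_. F, FArr = \<lambda>_. Ide H F\<rparr>"
  have K: "cat_functor H one_cat ?K"
    by (rule cat_functorI[OF assms(1) one]) (auto simp: one_cat_def)
  have L: "cat_functor one_cat H ?L"
    by (rule cat_functorI[OF one assms(1)]) (auto simp: assms(2))
  have LK: "cat_functor H H (comp_func ?L ?K)"
    by (rule cat_functorI[OF assms(1) assms(1)]) (auto simp: comp_func_def assms(2))
  have KL: "cat_functor one_cat one_cat (comp_func ?K ?L)"
    by (rule cat_functorI[OF one one]) (auto simp: comp_func_def one_cat_def)
  have idH: "cat_functor H H id_func" and id1: "cat_functor one_cat one_cat id_func"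
    by (auto intro!: cat_functorI assms one simp: id_func_def)
  have \<tau>_hom: "\<tau> G \<in> Arr H" "Dom H (\<tau> G) = G" "Cod H (\<tau> G) = F" if "G \<in> Obj H" for G
    using \<tau>[OF that] by (auto simp: hom_def)
  have \<tau>_nat: "\<tau> (Cod H f) \<cdot>\<^bsub>H\<^esub> f = \<tau> (Dom H f)" if [simp]: "f \<in> Arr H" for f
  proof -
    have "\<tau> (Cod H f) \<cdot>\<^bsub>H\<^esub> f \<in> hom H (Dom H f) F" by (simp add: hom_def \<tau>_hom)
    then show ?thesis by (simp add: \<tau>)
  qed
  have "natural_isomorphism H H id_func (comp_func ?L ?K) \<tau>"
    by (intro natural_isomorphism.intro natural_isomorphism_axioms.intro natural_transformationI idH LK)
      (simp_all add: iso id_func_def comp_func_def \<tau>_hom \<tau>_nat)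
  moreover have "natural_isomorphism one_cat one_cat (comp_func ?K ?L) id_func (\<lambda>_. ())"
    by (intro natural_isomorphism.intro natural_isomorphism_axioms.intro natural_transformationI id1 KL)
      (auto simp: iso_def inverse_arrows_def hom_def one_cat_def)
  ultimately show ?thesis
    unfolding equivalent_categories_def using K L by blast
qed

section \<open>Terminality\<close>

context
  fixes C :: "('o, 'a) brmoncat" (structure)
  assumes braided: "braided_monoidal_category C"
begin

interpretation braided_monoidal_category C by (rule braided)

lemma sym_center_isoD:
  assumes "iso (sym_center C) f"
  shows "iso C f" "inv_arr (sym_center C) f = inv_arr C f"
proof -
  show *: "iso C f" using assms by (auto simp: iso_def inverse_arrows_def hom_def)
  have "Dom C f \<in> sym_center_obj C" "Cod C f \<in> sym_center_obj C"
    using assms by (auto simp: iso_def inverse_arrows_def hom_def)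
  then show "inv_arr (sym_center C) f = inv_arr C f" using * braided by simp
qed

end

section \<open>Comparison of an arbitrary morphism into the center with the classifier\<close>

locale action_morphism_to_center = braided_action M C A
  for M :: "('m, 'f) brmoncat" and C :: "('o, 'a) brmoncat" and A :: "('m, 'f, 'o, 'a) act" +
  fixes G :: "('m, 'f, 'o, 'a, 'o, 'a) act_mor"
  assumes morphism: "act_morphism C M A (sym_center C) (sym_center_act C) G"
begin

abbreviation "T \<equiv> Theta G"

sublocale G: strong_braided_monoidal_functor M "sym_center C" G
  using morphism by (simp add: act_morphism_def)

lemma G_simps [simp]:
  "m \<in> Obj M \<Longrightarrow> FObj G m \<in> sym_center_obj C"
  "m \<in> Obj M \<Longrightarrow> FObj G m \<in> Obj C"
  "f \<in> Arr M \<Longrightarrow> FArr G f \<in> Arr C"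
  "f \<in> Arr M \<Longrightarrow> Dom C (FArr G f) = FObj G (Dom M f)"
  "f \<in> Arr M \<Longrightarrow> Cod C (FArr G f) = FObj G (Cod M f)"
  "FUnit G \<in> Arr C" "Dom C (FUnit G) = i" "Cod C (FUnit G) = FObj G j" "iso C (FUnit G)"
  "m \<in> Obj M \<Longrightarrow> n \<in> Obj M \<Longrightarrow> FTen G m n \<in> Arr C"
  "m \<in> Obj M \<Longrightarrow> n \<in> Obj M \<Longrightarrow> Dom C (FTen G m n) = FObj G m \<otimes>\<^sub>C FObj G n"
  "m \<in> Obj M \<Longrightarrow> n \<in> Obj M \<Longrightarrow> Cod C (FTen G m n) = FObj G (m \<otimes>\<^sub>M n)"
  "m \<in> Obj M \<Longrightarrow> n \<in> Obj M \<Longrightarrow> iso C (FTen G m n)"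
  "m \<in> Obj M \<Longrightarrow> n \<in> Obj M \<Longrightarrow> inv_arr (sym_center C) (FTen G m n) = inv_arr C (FTen G m n)"
  using G.fobj[of m] sym_center_obj_obj[OF braided_C] G.farr_simps[of f] G.funit_simps G.ften_simps[of m n]
    sym_center_isoD[OF braided_C G.funit_iso] sym_center_isoD[OF braided_C G.ften_iso]
  by simp_all

lemma T_simps [simp]:
  assumes "m \<in> Obj M" "c \<in> Obj C"
  shows "T m c \<in> Arr C" "Dom C (T m c) = FObj G m \<otimes>\<^sub>C c" "Cod C (T m c) = ActO A m c" "iso C (T m c)"
  using act_morphism_theta[OF morphism] assms by simp_all

lemma T_nat:
  assumes "f \<in> Arr M" "h \<in> Arr C" "Dom M f = m" "Cod M f = m'" "Dom C h = c" "Cod C h = c'"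
  shows "T m' c' \<cdot>\<^sub>C (FArr G f \<odot>\<^sub>C h) = ActA A f h \<cdot>\<^sub>C T m c"
proof -
  interpret natural_isomorphism "prod_cat M C" C "act_func (restrict_act G (sym_center C) C (sym_center_act C))"
    "act_func A" "\<lambda>(m, c). T m c"
    using morphism by (simp add: act_morphism_def action_isomorphism_def)
  show ?thesis using nat[of "(f, h)" "(m, c)" "(m', c')"] assms by simp
qed

lemma T_unit:
  assumes [simp]: "c \<in> Obj C"
  shows "T j c \<cdot>\<^sub>C (FUnit G \<odot>\<^sub>C Ide C c) = Eta A c \<cdot>\<^sub>C Lun C c"
proof -
  have "T j c \<cdot>\<^sub>C (FUnit G \<odot>\<^sub>C Ide C c) \<cdot>\<^sub>C inv_arr C (Lun C c) = Eta A c"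
    using morphism assms by (simp add: act_morphism_def action_isomorphism_def)
  from this[symmetric] show ?thesis by simp
qed

text \<open>Compatibility with multiplicators, freed of the inverse associator and with the inner
  identification moved through \<open>T m\<close> by naturality.\<close>

lemma T_mult:
  assumes [simp]: "m \<in> Obj M" "n \<in> Obj M" "c \<in> Obj C"
  shows "T (m \<otimes>\<^sub>M n) c \<cdot>\<^sub>C (FTen G m n \<odot>\<^sub>C Ide C c) =
    Mult A m n c \<cdot>\<^sub>C T m (ActO A n c) \<cdot>\<^sub>C (Ide C (FObj G m) \<odot>\<^sub>C T n c) \<cdot>\<^sub>C Assoc C (FObj G m) (FObj G n) c"
proof -
  let ?A = "Assoc C (FObj G m) (FObj G n) c"
  have "T (m \<otimes>\<^sub>M n) c \<cdot>\<^sub>C (FTen G m n \<odot>\<^sub>C Ide C c) \<cdot>\<^sub>C inv_arr C ?A =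
      Mult A m n c \<cdot>\<^sub>C ActA A (Ide M m) (T n c) \<cdot>\<^sub>C T m (FObj G n \<otimes>\<^sub>C c)"
    using morphism assms by (simp add: act_morphism_def action_isomorphism_def)
  also have "\<dots> = Mult A m n c \<cdot>\<^sub>C T m (ActO A n c) \<cdot>\<^sub>C (Ide C (FObj G m) \<odot>\<^sub>C T n c)"
    using T_nat[of "Ide M m" "T n c" m m "FObj G n \<otimes>\<^sub>C c" "ActO A n c"] by simp
  finally have "(T (m \<otimes>\<^sub>M n) c \<cdot>\<^sub>C (FTen G m n \<odot>\<^sub>C Ide C c) \<cdot>\<^sub>C inv_arr C ?A) \<cdot>\<^sub>C ?A =
    (Mult A m n c \<cdot>\<^sub>C T m (ActO A n c) \<cdot>\<^sub>C (Ide C (FObj G m) \<odot>\<^sub>C T n c)) \<cdot>\<^sub>C ?A"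
    by simp
  then show ?thesis by simp
qed

lemma T_iota:
  assumes [simp]: "m \<in> Obj M" "n \<in> Obj M" "c \<in> Obj C" "d \<in> Obj C"
  shows "T (m \<otimes>\<^sub>M n) (c \<otimes>\<^sub>C d) \<cdot>\<^sub>C (FTen G m n \<odot>\<^sub>C Ide C (c \<otimes>\<^sub>C d)) =
    \<kappa> m n c d \<cdot>\<^sub>C (T m c \<odot>\<^sub>C T n d) \<cdot>\<^sub>C interchange C (FObj G m) (FObj G n) c d"
proof -
  let ?X = "FTen G m n \<odot>\<^sub>C Ide C (c \<otimes>\<^sub>C d)"
  have "(T m c \<odot>\<^sub>C T n d) \<cdot>\<^sub>C interchange C (FObj G m) (FObj G n) c d \<cdot>\<^sub>C
      (inv_arr C (FTen G m n) \<odot>\<^sub>C Ide C (c \<otimes>\<^sub>C d)) = Iota A m n c d \<cdot>\<^sub>C T (m \<otimes>\<^sub>M n) (c \<otimes>\<^sub>C d)"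
    using morphism assms by (simp add: act_morphism_def action_isomorphism_def)
  from this[symmetric] have "\<kappa> m n c d \<cdot>\<^sub>C (Iota A m n c d \<cdot>\<^sub>C T (m \<otimes>\<^sub>M n) (c \<otimes>\<^sub>C d)) \<cdot>\<^sub>C ?X =
    \<kappa> m n c d \<cdot>\<^sub>C (T m c \<odot>\<^sub>C T n d) \<cdot>\<^sub>C interchange C (FObj G m) (FObj G n) c d"
    by simp
  then show ?thesis by (simp add: \<kappa>_def)
qed

definition comparison :: "'m \<Rightarrow> 'a" where
  "comparison m = T m i \<cdot>\<^sub>C inv_arr C (Run C (FObj G m))"

lemma comparison_simps [simp]:
  assumes "m \<in> Obj M"
  shows "comparison m \<in> Arr C" "Dom C (comparison m) = FObj G m" "Cod C (comparison m) = ActO A m i"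
    "iso C (comparison m)"
  using assms by (simp_all add: comparison_def)

text \<open>By \<open>T_iota\<close> for the pairs \<open>(m, i)\<close> and \<open>(j, d)\<close>,
  the identification splits into \<open>T m i\<close>, which is \<open>comparison m\<close> up to a
  unitor, and \<open>T j d\<close>, which \<open>T_unit\<close> reduces to \<open>Eta A d\<close>.
  What remains is \<open>\<theta>\<close>.\<close>

lemma T_eq_\<theta>:
  assumes [simp]: "m \<in> Obj M" "d \<in> Obj C"
  shows "\<theta> m d \<cdot>\<^sub>C (comparison m \<odot>\<^sub>C Ide C d) = T m d"
\<comment> \<open>Precomposing with the unitors supplies the two unit objects: one becomes
  \<open>FObj G j\<close> through \<open>FUnit G\<close>, the other is the argument of
  \<open>T m i\<close>.\<close>
proof (rule C.iso_cancel_right[of "Run C (FObj G m) \<odot>\<^sub>C Lun C d"])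
  let ?m = "FObj G m" and ?RL = "ActA A (Run M m) (Lun C d) \<cdot>\<^sub>C \<kappa> m j i d"
  let ?e = "(Ide C ?m \<odot>\<^sub>C FUnit G) \<odot>\<^sub>C Ide C (i \<otimes>\<^sub>C d)"
  have u: "(Run C ?m \<odot>\<^sub>C Lun C d) \<cdot>\<^sub>C interchange C ?m i i d = Run C ?m \<odot>\<^sub>C Lun C d"
  proof -
    have "Run C ?m \<odot>\<^sub>C Lun C d = ((Run C ?m \<odot>\<^sub>C Lun C d) \<cdot>\<^sub>C interchange C ?m i i d \<cdot>\<^sub>C
        (inv_arr C (Run C ?m) \<odot>\<^sub>C inv_arr C (Lun C d))) \<cdot>\<^sub>C (Run C ?m \<odot>\<^sub>C Lun C d)"
      by (subst C.interchange_unit) auto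
    then show ?thesis by simp
  qed
  have int: "interchange C ?m (FObj G j) i d \<cdot>\<^sub>C ((Ide C ?m \<odot>\<^sub>C FUnit G) \<odot>\<^sub>C (Ide C i \<odot>\<^sub>C Ide C d)) =
      ((Ide C ?m \<odot>\<^sub>C Ide C i) \<odot>\<^sub>C (FUnit G \<odot>\<^sub>C Ide C d)) \<cdot>\<^sub>C interchange C ?m i i d"
    by (rule C.interchange_natural) auto
  have run: "FArr G (Run M m) \<cdot>\<^sub>C FTen G m j \<cdot>\<^sub>C (Ide C ?m \<odot>\<^sub>C FUnit G) = Run C ?m"
    using G.ften_run[of m] by simp
  have "T m d \<cdot>\<^sub>C (Run C ?m \<odot>\<^sub>C Lun C d) =
      (T m d \<cdot>\<^sub>C (FArr G (Run M m) \<odot>\<^sub>C Lun C d)) \<cdot>\<^sub>C (FTen G m j \<odot>\<^sub>C Ide C (i \<otimes>\<^sub>C d)) \<cdot>\<^sub>C ?e"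
    unfolding run[symmetric] by simp
  also have "\<dots> = ActA A (Run M m) (Lun C d) \<cdot>\<^sub>C (T (m \<otimes>\<^sub>M j) (i \<otimes>\<^sub>C d) \<cdot>\<^sub>C (FTen G m j \<odot>\<^sub>C Ide C (i \<otimes>\<^sub>C d))) \<cdot>\<^sub>C ?e"
    by (subst T_nat) auto
  also have "\<dots> = ?RL \<cdot>\<^sub>C (T m i \<odot>\<^sub>C T j d) \<cdot>\<^sub>C (interchange C ?m (FObj G j) i d \<cdot>\<^sub>C
      ((Ide C ?m \<odot>\<^sub>C FUnit G) \<odot>\<^sub>C (Ide C i \<odot>\<^sub>C Ide C d)))"
    by (subst T_iota) auto
  also have "\<dots> = ?RL \<cdot>\<^sub>C (T m i \<odot>\<^sub>C (T j d \<cdot>\<^sub>C (FUnit G \<odot>\<^sub>C Ide C d))) \<cdot>\<^sub>C interchange C ?m i i d"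
    unfolding int by simp
  also have "\<dots> = ?RL \<cdot>\<^sub>C (comparison m \<odot>\<^sub>C Eta A d) \<cdot>\<^sub>C ((Run C ?m \<odot>\<^sub>C Lun C d) \<cdot>\<^sub>C interchange C ?m i i d)"
    by (simp add: T_unit comparison_def)
  also have "\<dots> = (\<theta> m d \<cdot>\<^sub>C (comparison m \<odot>\<^sub>C Ide C d)) \<cdot>\<^sub>C (Run C ?m \<odot>\<^sub>C Lun C d)"
    unfolding u by (simp add: \<theta>_def)
  finally show "(\<theta> m d \<cdot>\<^sub>C (comparison m \<odot>\<^sub>C Ide C d)) \<cdot>\<^sub>C (Run C ?m \<odot>\<^sub>C Lun C d) = T m d \<cdot>\<^sub>C (Run C ?m \<odot>\<^sub>C Lun C d)" ..
qed auto

lemma comparison_nat: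
  assumes [simp]: "f \<in> Arr M"
  shows "ActA A f (Ide C i) \<cdot>\<^sub>C comparison (Dom M f) = comparison (Cod M f) \<cdot>\<^sub>C FArr G f"
proof -
  have "comparison (Cod M f) \<cdot>\<^sub>C FArr G f =
      (T (Cod M f) i \<cdot>\<^sub>C (FArr G f \<odot>\<^sub>C Ide C i)) \<cdot>\<^sub>C inv_arr C (Run C (FObj G (Dom M f)))"
    by (simp add: comparison_def C.run_inv_nat)
  also have "\<dots> = ActA A f (Ide C i) \<cdot>\<^sub>C comparison (Dom M f)"
    by (subst T_nat) (auto simp: comparison_def)
  finally show ?thesis ..
qed

lemma comparison_unit: "comparison j \<cdot>\<^sub>C FUnit G = Eta A i"
proof -
  have "comparison j \<cdot>\<^sub>C FUnit G = (T j i \<cdot>\<^sub>C (FUnit G \<odot>\<^sub>C Ide C i)) \<cdot>\<^sub>C inv_arr C (Run C i)"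
    by (simp add: comparison_def C.run_inv_nat)
  also have "\<dots> = Eta A i" unfolding T_unit[OF C.unit_obj] by (simp add: C.lun_unit)
  finally show ?thesis .
qed

text \<open>\<open>T_mult\<close> at \<open>c = i\<close> involves \<open>T m\<close> at
  \<open>n \<bullet> i\<close>, a component away from the unit. \<open>T_eq_\<theta>\<close>
  expresses it by \<open>\<theta>\<close>, and \<open>mult_\<theta>\<close> then turns the
  multiplicator into \<open>\<phi>\<close>.\<close>

lemma comparison_tensor:
  assumes [simp]: "m \<in> Obj M" "n \<in> Obj M"
  shows "comparison (m \<otimes>\<^sub>M n) \<cdot>\<^sub>C FTen G m n = \<phi> m n \<cdot>\<^sub>C (comparison m \<odot>\<^sub>C comparison n)"
proof -
  let ?m = "FObj G m" and ?n = "FObj G n" and ?X = "ActO A n i"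
  have run: "Assoc C ?m ?n i \<cdot>\<^sub>C inv_arr C (Run C (?m \<otimes>\<^sub>C ?n)) = Ide C ?m \<odot>\<^sub>C inv_arr C (Run C ?n)"
    by (simp add: C.run_tensor[symmetric] C.inv_comp C.inv_tensor)
  have "comparison (m \<otimes>\<^sub>M n) \<cdot>\<^sub>C FTen G m n =
      (T (m \<otimes>\<^sub>M n) i \<cdot>\<^sub>C (FTen G m n \<odot>\<^sub>C Ide C i)) \<cdot>\<^sub>C inv_arr C (Run C (?m \<otimes>\<^sub>C ?n))"
    by (simp add: comparison_def C.run_inv_nat)
  also have "\<dots> = Mult A m n i \<cdot>\<^sub>C T m ?X \<cdot>\<^sub>C (Ide C ?m \<odot>\<^sub>C T n i) \<cdot>\<^sub>C (Assoc C ?m ?n i \<cdot>\<^sub>C inv_arr C (Run C (?m \<otimes>\<^sub>C ?n)))"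
    by (subst T_mult) auto
  also have "\<dots> = Mult A m n i \<cdot>\<^sub>C (\<theta> m ?X \<cdot>\<^sub>C (comparison m \<odot>\<^sub>C Ide C ?X)) \<cdot>\<^sub>C (Ide C ?m \<odot>\<^sub>C comparison n)"
    unfolding run by (subst T_eq_\<theta>) (auto simp: comparison_def)
  also have "\<dots> = (Mult A m n i \<cdot>\<^sub>C \<theta> m ?X) \<cdot>\<^sub>C (comparison m \<odot>\<^sub>C comparison n)"
    by simp
  also have "\<dots> = \<phi> m n \<cdot>\<^sub>C (comparison m \<odot>\<^sub>C comparison n)"
    by (subst mult_\<theta>) (auto simp: \<phi>_def)
  finally show ?thesis .
qed

lemma comparison_2cell:
  "act_2cell C M (sym_center C) (sym_center_act C) G classifier (\<lambda>m\<in>Obj M. comparison m)"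
proof -
  interpret F: strong_braided_monoidal_functor M "sym_center C" classifier by (rule classifier_braided)
  have "monoidal_transformation M (sym_center C) G classifier (\<lambda>m\<in>Obj M. comparison m)"
    by (rule monoidal_transformationI[OF G.strong_monoidal_functor_axioms F.strong_monoidal_functor_axioms])
      (simp_all add: comparison_nat comparison_unit comparison_tensor)
  then show ?thesis by (simp add: act_2cell_def T_eq_\<theta>)
qed

text \<open>At \<open>c = i\<close> the condition on 2-cells determines
  \<open>\<sigma> m \<odot> i\<close>, as \<open>\<theta> m i\<close> is invertible, and tensoring
  with the unit is faithful.\<close>

lemma comparison_unique:
  assumes "act_2cell C M (sym_center C) (sym_center_act C) G classifier \<sigma>" and [simp]: "m \<in> Obj M"
  shows "\<sigma> m = comparison m"
proof (rule C.tensor_unit_faithful)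
  interpret \<sigma>: monoidal_transformation M "sym_center C" G classifier \<sigma>
    using assms by (simp add: act_2cell_def)
  have [simp]: "\<sigma> m \<in> Arr C" "Dom C (\<sigma> m) = FObj G m" "Cod C (\<sigma> m) = ActO A m i"
    using \<sigma>.component_simps[of m] by simp_all
  show "\<sigma> m \<in> hom C (FObj G m) (ActO A m i)" "comparison m \<in> hom C (FObj G m) (ActO A m i)"
    by (simp_all add: hom_def)
  have "\<theta> m i \<cdot>\<^sub>C (\<sigma> m \<odot>\<^sub>C Ide C i) = \<theta> m i \<cdot>\<^sub>C (comparison m \<odot>\<^sub>C Ide C i)"
    using assms by (simp add: act_2cell_def T_eq_\<theta>)
  then show "\<sigma> m \<odot>\<^sub>C Ide C i = comparison m \<odot>\<^sub>C Ide C i"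
    by (rule C.iso_cancel_left[rotated]) auto
qed

lemma hom_classifier:
  fixes H defines "H \<equiv> act_hom_cat C M A (sym_center C) (sym_center_act C)"
  shows "\<exists>\<tau>. hom H G classifier = {\<tau>} \<and> iso H \<tau>"
proof -
  note S = sym_center_braided_action[OF braided_C]
  let ?\<tau> = "(G, classifier, \<lambda>m\<in>Obj M. comparison m)"
  have arr: "?\<tau> \<in> Arr H"
    unfolding H_def act_hom_cat_simps[OF S] by (simp add: morphism classifier_morphism comparison_2cell)
  have "f = ?\<tau>" if "f \<in> hom H G classifier" for f
    using that by (cases f)
      (auto simp: H_def hom_def act_hom_cat_simps[OF S] comparison_unique intro!: extensionalityI[of _ "Obj M"])
  then have "hom H G classifier = {?\<tau>}"
    using arr by (auto simp: hom_def H_def act_hom_cat_simps[OF S])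
  moreover have "iso H ?\<tau>"
    unfolding H_def by (rule iso_act_hom_cat[OF S arr[unfolded H_def]]) simp
  ultimately show ?thesis by blast
qed

end

theorem theorem5p5p9:
  fixes C :: "('o, 'a) brmoncat"
  assumes "braided_monoidal_category C"
  shows "braided_action (sym_center C) C (sym_center_act C) \<and>
    (\<forall>(M :: ('m, 'f) brmoncat) (A :: ('m, 'f, 'o, 'a) act).
       braided_action M C A \<longrightarrow>
         (\<exists>F. act_morphism C M A (sym_center C) (sym_center_act C) F \<and>
            (\<forall>G. act_morphism C M A (sym_center C) (sym_center_act C) G \<longrightarrow>
               (\<exists>\<tau>. hom (act_hom_cat C M A (sym_center C) (sym_center_act C)) G F = {\<tau>} \<and>
                    iso (act_hom_cat C M A (sym_center C) (sym_center_act C)) \<tau>))) \<and>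
         equivalent_categories (act_hom_cat C M A (sym_center C) (sym_center_act C)) one_cat)"
proof (intro conjI allI impI)
  show S: "braided_action (sym_center C) C (sym_center_act C)"
    by (rule sym_center_braided_action[OF assms])
  fix M :: "('m, 'f) brmoncat" and A :: "('m, 'f, 'o, 'a) act"
  assume A: "braided_action M C A"
  let ?H = "act_hom_cat C M A (sym_center C) (sym_center_act C)" and ?F = "braided_action.classifier M C A"
  have F: "act_morphism C M A (sym_center C) (sym_center_act C) ?F"
    by (rule braided_action.classifier_morphism[OF A])
  have hom: "\<exists>\<tau>. hom ?H G ?F = {\<tau>} \<and> iso ?H \<tau>"
    if "act_morphism C M A (sym_center C) (sym_center_act C) G" for G
  proof -
    interpret action_morphism_to_center M C A G
      using A that by (simp add: action_morphism_to_center_def action_morphism_to_center_axioms_def)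
    show ?thesis by (rule hom_classifier)
  qed
  show "\<exists>F. act_morphism C M A (sym_center C) (sym_center_act C) F \<and>
      (\<forall>G. act_morphism C M A (sym_center C) (sym_center_act C) G \<longrightarrow> (\<exists>\<tau>. hom ?H G F = {\<tau>} \<and> iso ?H \<tau>))"
    using F hom by blast
  \<comment> \<open>The unique invertible arrows into the classifier contract the hom-category to a
    point.\<close>
  show "equivalent_categories ?H one_cat"
    using F hom by (intro equivalent_one_cat[OF category_act_hom_cat[OF S], of ?F])
      (auto simp: act_hom_cat_simps[OF S])
qed

end
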